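(* Let $\mathbb{F}$ be a field, $K$ a finite simplicial complex, $P$ a finite poset, and $F : P \to \nabla K$ a cofiltration. Let $d$ be a degree, and let $\phi$ be any free presentation of the cohomology persistence module $H^d_{\mathrm{c}} |F| : P \to \mathsf{Vec}$. Then $\partial ZB^d F \sim \partial ZB\phi$; that is, $\partial ZB^d F[a,b] = \partial ZB\phi[a,b]$ for all $a < b$ in $P$.
   Context: Posets. For a poset $P$, $\mathrm{Int}\, P$ is the poset of intervals $[a,b]$ with $a \le b$ in $P$, with the product order: $[a,b] \le [c,d]$ iff $a \le c$ and $b \le d$. For a finite poset $Q$ and $m : Q \to \mathbb{Z}$, the Möbius inversion $\partial m : Q \to \mathbb{Z}$ is the unique function with $m(b) = \sum_{a \le b} \partial m(a)$ for all $b \in Q$. Two functions $m, n : \mathrm{Int}\, P \to \mathbb{Z}$ are equivalent, written $m \sim n$, if $m[a,b] = n[a,b]$ for all $a < b$ in $P$. Cofiltrations. A supcomplex of $K$ is a set of simplices $A \subseteq K$ such that $\sigma \in A$ and $\sigma \le \tau$ (i.e. $\sigma$ is a face of $\tau$) in $K$ imply $\tau \in A$; $\nabla K$ is the poset of supcomplexes ordered by inclusion. A cofiltration of $K$ indexed by $P$ is a monotone function $F : P \to \nabla K$. Let $C_\bullet F(a)$ be the chain complex over $\mathbb{F}$ generated by the simplices in $F(a)$, with the simplicial boundary operator in which every face not in $F(a)$ is sent to $0$. For $a \le b$ there is a surjective chain map $C_\bullet F(b) \to C_\bullet F(a)$ sending a simplex to itself if it is in $F(a)$ and to $0$ otherwise.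 Let $C^\bullet F(a) = \mathrm{Hom}(C_\bullet F(a), \mathbb{F})$, with cocycle spaces $Z^d F(a)$ and coboundary spaces $B^d F(a)$; for $a \le b$ dualizing gives an injective cochain map $C^\bullet F(a) \hookrightarrow C^\bullet F(b)$, via which $Z^d F(a)$ is regarded as a subspace of $Z^d F(b)$. The $d$-th birth-death function $ZB^d F : \mathrm{Int}\, P \to \mathbb{Z}$ is $ZB^d F[a,b] = \dim_{\mathbb{F}}\big(Z^d F(a) \cap B^d F(b)\big)$, the intersection being taken in $Z^d F(b)$. Persistence modules. $\mathsf{Vec}$ is the category of finite dimensional $\mathbb{F}$-vector spaces. A $P$-module (persistence module) is a functor $M : P \to \mathsf{Vec}$. For $a \in P$, $\mathbb{F}^{\uparrow a}$ is the $P$-module with $\mathbb{F}^{\uparrow a}(b) = \mathbb{F}$ if $a \le b$ and $0$ otherwise, and $\mathbb{F}^{\uparrow a}(b \le c) = 1_{\mathbb{F}}$ for all $a \le b \le c$. A $P$-module is free if it is a direct sum of modules of the form $\mathbb{F}^{\uparrow a}$. A (free) presentation of $M$ is a surjective natural transformation $\phi : E \Rightarrow M$ from a free $P$-module $E$. Its birth-death function $ZB\phi : \mathrm{Int}\, P \to \mathbb{Z}$ is $ZB\phi[a,b] = \dim_{\mathbb{F}}\big(E(a) \cap \ker \phi_b\big)$, where $E(a)$ is regarded as a subspace of $E(b)$ via the injective map $E(a \le b)$. Cohomology with compact support. For a topological space $X$, $H^d_{\mathrm{c}}(X)$ is the colimit over compact subsets $A \subseteq X$, ordered by inclusion, of the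 relative singular cohomology groups $H^d(X, X \setminus A)$ with $\mathbb{F}$-coefficients. If $X$ is an open subset of a space $Y$, the excision isomorphisms $H^d(X, X\setminus A) \cong H^d(Y, Y \setminus A)$ for compact $A \subseteq X$ induce a canonical map $H^d_{\mathrm{c}}(X) \to H^d_{\mathrm{c}}(Y)$. For a supcomplex $A$ of $K$, the underlying space $|A| \subseteq |K|$ is the union of the open simplices belonging to $A$, an open subset of $|K|$. The cohomology persistence module $H^d_{\mathrm{c}}|F| : P \to \mathsf{Vec}$ sends $a$ to $H^d_{\mathrm{c}}(|F(a)|)$ and $a \le b$ to the canonical map $H^d_{\mathrm{c}}(|F(a)|) \to H^d_{\mathrm{c}}(|F(b)|)$. *)

theory Defs
  imports
    "HOL-Homology.Homology"
    "HOL-Library.Product_Order"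
    "Jordan_Normal_Form.VS_Connect"
begin

text \<open>
  The coefficient field is a type of class \<open>field\<close>.  Vector spaces are \<open>HOL-Algebra\<close> module
  records satisfying \<open>vectorspace class_ring\<close>, with the dimension of that locale; a vector space
  of functions on a set \<open>S\<close> is a subspace of \<open>func_space S\<close>, so its elements are extensional on \<open>S\<close>.
\<close>

abbreviation fun_space :: "'x set \<Rightarrow> ('f::field, 'x \<Rightarrow> 'f) module"
  where "fun_space S \<equiv> LinearCombinations.ring.func_space class_ring S"

definition quotient_space :: "('f, 'm) module \<Rightarrow> 'm set \<Rightarrow> ('f, 'm set) module"
  where "quotient_space V W =
    \<lparr>carrier = a_rcosets\<^bsub>V\<^esub> W, mult = undefined, one = undefined,
     zero = W, add = (<+>\<^bsub>V\<^esub>),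
     smult = (\<lambda>c X. \<Union>x\<in>X. W +>\<^bsub>V\<^esub> (c \<odot>\<^bsub>V\<^esub> x))\<rparr>"


section \<open>Moebius inversion\<close>

definition moebius_inversion :: "'q::order set \<Rightarrow> ('q \<Rightarrow> int) \<Rightarrow> 'q \<Rightarrow> int"
  where "moebius_inversion Q m =
    (THE f. f \<in> extensional Q \<and> (\<forall>b\<in>Q. m b = (\<Sum>a\<in>{a\<in>Q. a \<le> b}. f a)))"

text \<open>
  The interval \<open>[a,b]\<close> is the pair \<open>(a,b)\<close>; the order on pairs is the componentwise one of
  \<open>HOL-Library.Product_Order\<close>.
\<close>

definition Int_poset :: "('p::order \<times> 'p) set"
  where "Int_poset = {(a, b). a \<le> b}"

definition int_equiv :: "('p::order \<times> 'p \<Rightarrow> int) \<Rightarrow> ('p \<times> 'p \<Rightarrow> int) \<Rightarrow> bool"  (infix \<open>\<sim>\<^sub>I\<close> 50)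
  where "m \<sim>\<^sub>I n \<longleftrightarrow> (\<forall>a b. a < b \<longrightarrow> m (a, b) = n (a, b))"


section \<open>Cofiltrations and their cochains\<close>

definition finite_simplicial_complex :: "'v set set \<Rightarrow> bool"
  where "finite_simplicial_complex K \<longleftrightarrow>
    finite K \<and> (\<forall>\<sigma>\<in>K. finite \<sigma> \<and> \<sigma> \<noteq> {}) \<and>
    (\<forall>\<tau>\<in>K. \<forall>\<sigma>. \<sigma> \<noteq> {} \<and> \<sigma> \<subseteq> \<tau> \<longrightarrow> \<sigma> \<in> K)"

definition supcomplex :: "'v set set \<Rightarrow> 'v set set \<Rightarrow> bool"
  where "supcomplex K A \<longleftrightarrow> A \<subseteq> K \<and> (\<forall>\<sigma>\<in>A. \<forall>\<tau>\<in>K. \<sigma> \<subseteq> \<tau> \<longrightarrow> \<tau> \<in> A)"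

definition cofiltration :: "'v set set \<Rightarrow> ('p::order \<Rightarrow> 'v set set) \<Rightarrow> bool"
  where "cofiltration K F \<longleftrightarrow> mono F \<and> (\<forall>a. supcomplex K (F a))"

text \<open>
  A chain over \<open>A\<close> is its coefficient function.  Simplices are oriented by the linear order on
  the vertices: the face of \<open>\<tau>\<close> opposite to \<open>v\<close> has sign \<open>(-1)^i\<close>, where \<open>v\<close> is the \<open>i\<close>-th
  vertex of \<open>\<tau>\<close> counted from \<open>0\<close>.
\<close>

definition chains :: "nat \<Rightarrow> 'v set set \<Rightarrow> ('v set \<Rightarrow> 'f::field) set"
  where "chains d A = {x. \<forall>\<sigma>. x \<sigma> \<noteq> 0 \<longrightarrow> \<sigma> \<in> A \<and> card \<sigma> = Suc d}"

definition boundary :: "'v::linorder set set \<Rightarrow> ('v set \<Rightarrow> 'f::field) \<Rightarrow> 'v set \<Rightarrow> 'f"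
  where "boundary A x = (\<lambda>\<sigma>. if \<sigma> \<in> A
    then \<Sum>\<tau>\<in>A. \<Sum>v\<in>\<tau>. if \<tau> - {v} = \<sigma> then (-1) ^ card {u\<in>\<tau>. u < v} * x \<tau> else 0
    else 0)"

definition chain_projection :: "'v set set \<Rightarrow> ('v set \<Rightarrow> 'f::field) \<Rightarrow> 'v set \<Rightarrow> 'f"
  where "chain_projection A x = (\<lambda>\<sigma>. if \<sigma> \<in> A then x \<sigma> else 0)"

definition cochains :: "nat \<Rightarrow> 'v set set \<Rightarrow> (('v set \<Rightarrow> 'f::field) \<Rightarrow> 'f) set"
  where "cochains d A = {\<phi> \<in> extensional (chains d A).
    (\<forall>x\<in>chains d A. \<forall>y\<in>chains d A. \<phi> (\<lambda>\<sigma>. x \<sigma> + y \<sigma>) = \<phi> x + \<phi> y) \<and>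
    (\<forall>c. \<forall>x\<in>chains d A. \<phi> (\<lambda>\<sigma>. c * x \<sigma>) = c * \<phi> x)}"

definition coboundary ::
    "nat \<Rightarrow> 'v::linorder set set \<Rightarrow> (('v set \<Rightarrow> 'f::field) \<Rightarrow> 'f) \<Rightarrow> ('v set \<Rightarrow> 'f) \<Rightarrow> 'f"
  where "coboundary d A \<phi> = (\<lambda>x\<in>chains (Suc d) A. \<phi> (boundary A x))"

definition cocycles :: "nat \<Rightarrow> 'v::linorder set set \<Rightarrow> (('v set \<Rightarrow> 'f::field) \<Rightarrow> 'f) set"
  where "cocycles d A = {\<phi> \<in> cochains d A. coboundary d A \<phi> = (\<lambda>x\<in>chains (Suc d) A. 0)}"

definition coboundaries :: "nat \<Rightarrow> 'v::linorder set set \<Rightarrow> (('v set \<Rightarrow> 'f::field) \<Rightarrow> 'f) set"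
  where "coboundaries d A = (case d of
      0 \<Rightarrow> {\<lambda>x\<in>chains 0 A. 0}
    | Suc e \<Rightarrow> coboundary e A ` cochains e A)"

definition cochain_inclusion ::
    "nat \<Rightarrow> 'v set set \<Rightarrow> 'v set set \<Rightarrow> (('v set \<Rightarrow> 'f::field) \<Rightarrow> 'f) \<Rightarrow> ('v set \<Rightarrow> 'f) \<Rightarrow> 'f"
  where "cochain_inclusion d A B \<phi> = (\<lambda>x\<in>chains d B. \<phi> (chain_projection A x))"

definition ZB_cofiltration ::
    "'f::field itself \<Rightarrow> nat \<Rightarrow> ('p::order \<Rightarrow> 'v::linorder set set) \<Rightarrow> 'p \<times> 'p \<Rightarrow> int"
  where "ZB_cofiltration (_ :: 'f itself) d F = (\<lambda>(a, b). int (vectorspace.dim class_ring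
    ((fun_space (chains d (F b)) :: ('f, _) module)
      \<lparr>carrier := cochain_inclusion d (F a) (F b) ` cocycles d (F a) \<inter> coboundaries d (F b)\<rparr>)))"


section \<open>Persistence modules and free presentations\<close>

record ('p, 'f, 'm) pmodule =
  obj :: "'p \<Rightarrow> ('f, 'm) module"
  tr :: "'p \<Rightarrow> 'p \<Rightarrow> 'm \<Rightarrow> 'm"

definition persistence_module :: "('p::order, 'f::field, 'm) pmodule \<Rightarrow> bool"
  where "persistence_module M \<longleftrightarrow>
    (\<forall>a. vectorspace class_ring (obj M a) \<and> vectorspace.fin_dim class_ring (obj M a)) \<and>
    (\<forall>a b. a \<le> b \<longrightarrow> tr M a b \<in> module_hom class_ring (obj M a) (obj M b)) \<and>
    (\<forall>a. \<forall>x\<in>carrier (obj M a). tr M a a x = x) \<and>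
    (\<forall>a b c. a \<le> b \<and> b \<le> c \<longrightarrow>
      (\<forall>x\<in>carrier (obj M a). tr M a c x = tr M b c (tr M a b x)))"

definition natural_transformation ::
    "('p::order, 'f::field, 'm) pmodule \<Rightarrow> ('p, 'f, 'n) pmodule \<Rightarrow> ('p \<Rightarrow> 'm \<Rightarrow> 'n) \<Rightarrow> bool"
  where "natural_transformation M N \<eta> \<longleftrightarrow>
    (\<forall>a. \<eta> a \<in> module_hom class_ring (obj M a) (obj N a)) \<and>
    (\<forall>a b. a \<le> b \<longrightarrow> (\<forall>x\<in>carrier (obj M a). \<eta> b (tr M a b x) = tr N a b (\<eta> a x)))"

definition pmodule_isomorphic ::
    "('p::order, 'f::field, 'm) pmodule \<Rightarrow> ('p, 'f, 'n) pmodule \<Rightarrow> bool"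
  where "pmodule_isomorphic M N \<longleftrightarrow> (\<exists>\<eta>. natural_transformation M N \<eta> \<and>
    (\<forall>a. bij_betw (\<eta> a) (carrier (obj M a)) (carrier (obj N a))))"

definition up_module :: "'p::order \<Rightarrow> ('p, 'f::field, 'f) pmodule"
  where "up_module a =
    \<lparr>obj = (\<lambda>b. \<lparr>carrier = (if a \<le> b then UNIV else {0}), mult = (*), one = 1,
       zero = 0, add = (+), smult = (*)\<rparr>),
     tr = (\<lambda>b c x. if a \<le> b \<and> b \<le> c then x else 0)\<rparr>"

definition direct_sum ::
    "'i set \<Rightarrow> ('i \<Rightarrow> ('p, 'f, 'm) pmodule) \<Rightarrow> ('p, 'f, 'i \<Rightarrow> 'm) pmodule"
  where "direct_sum I M =
    \<lparr>obj = (\<lambda>a. \<lparr>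
       carrier = {x \<in> \<Pi>\<^sub>E i\<in>I. carrier (obj (M i) a). finite {i\<in>I. x i \<noteq> \<zero>\<^bsub>obj (M i) a\<^esub>}},
       mult = undefined, one = undefined,
       zero = (\<lambda>i\<in>I. \<zero>\<^bsub>obj (M i) a\<^esub>),
       add = (\<lambda>x y. \<lambda>i\<in>I. x i \<oplus>\<^bsub>obj (M i) a\<^esub> y i),
       smult = (\<lambda>c x. \<lambda>i\<in>I. c \<odot>\<^bsub>obj (M i) a\<^esub> x i)\<rparr>),
     tr = (\<lambda>a b x. \<lambda>i\<in>I. tr (M i) a b (x i))\<rparr>"

text \<open>
  Index sets of natural numbers suffice: since the spaces of a persistence module are finite
  dimensional, only finitely many summands \<open>up_module c\<close> can be nonzero at each of the finitely
  many elements of the poset.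
\<close>

definition free_module :: "('p::{finite, order}, 'f::field, 'm) pmodule \<Rightarrow> bool"
  where "free_module E \<longleftrightarrow> persistence_module E \<and>
    (\<exists>(I :: nat set) g. pmodule_isomorphic E (direct_sum I (\<lambda>i. up_module (g i))))"

definition free_presentation ::
    "('p::{finite, order}, 'f::field, 'e) pmodule \<Rightarrow> ('p, 'f, 'm) pmodule \<Rightarrow> ('p \<Rightarrow> 'e \<Rightarrow> 'm) \<Rightarrow> bool"
  where "free_presentation E M \<phi> \<longleftrightarrow> free_module E \<and> natural_transformation E M \<phi> \<and>
    (\<forall>a. \<phi> a ` carrier (obj E a) = carrier (obj M a))"

definition ZB_presentation ::
    "('p, 'f::field, 'e) pmodule \<Rightarrow> ('p, 'f, 'm) pmodule \<Rightarrow> ('p \<Rightarrow> 'e \<Rightarrow> 'm) \<Rightarrow> 'p \<times> 'p \<Rightarrow> int"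
  where "ZB_presentation E M \<phi> = (\<lambda>(a, b). int (vectorspace.dim class_ring
    ((obj E b)\<lparr>carrier := tr E a b ` carrier (obj E a) \<inter>
       {x \<in> carrier (obj E b). \<phi> b x = \<zero>\<^bsub>obj M b\<^esub>}\<rparr>)))"


section \<open>Relative singular cohomology\<close>

text \<open>
  Relative cochains are the homomorphisms from the integral relative chain group
  \<open>C\<^sub>p(X) / C\<^sub>p(S)\<close> to the field, that is, the additive maps on \<open>C\<^sub>p(X)\<close> that vanish on \<open>C\<^sub>p(S)\<close>.
\<close>

definition sing_cochains :: "nat \<Rightarrow> 'a topology \<Rightarrow> 'a set \<Rightarrow> ('a chain \<Rightarrow> 'f::field) set"
  where "sing_cochains p X S = {\<phi> \<in> extensional (singular_chain_set p X).
    (\<forall>x y. singular_chain p X x \<and> singular_chain p X y \<longrightarrow> \<phi> (x + y) = \<phi> x + \<phi> y) \<and>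
    (\<forall>x. singular_chain p (subtopology X S) x \<longrightarrow> \<phi> x = 0)}"

definition sing_coboundary :: "nat \<Rightarrow> 'a topology \<Rightarrow> ('a chain \<Rightarrow> 'f::field) \<Rightarrow> 'a chain \<Rightarrow> 'f"
  where "sing_coboundary p X \<phi> = (\<lambda>x\<in>singular_chain_set (Suc p) X. \<phi> (chain_boundary (Suc p) x))"

definition sing_cocycles :: "nat \<Rightarrow> 'a topology \<Rightarrow> 'a set \<Rightarrow> ('a chain \<Rightarrow> 'f::field) set"
  where "sing_cocycles p X S =
    {\<phi> \<in> sing_cochains p X S. sing_coboundary p X \<phi> = (\<lambda>x\<in>singular_chain_set (Suc p) X. 0)}"

definition sing_coboundaries :: "nat \<Rightarrow> 'a topology \<Rightarrow> 'a set \<Rightarrow> ('a chain \<Rightarrow> 'f::field) set"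
  where "sing_coboundaries p X S = (case p of
      0 \<Rightarrow> {\<lambda>x\<in>singular_chain_set 0 X. 0}
    | Suc q \<Rightarrow> sing_coboundary q X ` sing_cochains q X S)"

definition sing_cohomology ::
    "nat \<Rightarrow> 'a topology \<Rightarrow> 'a set \<Rightarrow> ('f::field, ('a chain \<Rightarrow> 'f) set) module"
  where "sing_cohomology p X S = quotient_space
    ((fun_space (singular_chain_set p X))\<lparr>carrier := sing_cocycles p X S\<rparr>)
    (sing_coboundaries p X S)"

text \<open>
  For a subspace \<open>X\<close> of \<open>Y\<close> and \<open>S \<subseteq> T\<close>, the map \<open>H\<^sup>p(Y,T) \<rightarrow> H\<^sup>p(X,S)\<close> induced by the inclusion
  \<open>(X,S) \<rightarrow> (Y,T)\<close>; a class is the set of its representing cocycles.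
\<close>

definition sing_restriction ::
    "nat \<Rightarrow> 'a topology \<Rightarrow> 'a set \<Rightarrow> ('a chain \<Rightarrow> 'f::field) set \<Rightarrow> ('a chain \<Rightarrow> 'f) set"
  where "sing_restriction p X S c =
    (\<Union>\<phi>\<in>c. sing_coboundaries p X S +>\<^bsub>fun_space (singular_chain_set p X)\<^esub>
       restrict \<phi> (singular_chain_set p X))"


section \<open>Cohomology with compact support\<close>

text \<open>
  Colimit of a system of vector spaces \<open>M i\<close>, \<open>i \<in> I\<close>, over a directed set \<open>I\<close>, with maps
  \<open>f i j : M i \<rightarrow> M j\<close> for \<open>i \<le> j\<close>: its elements are the classes of pairs \<open>(i, x)\<close> with
  \<open>x \<in> M i\<close>, two pairs being identified if they become equal in some \<open>M k\<close>.
\<close>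

definition colim_rel ::
    "'i::order set \<Rightarrow> ('i \<Rightarrow> ('f, 'm) module) \<Rightarrow> ('i \<Rightarrow> 'i \<Rightarrow> 'm \<Rightarrow> 'm) \<Rightarrow> (('i \<times> 'm) \<times> ('i \<times> 'm)) set"
  where "colim_rel I M f = {((i, x), (j, y)). i \<in> I \<and> j \<in> I \<and>
    x \<in> carrier (M i) \<and> y \<in> carrier (M j) \<and> (\<exists>k\<in>I. i \<le> k \<and> j \<le> k \<and> f i k x = f j k y)}"

definition directed_colimit ::
    "'i::order set \<Rightarrow> ('i \<Rightarrow> ('f, 'm) module) \<Rightarrow> ('i \<Rightarrow> 'i \<Rightarrow> 'm \<Rightarrow> 'm) \<Rightarrow> ('f, ('i \<times> 'm) set) module"
  where "directed_colimit I M f =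
    \<lparr>carrier = (SIGMA i:I. carrier (M i)) // colim_rel I M f,
     mult = undefined, one = undefined,
     zero = (\<Union>i\<in>I. colim_rel I M f `` {(i, \<zero>\<^bsub>M i\<^esub>)}),
     add = (\<lambda>X Y. \<Union>(i, x)\<in>X. \<Union>(j, y)\<in>Y. \<Union>k\<in>{k\<in>I. i \<le> k \<and> j \<le> k}.
       colim_rel I M f `` {(k, f i k x \<oplus>\<^bsub>M k\<^esub> f j k y)}),
     smult = (\<lambda>c X. \<Union>(i, x)\<in>X. colim_rel I M f `` {(i, c \<odot>\<^bsub>M i\<^esub> x)})\<rparr>"

abbreviation cpt_objects ::
    "nat \<Rightarrow> 'a topology \<Rightarrow> 'a set \<Rightarrow> ('f::field, ('a chain \<Rightarrow> 'f) set) module"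
  where "cpt_objects p X A \<equiv> sing_cohomology p X (topspace X - A)"

abbreviation cpt_maps ::
    "nat \<Rightarrow> 'a topology \<Rightarrow> 'a set \<Rightarrow> 'a set \<Rightarrow> ('a chain \<Rightarrow> 'f::field) set \<Rightarrow> ('a chain \<Rightarrow> 'f) set"
  where "cpt_maps p X A B \<equiv> sing_restriction p X (topspace X - B)"

definition cpt_cohomology ::
    "nat \<Rightarrow> 'a topology \<Rightarrow> ('f::field, ('a set \<times> ('a chain \<Rightarrow> 'f) set) set) module"
  where "cpt_cohomology p X = directed_colimit {A. compactin X A} (cpt_objects p X) (cpt_maps p X)"

text \<open>
  The canonical map for an open subspace \<open>X\<close> of a Hausdorff space \<open>Y\<close> sends the class of
  \<open>x \<in> H\<^sup>p(X, X - A)\<close> to the class of its preimage under the excision isomorphism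
  \<open>H\<^sup>p(Y, Y - A) \<rightarrow> H\<^sup>p(X, X - A)\<close>.
\<close>

definition cpt_extension ::
    "nat \<Rightarrow> 'a topology \<Rightarrow> 'a topology \<Rightarrow>
     ('a set \<times> ('a chain \<Rightarrow> 'f::field) set) set \<Rightarrow> ('a set \<times> ('a chain \<Rightarrow> 'f) set) set"
  where "cpt_extension p X Y c =
    (\<Union>(A, x)\<in>c. colim_rel {A. compactin Y A} (cpt_objects p Y) (cpt_maps p Y) ``
      {(A, inv_into (carrier (cpt_objects p Y A)) (sing_restriction p X (topspace X - A)) x)})"


section \<open>The cohomology persistence module of a cofiltration\<close>

text \<open>Points of \<open>|K|\<close> are given by their barycentric coordinates, extended by zero.\<close>

definition open_simplex :: "'v set \<Rightarrow> ('v \<Rightarrow> real) set"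
  where "open_simplex \<sigma> = {x. (\<forall>v\<in>\<sigma>. 0 < x v) \<and> (\<forall>v. v \<notin> \<sigma> \<longrightarrow> x v = 0) \<and> sum x \<sigma> = 1}"

definition underlying_set :: "'v set set \<Rightarrow> ('v \<Rightarrow> real) set"
  where "underlying_set A = (\<Union>\<sigma>\<in>A. open_simplex \<sigma>)"

definition underlying_space :: "'v set set \<Rightarrow> 'v set set \<Rightarrow> ('v \<Rightarrow> real) topology"
  where "underlying_space K A =
    subtopology (subtopology (powertop_real UNIV) (underlying_set K)) (underlying_set A)"

definition cohomology_pmodule ::
    "nat \<Rightarrow> 'v set set \<Rightarrow> ('p \<Rightarrow> 'v set set) \<Rightarrow>
     ('p, 'f::field, (('v \<Rightarrow> real) set \<times> (('v \<Rightarrow> real) chain \<Rightarrow> 'f) set) set) pmodule"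
  where "cohomology_pmodule d K F =
    \<lparr>obj = (\<lambda>a. cpt_cohomology d (underlying_space K (F a))),
     tr = (\<lambda>a b. cpt_extension d (underlying_space K (F a)) (underlying_space K (F b)))\<rparr>"

end

theory Submission
  imports Defs
begin

text \<open>
  The two birth-death functions differ by a function of the left endpoint alone: for \<open>a \<le> b\<close>,
  \<open>ZB\<phi>[a,b] = ZB\<^sup>dF[a,b] + (dim E(a) - dim Z\<^sup>dF(a))\<close>.  The Moebius inversion of a function of
  \<open>[a,b]\<close> that depends on \<open>a\<close> only is concentrated on the intervals \<open>[a,a]\<close>, so the two
  inversions agree on all \<open>[a,b]\<close> with \<open>a < b\<close> (\<open>int_equiv_moebius_inversion\<close>).

  The difference comes from rank-nullity, applied twice (\<open>dim_kernel_in_image\<close>).  Write \<open>M\<close> for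
  the cohomology module.  Both \<open>E(a) \<rightarrow> E(b)\<close> and \<open>Z\<^sup>dF(a) \<rightarrow> Z\<^sup>dF(b)\<close> are injective, and both
  targets map onto \<open>M(b)\<close>, the first by \<open>\<phi>\<close> and the second by the map \<open>classify\<close> that
  sends a simplicial cocycle to its class, with kernel \<open>B\<^sup>dF(b)\<close>.  Both maps onto \<open>M\<close> are natural
  and surjective at \<open>a\<close>, so \<open>E(a)\<close> and \<open>Z\<^sup>dF(a)\<close> have the same image in \<open>M(b)\<close>, namely that of
  \<open>M(a)\<close>.  If \<open>r\<close> is its dimension, the birth-death functions at \<open>[a,b]\<close> are \<open>dim E(a) - r\<close> and
  \<open>dim Z\<^sup>dF(a) - r\<close>.

  It remains to construct \<open>classify\<close>, a natural surjection from the simplicial cocycles of a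
  supcomplex \<open>A\<close> to the compactly supported cohomology of the open set \<open>|A|\<close> whose kernel consists
  of the coboundaries (\<open>classify_surj\<close>, \<open>classify_eq_zero_iff\<close>, \<open>cpt_extension_classify\<close>).  By
  excision, every class on \<open>|A|\<close> is represented by a singular cocycle of \<open>|K|\<close> that vanishes
  away from a compact subset of \<open>|A|\<close>.  Such cocycles are compared with simplicial ones directly,
  at the level of cochains.

  Attach to each point of \<open>|K|\<close> a vertex at which its coordinate is large.  The vertices attached to
  the corners of a sufficiently small singular simplex \<open>s\<close> span a simplex of \<open>K\<close>, and all points of
  \<open>s\<close> have coordinates above a fixed bound \<open>mesh\<close> at these vertices.  A simplicial cochain can
  therefore be evaluated on small singular chains, and on all singular chains after composition with
  a retraction \<open>\<rho>\<close> onto the small ones; the result is \<open>realize\<close>.  If the simplicial cochain is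
  supported on \<open>A\<close>, its realization vanishes on chains that avoid the compact set
  \<open>thick A mesh \<subseteq> |A|\<close>.  In the other direction, \<open>sample\<close> evaluates a singular cochain on the
  affine simplices of \<open>K\<close>.  Sampling a realization returns the simplicial cochain itself
  (\<open>realize_geom_simplex\<close>, by Sperner's argument), which gives injectivity modulo coboundaries.
  Realizing a sampled cocycle changes it by a coboundary (\<open>realize_sample_cohomologous\<close>), which
  gives surjectivity; the coning homotopy behind this respects supports, because for
  \<open>\<delta> \<le> mesh\<close> it moves a small simplex that avoids \<open>thick A \<delta>\<close> only inside a set that still avoids it
  (\<open>join_hull_avoids_thick\<close>).
\<close>

section \<open>Small singular chains\<close>

definition small_chain :: "nat \<Rightarrow> 'a set set \<Rightarrow> 'a chain \<Rightarrow> bool"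
  where "small_chain p \<U> c \<longleftrightarrow> (\<forall>f\<in>Poly_Mapping.keys c. \<exists>U\<in>\<U>. f ` standard_simplex p \<subseteq> U)"

lemma small_chain_0 [simp]: "small_chain p \<U> 0"
  by (simp add: small_chain_def)

lemma small_chain_add: "small_chain p \<U> a \<Longrightarrow> small_chain p \<U> b \<Longrightarrow> small_chain p \<U> (a + b)"
  unfolding small_chain_def using keys_add[of a b] by blast

lemma small_chain_diff: "small_chain p \<U> a \<Longrightarrow> small_chain p \<U> b \<Longrightarrow> small_chain p \<U> (a - b)"
  unfolding small_chain_def using keys_diff[of a b] by blast

lemma small_chain_cmul: "small_chain p \<U> a \<Longrightarrow> small_chain p \<U> (frag_cmul k a)"
  unfolding small_chain_def using keys_cmul[of k a] by blast

lemma small_chain_sum: "(\<And>i. i \<in> I \<Longrightarrow> small_chain p \<U> (f i)) \<Longrightarrow> small_chain p \<U> (\<Sum>i\<in>I. f i)"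
  by (induction I rule: infinite_finite_induct) (auto intro: small_chain_add)

lemma small_chain_frag_of: "small_chain p \<U> (frag_of f) \<longleftrightarrow> (\<exists>U\<in>\<U>. f ` standard_simplex p \<subseteq> U)"
  by (simp add: small_chain_def)

lemma additive_cmul:
  assumes "Modules.additive T"
  shows "T (frag_cmul k x) = frag_cmul k (T x)"
proof -
  interpret Modules.additive T by fact
  have nat: "T (frag_cmul (int n) x) = frag_cmul (int n) (T x)" for n
    by (induction n) (auto simp: zero add frag_cmul_distrib)
  show ?thesis
    by (cases k rule: int_cases2) (use nat minus in \<open>metis minus_frag_cmul\<close>)+
qed

lemma additive_frag_extend: "Modules.additive (frag_extend f)"
  by unfold_locales (rule frag_extend_add)

lemma additive_chain_boundary: "Modules.additive (chain_boundary p)"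
  by unfold_locales (rule chain_boundary_add)

text \<open>
  A map on chains that does not leave any subspace maps a simplex inside a member \<open>U\<close>
  of the cover to a chain in \<open>U\<close>. This applies to the boundary, to subdivision and to
  the subdivision homotopy.
\<close>

lemma small_chain_natural:
  assumes T: "Modules.additive T"
    and nat: "\<And>U c. singular_chain p (subtopology X U) c \<Longrightarrow> singular_chain q (subtopology X U) (T c)"
    and c: "singular_chain p X c" "small_chain p \<U> c"
  shows "small_chain q \<U> (T c)"
proof -
  interpret Modules.additive T by fact
  have "Poly_Mapping.keys c \<subseteq> {f. singular_simplex p X f \<and> (\<exists>U\<in>\<U>. f ` standard_simplex p \<subseteq> U)}"
    using c unfolding singular_chain_def small_chain_def by blast
  then show ?thesis
  proof (induction rule: frag_induction)
    case (one f)
    then obtain U where U: "U \<in> \<U>" "singular_simplex p (subtopology X U) f"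
      by (auto simp: singular_simplex_subtopology)
    then have "singular_chain q (subtopology X U) (T (frag_of f))"
      by (simp add: nat singular_chain_of)
    with U show ?case
      unfolding small_chain_def singular_chain_subtopology by blast
  qed (auto simp: zero diff intro: small_chain_diff)
qed

lemma small_chain_boundary:
  assumes "singular_chain p X c" "small_chain p \<U> c"
  shows "small_chain (p - Suc 0) \<U> (chain_boundary p c)"
  using additive_chain_boundary singular_chain_boundary assms by (rule small_chain_natural)

text \<open>
  A chain map \<open>\<rho>\<close> onto the small chains together with a chain homotopy
  \<open>D\<close> from the identity to \<open>\<rho>\<close>. Both respect every subspace, and on
  small chains \<open>\<rho>\<close> is the identity and \<open>D\<close> is zero; hence
  precomposition with \<open>\<rho>\<close> is defined on relative cochains and extends a cochain
  that is only given on small chains.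
\<close>

locale small_retraction =
  fixes X :: "'a topology" and \<U> :: "'a set set" and \<rho> D :: "nat \<Rightarrow> 'a chain \<Rightarrow> 'a chain"
  assumes \<rho>_additive: "Modules.additive (\<rho> p)" and D_additive: "Modules.additive (D p)"
    and \<rho>_subspace: "singular_chain p (subtopology X S) c \<Longrightarrow> singular_chain p (subtopology X S) (\<rho> p c)"
    and D_subspace: "singular_chain p (subtopology X S) c \<Longrightarrow> singular_chain (Suc p) (subtopology X S) (D p c)"
    and \<rho>_small: "singular_chain p X c \<Longrightarrow> small_chain p \<U> (\<rho> p c)"
    and D_small: "singular_chain p X c \<Longrightarrow> small_chain p \<U> c \<Longrightarrow> D p c = 0"
    and homotopy: "singular_chain p X c \<Longrightarrow>
       chain_boundary (Suc p) (D p c) + D (p - Suc 0) (chain_boundary p c) = \<rho> p c - c"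
begin

lemma \<rho>_chain: "singular_chain p X c \<Longrightarrow> singular_chain p X (\<rho> p c)"
  using \<rho>_subspace[of p "topspace X"] by simp

lemma D_chain: "singular_chain p X c \<Longrightarrow> singular_chain (Suc p) X (D p c)"
  using D_subspace[of p "topspace X"] by simp

lemma \<rho>_boundary:
  assumes c: "singular_chain p X c"
  shows "chain_boundary p (\<rho> p c) = \<rho> (p - Suc 0) (chain_boundary p c)"
proof -
  have "\<rho> p c = c + chain_boundary (Suc p) (D p c) + D (p - Suc 0) (chain_boundary p c)"
    using homotopy[OF c] by (simp add: algebra_simps)
  then have 1: "chain_boundary p (\<rho> p c) = chain_boundary p c + chain_boundary p (D (p - Suc 0) (chain_boundary p c))"
    using chain_boundary_boundary_alt[OF D_chain[OF c]] by (simp add: chain_boundary_add)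
  show ?thesis
  proof (cases p)
    case 0
    then show ?thesis by (simp add: chain_boundary_def additive.zero[OF \<rho>_additive])
  next
    case (Suc q)
    have "chain_boundary q (chain_boundary p c) = 0"
      using chain_boundary_boundary_alt c Suc by blast
    with homotopy[of q "chain_boundary p c"] singular_chain_boundary[OF c] 1 show ?thesis
      by (simp add: Suc additive.zero[OF D_additive] algebra_simps)
  qed
qed

lemma \<rho>_id:
  assumes c: "singular_chain p X c" "small_chain p \<U> c"
  shows "\<rho> p c = c"
proof -
  have "D (p - Suc 0) (chain_boundary p c) = 0"
    using D_small[OF singular_chain_boundary[OF c(1)] small_chain_boundary[OF c]] .
  with homotopy[OF c(1)] D_small[OF c] show ?thesis by simp
qed

end

text \<open>
  The construction follows the proof of the small simplices theorem in Hatcher's \<open>Algebraic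
  Topology\<close>. Each simplex \<open>s\<close> is subdivided \<open>m(s)\<close> times, where
  \<open>m(s)\<close> suffices to make it small and is at least \<open>m\<close> of each face. Let
  \<open>D\<close> be the sum of the subdivision homotopy over the first \<open>m(s)\<close>
  iterated subdivisions of \<open>s\<close>; then \<open>\<rho>\<close> is forced by the homotopy
  formula. It is small because its correction terms are subdivision homotopies of faces that have
  already been made small.
\<close>

theorem small_retraction_exists:
  fixes X :: "'a topology"
  assumes opn: "\<forall>U\<in>\<U>. openin X U" and cov: "topspace X \<subseteq> \<Union>\<U>"
  obtains \<rho> D where "small_retraction X \<U> \<rho> D"
proof -
  obtain h :: "nat \<Rightarrow> 'a chain \<Rightarrow> 'a chain" where h0: "\<And>p. h p 0 = 0"
    and hdiff: "\<And>p c1 c2. h p (c1-c2) = h p c1 - h p c2"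
    and hch: "\<And>p X c. singular_chain p X c \<Longrightarrow> singular_chain (Suc p) X (h p c)"
    and hb: "\<And>p X c. singular_chain p X c
       \<Longrightarrow> chain_boundary (Suc p) (h p c) + h (p - Suc 0) (chain_boundary p c) = singular_subdivision p c - c"
    by (rule chain_homotopic_singular_subdivision) (rule that)
  have hadd: "Modules.additive (h p)" for p
  proof
    fix x y
    have "h p (x - (0 - y)) = h p x - (h p 0 - h p y)" by (simp only: hdiff)
    then show "h p (x + y) = h p x + h p y" by (simp add: h0)
  qed
  let ?Sd = singular_subdivision
  let ?sm = "\<lambda>p s. small_chain p \<U> (frag_of s)"
  have Sdadd: "Modules.additive (?Sd p ^^ n)" for p n
    by unfold_locales (induction n; simp add: singular_subdivision_add)
  have Sdch: "singular_chain p Y ((?Sd p ^^ n) c)" if "singular_chain p Y c" for p n c and Y :: "'a topology"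
    by (induction n) (auto simp: that singular_chain_singular_subdivision)
  have Sdb: "chain_boundary p ((?Sd p ^^ n) c) = (?Sd (p - Suc 0) ^^ n) (chain_boundary p c)"
    if "singular_chain p Y c" for p n c and Y :: "'a topology"
  proof (induction n)
    case (Suc n)
    have "singular_chain p Y ((?Sd p ^^ n) c)" using Sdch that .
    then show ?case using Suc by (simp add: chain_boundary_singular_subdivision)
  qed simp
  have "\<exists>n. singular_simplex p X s \<longrightarrow> (\<forall>m\<ge>n. small_chain p \<U> ((?Sd p ^^ m) (frag_of s)))" for p s
  proof (cases "singular_simplex p X s")
    case True
    then have "singular_chain p X (frag_of s)" by (simp add: singular_chain_of)
    from sufficient_iterated_singular_subdivision_exists[OF bspec[OF opn] cov this] obtain n where
      "\<And>m f. \<lbrakk>n \<le> m; f \<in> Poly_Mapping.keys ((?Sd p ^^ m) (frag_of s))\<rbrakk> \<Longrightarrow> \<exists>V \<in> \<U>. f \<in> (standard_simplex p) \<rightarrow> V"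
      by blast
    then have "\<forall>m\<ge>n. small_chain p \<U> ((?Sd p ^^ m) (frag_of s))"
      unfolding small_chain_def by (metis image_subset_iff_funcset)
    then show ?thesis by blast
  qed auto
  then obtain n0 where n0: "\<And>p s m. singular_simplex p X s \<Longrightarrow> n0 p s \<le> m \<Longrightarrow> small_chain p \<U> ((?Sd p ^^ m) (frag_of s))"
    by metis
  \<comment> \<open>Small simplices are not subdivided at all, which makes \<open>D\<close> vanish on small chains; other
    simplices are subdivided at least as often as their faces.\<close>
  define m where "m = rec_nat (\<lambda>s. if ?sm 0 s then 0 else n0 0 s)
     (\<lambda>p mp s. if ?sm (Suc p) s then 0 else
        max (n0 (Suc p) s) (Max ((\<lambda>k. mp (singular_face (Suc p) k s)) ` {..Suc p})))"
  have m_small: "m p s = 0" if "?sm p s" for p s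
    using that by (cases p) (auto simp: m_def)
  have m_n0: "n0 p s \<le> m p s" if "\<not> ?sm p s" for p s
    using that by (cases p) (auto simp: m_def)
  have face_small: "?sm (p - Suc 0) (singular_face p k s)"
    if s: "?sm p s" and that: "singular_simplex p X s" "1 \<le> p" "k \<le> p" for p k s
  proof -
    obtain U where U: "U \<in> \<U>" "s ` standard_simplex p \<subseteq> U"
      using s by (auto simp: small_chain_frag_of)
    then have "singular_simplex p (subtopology X U) s"
      using that by (simp add: singular_simplex_subtopology)
    from singular_simplex_singular_face[OF this] that U show ?thesis
      by (auto simp: small_chain_frag_of singular_simplex_subtopology)
  qed
  have m_face: "m (p - Suc 0) (singular_face p k s) \<le> m p s"
    if "singular_simplex p X s" "1 \<le> p" "k \<le> p" for p k s
  proof (cases "?sm p s")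
    case True
    with face_small[OF this that] show ?thesis by (simp add: m_small)
  next
    case False
    obtain q where q: "p = Suc q" using \<open>1 \<le> p\<close> by (cases p) auto
    have "m q (singular_face p k s) \<le> Max ((\<lambda>k. m q (singular_face p k s)) ` {..p})"
      using that by (intro Max_ge) auto
    also have "\<dots> \<le> m p s" using False unfolding q by (simp add: m_def)
    finally show ?thesis by (simp add: q)
  qed
  have Sd_small: "small_chain p \<U> ((?Sd p ^^ i) (frag_of s))"
    if "singular_simplex p X s" "m p s \<le> i" for p s i
  proof (cases "?sm p s")
    case True
    show ?thesis
      by (rule small_chain_natural[where X = X, OF Sdadd _ _ True])
         (auto simp: Sdch that singular_chain_of)
  next
    case False
    then show ?thesis using n0 m_n0 that order_trans by blast
  qed
  \<comment> \<open>The homotopy between the identity and the \<open>n\<close>-fold subdivision.\<close>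
  define H where "H p n c = (\<Sum>i<n. h p ((?Sd p ^^ i) c))" for p n c
  have Hadd: "Modules.additive (H p n)" for p n
    unfolding H_def
    by unfold_locales (simp add: additive.add[OF hadd] additive.add[OF Sdadd] sum.distrib)
  have Hch: "singular_chain (Suc p) Y (H p n c)" if "singular_chain p Y c" for p n c and Y :: "'a topology"
    unfolding H_def by (intro singular_chain_sum hch Sdch that)
  have Hb: "chain_boundary (Suc p) (H p n c) + H (p - Suc 0) n (chain_boundary p c) = (?Sd p ^^ n) c - c"
    if c: "singular_chain p X c" for p n c
  proof (induction n)
    case 0
    then show ?case by (simp add: H_def)
  next
    case (Suc n)
    have "chain_boundary (Suc p) (H p (Suc n) c) + H (p - Suc 0) (Suc n) (chain_boundary p c)
      = (chain_boundary (Suc p) (H p n c) + H (p - Suc 0) n (chain_boundary p c))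
        + (chain_boundary (Suc p) (h p ((?Sd p ^^ n) c)) + h (p - Suc 0) ((?Sd (p - Suc 0) ^^ n) (chain_boundary p c)))"
      by (simp add: H_def chain_boundary_add)
    also have "\<dots> = ((?Sd p ^^ n) c - c) + ((?Sd p ^^ Suc n) c - (?Sd p ^^ n) c)"
      using hb[OF Sdch[OF c], of n] by (simp add: Suc Sdb[OF c])
    finally show ?case by simp
  qed
  define D where "D p = frag_extend (\<lambda>s. H p (m p s) (frag_of s))" for p
  have Dadd: "Modules.additive (D p)" for p
    unfolding D_def by (rule additive_frag_extend)
  have Dch: "singular_chain (Suc p) Y (D p c)" if "singular_chain p Y c" for p c and Y :: "'a topology"
    unfolding D_def
    by (rule singular_chain_extend) (use that in \<open>auto simp: singular_chain_def intro!: Hch[unfolded singular_chain_def]\<close>)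
  define \<rho> where "\<rho> p c = c + chain_boundary (Suc p) (D p c) + D (p - Suc 0) (chain_boundary p c)" for p c
  have \<rho>add: "Modules.additive (\<rho> p)" for p
    unfolding \<rho>_def
    by unfold_locales (simp add: additive.add[OF Dadd] chain_boundary_add)
  have \<rho>ch: "singular_chain p Y (\<rho> p c)" if "singular_chain p Y c" for p c and Y :: "'a topology"
  proof (cases "p = 0")
    case True
    have "singular_chain p Y (chain_boundary (Suc p) (D p c))"
      using singular_chain_boundary[OF Dch[OF that]] by simp
    moreover have "D (p - Suc 0) (chain_boundary p c) = 0"
      using True by (simp add: chain_boundary_def additive.zero[OF Dadd])
    ultimately show ?thesis unfolding \<rho>_def by (simp add: that singular_chain_add)
  next
    case False
    have "singular_chain p Y (chain_boundary (Suc p) (D p c))"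
      using singular_chain_boundary[OF Dch[OF that]] by simp
    moreover have "singular_chain p Y (D (p - Suc 0) (chain_boundary p c))"
      using Dch[OF singular_chain_boundary[OF that]] False by simp
    ultimately show ?thesis unfolding \<rho>_def by (simp add: that singular_chain_add)
  qed
  have \<rho>simplex: "small_chain p \<U> (\<rho> p (frag_of s))" if s: "singular_simplex p X s" for p s
  proof -
    have sc: "singular_chain p X (frag_of s)" using s by (simp add: singular_chain_of)
    have Ds: "D p (frag_of s) = H p (m p s) (frag_of s)" by (simp add: D_def)
    have "small_chain p \<U> (H (p - Suc 0) (m p s) (chain_boundary p (frag_of s))
        - D (p - Suc 0) (chain_boundary p (frag_of s)))"
    proof (cases "p = 0")
      case True
      then show ?thesis by (simp add: chain_boundary_def additive.zero[OF Dadd] additive.zero[OF Hadd])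
    next
      case False
      then obtain q where q: "p = Suc q" by (cases p) auto
      let ?f = "\<lambda>k. frag_of (singular_face p k s)"
      let ?G = "\<lambda>c. H q (m p s) c - D q c"
      have G: "Modules.additive ?G"
        by unfold_locales (simp add: additive.add[OF Dadd] additive.add[OF Hadd])
      have bd: "chain_boundary p (frag_of s) = (\<Sum>k\<le>p. frag_cmul ((-1) ^ k) (?f k))"
        using False by (simp add: chain_boundary_of)
      have "small_chain p \<U> (?G (?f k))" if k: "k \<le> p" for k
      proof -
        let ?t = "singular_face p k s"
        have t: "singular_simplex q X ?t"
          using singular_simplex_singular_face[OF s] k False q by force
        have le: "m q ?t \<le> m p s" using m_face[OF s] k False q by force
        \<comment> \<open>A face contributes only the iterates from its own subdivision number up to that of \<open>s\<close>,
          and all of these are small.\<close>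
        have "?G (frag_of ?t) = (\<Sum>i<m p s. h q ((?Sd q ^^ i) (frag_of ?t))) - (\<Sum>i<m q ?t. h q ((?Sd q ^^ i) (frag_of ?t)))"
          by (simp add: D_def H_def)
        also have "\<dots> = (\<Sum>i\<in>{m q ?t..<m p s}. h q ((?Sd q ^^ i) (frag_of ?t)))"
          using sum_diff_nat_ivl[of 0 "m q ?t" "m p s"] le by (simp add: atLeast0LessThan)
        also have "small_chain p \<U> \<dots>"
        proof (rule small_chain_sum)
          fix i assume "i \<in> {m q ?t..<m p s}"
          then have sm: "small_chain q \<U> ((?Sd q ^^ i) (frag_of ?t))"
            using Sd_small[OF t] by simp
          have "small_chain (Suc q) \<U> (h q ((?Sd q ^^ i) (frag_of ?t)))"
            by (rule small_chain_natural[where X = X, OF hadd _ _ sm])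
               (auto simp: hch Sdch t singular_chain_of)
          then show "small_chain p \<U> (h q ((?Sd q ^^ i) (frag_of ?t)))"
            by (simp only: q)
        qed
        finally show ?thesis .
      qed
      then have "small_chain p \<U> (?G (chain_boundary p (frag_of s)))"
        unfolding bd additive.sum[OF G] additive_cmul[OF G]
        by (intro small_chain_sum small_chain_cmul) auto
      then show ?thesis by (simp add: q)
    qed
    moreover have "\<rho> p (frag_of s) = (?Sd p ^^ m p s) (frag_of s) -
       (H (p - Suc 0) (m p s) (chain_boundary p (frag_of s)) - D (p - Suc 0) (chain_boundary p (frag_of s)))"
      using Hb[OF sc, of "m p s"] unfolding \<rho>_def Ds by (simp add: algebra_simps)
    ultimately show ?thesis using Sd_small[OF s order_refl] small_chain_diff by metis
  qed
  have "small_retraction X \<U> \<rho> D"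
  proof (rule small_retraction.intro)
    show "small_chain p \<U> (\<rho> p c)" if "singular_chain p X c" for p c
      using that unfolding singular_chain_def
      by (induction rule: frag_induction)
         (auto simp: additive.zero[OF \<rho>add] additive.diff[OF \<rho>add] \<rho>simplex intro: small_chain_diff)
    show "D p c = 0" if "singular_chain p X c" "small_chain p \<U> c" for p c
    proof -
      have "H p (m p s) (frag_of s) = 0" if "s \<in> Poly_Mapping.keys c" for s
      proof -
        have "?sm p s" using that \<open>small_chain p \<U> c\<close> by (auto simp: small_chain_def)
        then show ?thesis by (simp add: m_small H_def)
      qed
      then show ?thesis unfolding D_def by (rule frag_extend_eq_0)
    qed
    show "chain_boundary (Suc p) (D p c) + D (p - Suc 0) (chain_boundary p c) = \<rho> p c - c" for p c
      by (simp add: \<rho>_def)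
  qed (use \<rho>add Dadd \<rho>ch Dch in auto)
  then show thesis by (rule that)
qed

section \<open>Relative cochains and excision\<close>

lemma sing_cochain_add:
  "\<phi> \<in> sing_cochains p X S \<Longrightarrow> singular_chain p X x \<Longrightarrow> singular_chain p X y \<Longrightarrow> \<phi> (x + y) = \<phi> x + \<phi> y"
  by (simp add: sing_cochains_def)

lemma sing_cochain_rel:
  "\<phi> \<in> sing_cochains p X S \<Longrightarrow> singular_chain p (subtopology X S) x \<Longrightarrow> \<phi> x = 0"
  by (simp add: sing_cochains_def)

lemma sing_cochain_zero [simp]: "\<phi> \<in> sing_cochains p X S \<Longrightarrow> \<phi> 0 = 0"
  by (rule sing_cochain_rel) auto

lemma sing_cochain_diff:
  assumes "\<phi> \<in> sing_cochains p X S" "singular_chain p X x" "singular_chain p X y"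
  shows "\<phi> (x - y) = \<phi> x - \<phi> y"
  using sing_cochain_add[OF assms(1) singular_chain_diff[OF assms(2,3)] assms(3)] by simp

lemma sing_cochain_minus:
  assumes "\<phi> \<in> sing_cochains p X S" "singular_chain p X x"
  shows "\<phi> (- x) = - \<phi> x"
  using sing_cochain_diff[OF assms(1) singular_chain_0 assms(2)] assms(1) by simp

lemma sing_cochain_sum:
  assumes \<phi>: "\<phi> \<in> sing_cochains p X S" and f: "\<And>i. i \<in> I \<Longrightarrow> singular_chain p X (f i)"
  shows "\<phi> (\<Sum>i\<in>I. f i) = (\<Sum>i\<in>I. \<phi> (f i))"
  using f
proof (induction I rule: infinite_finite_induct)
  case (insert i I)
  then have "singular_chain p X (sum f I)" by (intro singular_chain_sum) auto
  with insert show ?case by (simp add: sing_cochain_add[OF \<phi>])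
qed (use \<phi> in auto)

lemma sing_cochainI:
  assumes "\<And>x y. singular_chain p X x \<Longrightarrow> singular_chain p X y \<Longrightarrow> g (x + y) = g x + g y"
    and "\<And>x. singular_chain p (subtopology X S) x \<Longrightarrow> g x = 0"
  shows "restrict g (singular_chain_set p X) \<in> sing_cochains p X S"
proof -
  have "singular_chain p X x" if "singular_chain p (subtopology X S) x" for x
    using that by (simp add: singular_chain_subtopology)
  with assms show ?thesis by (auto simp: sing_cochains_def singular_chain_add)
qed

lemma sing_cocycles_iff:
  "\<phi> \<in> sing_cocycles p X S \<longleftrightarrow>
     \<phi> \<in> sing_cochains p X S \<and> (\<forall>x. singular_chain (Suc p) X x \<longrightarrow> \<phi> (chain_boundary (Suc p) x) = 0)"
proof -
  have "(\<lambda>x\<in>singular_chain_set (Suc p) X. \<phi> (chain_boundary (Suc p) x)) = (\<lambda>x\<in>singular_chain_set (Suc p) X. 0) \<longleftrightarrow>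
     (\<forall>x. singular_chain (Suc p) X x \<longrightarrow> \<phi> (chain_boundary (Suc p) x) = 0)"
    unfolding fun_eq_iff restrict_def by auto
  then show ?thesis by (auto simp: sing_cocycles_def sing_coboundary_def)
qed

text \<open>
  In degree zero the boundary operator vanishes, so the truncated predecessor \<open>p - Suc
  0\<close> allows one description of the coboundaries in all degrees.
\<close>

lemma sing_coboundaries_eq:
  "sing_coboundaries p X S =
     (\<lambda>\<eta>. \<lambda>x\<in>singular_chain_set p X. \<eta> (chain_boundary p x)) ` sing_cochains (p - Suc 0) X S"
proof (cases p)
  case 0
  have "(\<lambda>x\<in>singular_chain_set 0 X. 0) \<in> sing_cochains 0 X S"
    by (rule sing_cochainI) auto
  then show ?thesis
    unfolding 0 by (auto simp: sing_coboundaries_def chain_boundary_def image_iff cong: restrict_cong)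
next
  case (Suc q)
  then show ?thesis by (simp add: sing_coboundaries_def sing_coboundary_def)
qed

lemma sing_cocycle_cochain: "\<phi> \<in> sing_cocycles p X S \<Longrightarrow> \<phi> \<in> sing_cochains p X S"
  by (simp add: sing_cocycles_def)

lemma sing_cochains_mono: "S' \<subseteq> S \<Longrightarrow> sing_cochains p X S \<subseteq> sing_cochains p X S'"
  unfolding sing_cochains_def using singular_chain_mono by blast

lemma sing_cocycles_mono: "S' \<subseteq> S \<Longrightarrow> sing_cocycles p X S \<subseteq> sing_cocycles p X S'"
  unfolding sing_cocycles_def using sing_cochains_mono by blast

lemma sing_coboundaries_mono: "S' \<subseteq> S \<Longrightarrow> sing_coboundaries p X S \<subseteq> sing_coboundaries p X S'"
  unfolding sing_coboundaries_eq using sing_cochains_mono by (rule image_mono)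

text \<open>
  The linear extension of a function on generators to the free abelian group, with values in a ring.
\<close>

definition frag_eval :: "('b \<Rightarrow> 'f::comm_ring_1) \<Rightarrow> ('b \<Rightarrow>\<^sub>0 int) \<Rightarrow> 'f"
  where "frag_eval f c = (\<Sum>s\<in>Poly_Mapping.keys c. of_int (Poly_Mapping.lookup c s) * f s)"

lemma frag_eval_of [simp]: "frag_eval f (frag_of s) = f s"
  by (simp add: frag_eval_def)

lemma additive_frag_eval: "Modules.additive (frag_eval f)"
proof
  fix x y :: "'a \<Rightarrow>\<^sub>0 int"
  let ?A = "Poly_Mapping.keys x \<union> Poly_Mapping.keys y"
  have "frag_eval f z = (\<Sum>s\<in>?A. of_int (Poly_Mapping.lookup z s) * f s)" if "Poly_Mapping.keys z \<subseteq> ?A" for z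
    unfolding frag_eval_def using that by (intro sum.mono_neutral_left) (auto simp: in_keys_iff)
  from this[of x] this[of y] this[of "x + y"] show "frag_eval f (x + y) = frag_eval f x + frag_eval f y"
    using keys_add[of x y] by (simp add: lookup_add distrib_right sum.distrib)
qed

lemma frag_eval_eq_0: "(\<And>s. s \<in> Poly_Mapping.keys c \<Longrightarrow> f s = 0) \<Longrightarrow> frag_eval f c = 0"
  by (simp add: frag_eval_def)

lemma frag_eval_cong:
  "(\<And>s. s \<in> Poly_Mapping.keys c \<Longrightarrow> f s = g s) \<Longrightarrow> frag_eval f c = frag_eval g c"
  by (simp add: frag_eval_def)

lemma sing_cochain_eq_frag_eval:
  assumes "\<phi> \<in> sing_cochains p X S" and "singular_chain p X c"
  shows "\<phi> c = frag_eval (\<lambda>s. \<phi> (frag_of s)) c"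
proof -
  have "singular_chain p X c \<and> \<phi> c = frag_eval (\<lambda>s. \<phi> (frag_of s)) c"
    using assms(2) unfolding singular_chain_def[of p X c]
  proof (induction rule: frag_induction)
    case (diff a b)
    then show ?case
      using sing_cochain_diff[OF assms(1)] additive.diff[OF additive_frag_eval] 
      by (metis singular_chain_diff singular_chain_def)
  qed (use assms(1) additive.zero[OF additive_frag_eval] in \<open>auto simp: singular_chain_def\<close>)
  then show ?thesis ..
qed

context
  fixes Y :: "'a topology" and U C :: "'a set"
  assumes U: "openin Y U" and C: "closedin Y C" "C \<subseteq> U"
begin

text \<open>
  The extension by zero of a cochain on \<open>U\<close> to all simplices of \<open>Y\<close>. It is
  a relative cochain, but it commutes with the coboundary only on chains that are small for the
  cover by \<open>U\<close> and the complement of \<open>C\<close>.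
\<close>

definition excision_hat :: "nat \<Rightarrow> ('a chain \<Rightarrow> 'f::field) \<Rightarrow> 'a chain \<Rightarrow> 'f"
  where "excision_hat p \<eta> = frag_eval (\<lambda>s. if s ` standard_simplex p \<subseteq> U then \<eta> (frag_of s) else 0)"

lemma excision_hat_inside:
  assumes "\<eta> \<in> sing_cochains p (subtopology Y U) (U - C)" "singular_chain p (subtopology Y U) c"
  shows "excision_hat p \<eta> c = \<eta> c"
  unfolding sing_cochain_eq_frag_eval[OF assms] excision_hat_def
  using assms(2) by (intro frag_eval_cong) (auto simp: singular_chain_subtopology)

text \<open>
  A simplex that avoids \<open>C\<close> and lies in \<open>U\<close> lies in \<open>U - C\<close>,
  where \<open>\<eta>\<close> vanishes; other simplices are killed by definition.
\<close>

lemma excision_hat_outside: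
  assumes \<eta>: "\<eta> \<in> sing_cochains p (subtopology Y U) (U - C)"
    and c: "singular_chain p (subtopology Y (topspace Y - C)) c"
  shows "excision_hat p \<eta> c = 0"
  unfolding excision_hat_def
proof (rule frag_eval_eq_0, clarsimp)
  fix s assume s: "s \<in> Poly_Mapping.keys c" "s ` standard_simplex p \<subseteq> U"
  then have "singular_chain p (subtopology (subtopology Y U) (U - C)) (frag_of s)"
    using c by (fastforce simp: singular_chain_def singular_simplex_subtopology)
  with \<eta> show "\<eta> (frag_of s) = 0" by (rule sing_cochain_rel)
qed

lemma small_chain_induct_excision [consumes 2, case_names zero inside outside diff]:
  assumes "singular_chain p Y c" "small_chain p {U, topspace Y - C} c"
    and "P 0"
    and "\<And>s. singular_simplex p (subtopology Y U) s \<Longrightarrow> P (frag_of s)"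
    and "\<And>s. singular_simplex p (subtopology Y (topspace Y - C)) s \<Longrightarrow> P (frag_of s)"
    and "\<And>a b. singular_chain p Y a \<Longrightarrow> singular_chain p Y b \<Longrightarrow> P a \<Longrightarrow> P b \<Longrightarrow> P (a - b)"
  shows "P c"
proof -
  have "Poly_Mapping.keys c \<subseteq> {s. singular_simplex p (subtopology Y U) s \<or> singular_simplex p (subtopology Y (topspace Y - C)) s}"
    using assms(1,2) by (auto simp: singular_chain_def small_chain_def singular_simplex_subtopology)
  then have "singular_chain p Y c \<and> P c"
  proof (induction rule: frag_induction)
    case (one s)
    then show ?case using assms(4,5) by (auto simp: singular_chain_of singular_simplex_subtopology)
  next
    case (diff a b)
    then show ?case using assms(6) singular_chain_diff by blast
  qed (use assms(3) in auto)
  then show ?thesis ..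
qed

text \<open>
  Precomposing the extension by zero with a retraction onto chains that are small for the cover by
  \<open>U\<close> and the complement of \<open>C\<close> extends cochains so that cocycles become
  cocycles. The last property is the injectivity half of excision: if \<open>\<phi>\<close> is the
  coboundary of \<open>\<eta>\<close> on \<open>U\<close>, then it is the coboundary of the extended
  \<open>\<eta>\<close> on small chains, and the homotopy \<open>D\<close> corrects this on all
  chains.
\<close>

lemma excision_extend:
  obtains ext :: "nat \<Rightarrow> ('a chain \<Rightarrow> 'f::field) \<Rightarrow> 'a chain \<Rightarrow> 'f" where
    "\<And>p \<eta>. \<eta> \<in> sing_cochains p (subtopology Y U) (U - C) \<Longrightarrow> ext p \<eta> \<in> sing_cochains p Y (topspace Y - C)"
    "\<And>p \<eta> c. \<eta> \<in> sing_cochains p (subtopology Y U) (U - C) \<Longrightarrow> singular_chain p (subtopology Y U) c \<Longrightarrow> ext p \<eta> c = \<eta> c"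
    "\<And>p \<eta> c. \<eta> \<in> sing_cocycles p (subtopology Y U) (U - C) \<Longrightarrow> ext p \<eta> \<in> sing_cocycles p Y (topspace Y - C)"
    "\<And>p (\<phi> :: 'a chain \<Rightarrow> 'f) \<eta>. \<phi> \<in> sing_cocycles p Y (topspace Y - C) \<Longrightarrow> \<eta> \<in> sing_cochains (p - Suc 0) (subtopology Y U) (U - C) \<Longrightarrow>
       (\<And>c. singular_chain p (subtopology Y U) c \<Longrightarrow> \<phi> c = \<eta> (chain_boundary p c)) \<Longrightarrow>
       \<phi> \<in> sing_coboundaries p Y (topspace Y - C)"
proof -
  let ?U = "{U, topspace Y - C}"
  have "\<forall>V\<in>?U. openin Y V" "topspace Y \<subseteq> \<Union>?U" using U C by auto
  then obtain \<rho> D where "small_retraction Y ?U \<rho> D" by (rule small_retraction_exists)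
  then interpret small_retraction Y ?U \<rho> D .
  have sub: "singular_chain p Y c" if "singular_chain p (subtopology Y S) c" for p S c
    using that by (simp add: singular_chain_subtopology)
  have insmall: "small_chain p ?U c" if "singular_chain p (subtopology Y S) c" "S \<in> ?U" for p S c
    unfolding small_chain_def
  proof (intro ballI bexI)
    show "S \<in> ?U" by (fact that(2))
    fix f assume "f \<in> Poly_Mapping.keys c"
    with that(1) show "f ` standard_simplex p \<subseteq> S"
      unfolding singular_chain_subtopology by (elim conjE) (drule (1) bspec)
  qed
  define ext :: "nat \<Rightarrow> ('a chain \<Rightarrow> 'f) \<Rightarrow> 'a chain \<Rightarrow> 'f"
    where "ext p \<eta> = (\<lambda>c\<in>singular_chain_set p Y. excision_hat p \<eta> (\<rho> p c))" for p \<eta>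
  have hatadd: "Modules.additive (excision_hat p \<eta>)" for p and \<eta> :: "'a chain \<Rightarrow> 'f"
    unfolding excision_hat_def by (rule additive_frag_eval)
  have E1: "ext p \<eta> \<in> sing_cochains p Y (topspace Y - C)"
    if "\<eta> \<in> sing_cochains p (subtopology Y U) (U - C)" for p \<eta>
    unfolding ext_def
    by (rule sing_cochainI) (auto simp: additive.add[OF \<rho>_additive] additive.add[OF hatadd] excision_hat_outside[OF that] \<rho>_subspace)
  have E2: "ext p \<eta> c = \<eta> c"
    if "\<eta> \<in> sing_cochains p (subtopology Y U) (U - C)" "singular_chain p (subtopology Y U) c" for p \<eta> c
    using that \<rho>_id[OF sub insmall, OF that(2,2)] by (simp add: ext_def sub excision_hat_inside)
  have E3: "ext p \<eta> \<in> sing_cocycles p Y (topspace Y - C)"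
    if \<eta>: "\<eta> \<in> sing_cocycles p (subtopology Y U) (U - C)" for p \<eta>
  proof -
    note \<eta>' = sing_cocycle_cochain[OF \<eta>]
    have "excision_hat p \<eta> (chain_boundary (Suc p) z) = 0"
      if "singular_chain (Suc p) Y z" "small_chain (Suc p) ?U z" for z
      using that
    proof (induction rule: small_chain_induct_excision)
      case (inside s)
      then have "singular_chain (Suc p) (subtopology Y U) (frag_of s)" by (simp add: singular_chain_of)
      then show ?case
        using \<eta> excision_hat_inside[OF \<eta>' singular_chain_boundary_alt] by (simp add: sing_cocycles_iff)
    next
      case (outside s)
      then have "singular_chain (Suc p) (subtopology Y (topspace Y - C)) (frag_of s)" by (simp add: singular_chain_of)
      then show ?case using excision_hat_outside[OF \<eta>' singular_chain_boundary_alt] by simp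
    qed (auto simp: additive.zero[OF hatadd] additive.diff[OF hatadd] chain_boundary_diff)
    moreover have "ext p \<eta> (chain_boundary (Suc p) y) = excision_hat p \<eta> (chain_boundary (Suc p) (\<rho> (Suc p) y))"
      if "singular_chain (Suc p) Y y" for y
      using \<rho>_boundary[OF that] that by (simp add: ext_def singular_chain_boundary_alt)
    ultimately show ?thesis using E1[OF \<eta>'] \<rho>_chain \<rho>_small by (simp add: sing_cocycles_iff)
  qed
  have E4: "\<phi> \<in> sing_coboundaries p Y (topspace Y - C)"
    if \<phi>: "\<phi> \<in> sing_cocycles p Y (topspace Y - C)"
      and \<eta>: "\<eta> \<in> sing_cochains (p - Suc 0) (subtopology Y U) (U - C)"
      and eq: "\<And>c. singular_chain p (subtopology Y U) c \<Longrightarrow> \<phi> c = \<eta> (chain_boundary p c)"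
    for p and \<phi> \<eta> :: "'a chain \<Rightarrow> 'f"
  proof -
    note \<phi>' = sing_cocycle_cochain[OF \<phi>]
    note \<eta>' = E1[OF \<eta>]
    have small: "\<phi> z = ext (p - Suc 0) \<eta> (chain_boundary p z)"
      if "singular_chain p Y z" "small_chain p ?U z" for z
      using that
    proof (induction rule: small_chain_induct_excision)
      case (inside s)
      then have "singular_chain p (subtopology Y U) (frag_of s)" by (simp add: singular_chain_of)
      then show ?case using eq E2[OF \<eta> singular_chain_boundary] by simp
    next
      case (outside s)
      then have "singular_chain p (subtopology Y (topspace Y - C)) (frag_of s)" by (simp add: singular_chain_of)
      then show ?case
        using sing_cochain_rel[OF \<phi>'] sing_cochain_rel[OF \<eta>' singular_chain_boundary] by simp
    next
      case (diff a b)
      then show ?case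
        using sing_cochain_diff[OF \<phi>'] sing_cochain_diff[OF \<eta>'] 
        by (simp add: chain_boundary_diff singular_chain_boundary)
    qed (use \<phi>' \<eta>' in auto)
    have main: "\<phi> y = ext (p - Suc 0) \<eta> (chain_boundary p y) - \<phi> (D (p - Suc 0) (chain_boundary p y))"
      if y: "singular_chain p Y y" for y
    proof -
      have dy: "singular_chain (p - Suc 0) Y (chain_boundary p y)"
        using singular_chain_boundary[OF y] .
      have Dd: "singular_chain p Y (D (p - Suc 0) (chain_boundary p y))"
      proof (cases "p = 0")
        case True
        then show ?thesis by (simp add: chain_boundary_def additive.zero[OF D_additive])
      next
        case False
        then show ?thesis using D_chain[OF dy] by simp
      qed
      have "y = \<rho> p y - chain_boundary (Suc p) (D p y) - D (p - Suc 0) (chain_boundary p y)"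
        using homotopy[OF y] by (simp add: algebra_simps)
      also have "\<phi> \<dots> = \<phi> (\<rho> p y) - \<phi> (chain_boundary (Suc p) (D p y)) - \<phi> (D (p - Suc 0) (chain_boundary p y))"
        using sing_cochain_diff[OF \<phi>'] \<rho>_chain[OF y] singular_chain_boundary_alt[OF D_chain[OF y]] Dd
        by (simp add: singular_chain_diff)
      also have "\<phi> (chain_boundary (Suc p) (D p y)) = 0"
        using \<phi> D_chain[OF y] by (simp add: sing_cocycles_iff)
      also have "\<phi> (\<rho> p y) = ext (p - Suc 0) \<eta> (chain_boundary p (\<rho> p y))"
        using small[OF \<rho>_chain[OF y] \<rho>_small[OF y]] .
      also have "\<dots> = ext (p - Suc 0) \<eta> (chain_boundary p y)"
        using \<rho>_boundary[OF y] \<rho>_id[OF \<rho>_chain[OF dy] \<rho>_small[OF dy]] \<rho>_chain[OF dy] dy by (simp add: ext_def)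
      finally show ?thesis by simp
    qed
    \<comment> \<open>For \<open>p = 0\<close> the truncated predecessor makes \<open>D (p - Suc 0)\<close> raise the degree above that of
      \<open>\<phi>\<close>; the zero cochain is correct there because the boundary of a 0-chain vanishes.\<close>
    define \<theta> where "\<theta> = (if p = 0 then \<lambda>_. 0 else (\<lambda>w. ext (p - Suc 0) \<eta> w - \<phi> (D (p - Suc 0) w)))"
    have \<theta>: "restrict \<theta> (singular_chain_set (p - Suc 0) Y) \<in> sing_cochains (p - Suc 0) Y (topspace Y - C)"
    proof (rule sing_cochainI)
      fix x y assume "singular_chain (p - Suc 0) Y x" "singular_chain (p - Suc 0) Y y"
      then show "\<theta> (x + y) = \<theta> x + \<theta> y"
        using D_chain[of "p - Suc 0" x] D_chain[of "p - Suc 0" y] sing_cochain_add[OF \<phi>', of "D (p - Suc 0) x" "D (p - Suc 0) y"]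
          sing_cochain_add[OF \<eta>', of x y]
        by (cases p) (simp_all add: \<theta>_def additive.add[OF D_additive])
    next
      fix x assume "singular_chain (p - Suc 0) (subtopology Y (topspace Y - C)) x"
      then show "\<theta> x = 0"
        using D_subspace[of "p - Suc 0" "topspace Y - C" x] sing_cochain_rel[OF \<phi>', of "D (p - Suc 0) x"]
          sing_cochain_rel[OF \<eta>', of x]
        by (cases p) (simp_all add: \<theta>_def)
    qed
    have "\<phi> = (\<lambda>x\<in>singular_chain_set p Y. restrict \<theta> (singular_chain_set (p - Suc 0) Y) (chain_boundary p x))"
    proof (rule extensionalityI)
      show "\<phi> \<in> extensional (singular_chain_set p Y)" using \<phi>' by (simp add: sing_cochains_def)
      fix x assume "x \<in> singular_chain_set p Y"
      then have x: "singular_chain p Y x" by simp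
      show "\<phi> x = (\<lambda>x\<in>singular_chain_set p Y. restrict \<theta> (singular_chain_set (p - Suc 0) Y) (chain_boundary p x)) x"
      proof (cases "p = 0")
        case True
        then have "chain_boundary p x = 0" by (simp add: chain_boundary_def)
        with main[OF x] x show ?thesis
          using sing_cochain_zero[OF \<phi>'] sing_cochain_zero[OF \<eta>']
          by (simp add: \<theta>_def True additive.zero[OF D_additive])
      next
        case False
        with main[OF x] x singular_chain_boundary[OF x] show ?thesis
          by (simp add: \<theta>_def)
      qed
    qed auto
    with \<theta> show ?thesis unfolding sing_coboundaries_eq by blast
  qed
  show thesis by (rule that[OF E1 E2 E3 E4])
qed

text \<open>
  The surjectivity half of excision, for cocycles rather than classes: every relative cocycle of
  \<open>U\<close> is the restriction of one of \<open>Y\<close>.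
\<close>

lemma excision_surj:
  assumes x: "x \<in> sing_cocycles p (subtopology Y U) (U - C)"
  obtains \<phi> :: "'a chain \<Rightarrow> 'f::field" where "\<phi> \<in> sing_cocycles p Y (topspace Y - C)"
    "restrict \<phi> (singular_chain_set p (subtopology Y U)) = x"
proof -
  obtain ext :: "nat \<Rightarrow> ('a chain \<Rightarrow> 'f::field) \<Rightarrow> 'a chain \<Rightarrow> 'f" where
    2: "\<And>p \<eta> c. \<eta> \<in> sing_cochains p (subtopology Y U) (U - C) \<Longrightarrow> singular_chain p (subtopology Y U) c \<Longrightarrow> ext p \<eta> c = \<eta> c"
    and 3: "\<And>p \<eta> c. \<eta> \<in> sing_cocycles p (subtopology Y U) (U - C) \<Longrightarrow> ext p \<eta> \<in> sing_cocycles p Y (topspace Y - C)"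
    by (rule excision_extend) blast
  have "restrict (ext p x) (singular_chain_set p (subtopology Y U)) = x"
    using 2[OF sing_cocycle_cochain[OF x]] sing_cocycle_cochain[OF x]
    by (auto simp: sing_cochains_def extensional_def fun_eq_iff restrict_def)
  with 3[OF x] show thesis by (rule that)
qed

lemma excision_inj:
  fixes \<phi> :: "'a chain \<Rightarrow> 'f::field"
  assumes \<phi>: "\<phi> \<in> sing_cocycles p Y (topspace Y - C)"
    and x: "restrict \<phi> (singular_chain_set p (subtopology Y U)) \<in> sing_coboundaries p (subtopology Y U) (U - C)"
  shows "\<phi> \<in> sing_coboundaries p Y (topspace Y - C)"
proof -
  obtain \<eta> where \<eta>: "\<eta> \<in> sing_cochains (p - Suc 0) (subtopology Y U) (U - C)"
    and eq: "restrict \<phi> (singular_chain_set p (subtopology Y U)) = (\<lambda>x\<in>singular_chain_set p (subtopology Y U). \<eta> (chain_boundary p x))"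
    using x unfolding sing_coboundaries_eq by blast
  have "\<phi> c = \<eta> (chain_boundary p c)" if "singular_chain p (subtopology Y U) c" for c
    using fun_cong[OF eq, of c] that by simp
  with \<phi> \<eta> show ?thesis by (rule_tac excision_extend) blast
qed

end

section \<open>Relative cohomology classes\<close>

lemma fun_space_simps [simp]:
  fixes S :: "'x set"
  defines "V \<equiv> (fun_space S :: ('f::field, 'x \<Rightarrow> 'f) module)"
  shows "carrier V = extensional S" "zero V = (\<lambda>x\<in>S. 0)"
    "add V = (\<lambda>f g. \<lambda>x\<in>S. f x + g x)" "smult V = (\<lambda>c f. \<lambda>x\<in>S. c * f x)"
proof -
  have r: "(LinearCombinations.ring.func_space class_ring S :: ('f, 'x \<Rightarrow> 'f) module) =
    \<lparr>carrier = S \<rightarrow>\<^sub>E carrier class_ring, mult = (\<lambda>f g. restrict (\<lambda>v. \<zero>\<^bsub>class_ring\<^esub>) S),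
     one = restrict (\<lambda>v. \<zero>\<^bsub>class_ring\<^esub>) S, zero = restrict (\<lambda>v. \<zero>\<^bsub>class_ring\<^esub>) S,
     add = (\<lambda>f g. restrict (\<lambda>v. f v \<oplus>\<^bsub>class_ring\<^esub> g v) S),
     smult = (\<lambda>c f. restrict (\<lambda>v. c \<otimes>\<^bsub>class_ring\<^esub> f v) S)\<rparr>" for S :: "'x set"
    by (rule LinearCombinations.ring.func_space_def) (rule class_ring.ring_axioms)
  show "carrier V = extensional S" "zero V = (\<lambda>x\<in>S. 0)"
    "add V = (\<lambda>f g. \<lambda>x\<in>S. f x + g x)" "smult V = (\<lambda>c f. \<lambda>x\<in>S. c * f x)"
    by (auto simp: V_def r PiE_def)
qed

text \<open>
  Linear subspaces of a space of functions on \<open>S\<close>. As in \<open>fun_space\<close>,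
  functions are extensional, so the operations restrict their results to \<open>S\<close>.
\<close>

locale linear_subset =
  fixes S :: "'x set" and W :: "('x \<Rightarrow> 'f::field) set"
  assumes extensional: "f \<in> W \<Longrightarrow> f \<in> extensional S"
    and zero: "(\<lambda>x\<in>S. 0) \<in> W"
    and add: "f \<in> W \<Longrightarrow> g \<in> W \<Longrightarrow> (\<lambda>x\<in>S. f x + g x) \<in> W"
    and smult: "f \<in> W \<Longrightarrow> (\<lambda>x\<in>S. c * f x) \<in> W"

lemma linear_subset_diff:
  assumes W: "linear_subset S W" and "f \<in> W" "g \<in> W"
  shows "(\<lambda>x\<in>S. f x - g x) \<in> W"
proof -
  have "(\<lambda>x\<in>S. f x + (\<lambda>x\<in>S. - 1 * g x) x) \<in> W"
    by (rule linear_subset.add[OF W assms(2) linear_subset.smult[OF W assms(3)]])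
  then show ?thesis by (simp cong: restrict_cong)
qed

lemma coset_fun_space:
  "W +>\<^bsub>fun_space S\<^esub> f = (\<lambda>w. \<lambda>x\<in>S. w x + f x) ` W"
  by (auto simp: a_r_coset_def')

lemma coset_memI: "w \<in> W \<Longrightarrow> (\<lambda>x\<in>S. w x + f x) \<in> W +>\<^bsub>fun_space S\<^esub> f"
  unfolding coset_fun_space by (rule imageI)

lemma coset_memE:
  assumes "h \<in> W +>\<^bsub>fun_space S\<^esub> f"
  obtains w where "w \<in> W" "h = (\<lambda>x\<in>S. w x + f x)"
  using assms unfolding coset_fun_space by (rule imageE) (rule that)

lemma coset_fun_space_carrier:
  "W +>\<^bsub>(fun_space S)\<lparr>carrier := Z\<rparr>\<^esub> f = W +>\<^bsub>fun_space S\<^esub> f"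
  by (auto simp: a_r_coset_def')

lemma coset_eq_iff:
  assumes W: "linear_subset S W" and f: "f \<in> extensional S" and g: "g \<in> extensional S"
  shows "W +>\<^bsub>fun_space S\<^esub> f = W +>\<^bsub>fun_space S\<^esub> g \<longleftrightarrow> (\<lambda>x\<in>S. f x - g x) \<in> W"
proof
  assume eq: "W +>\<^bsub>fun_space S\<^esub> f = W +>\<^bsub>fun_space S\<^esub> g"
  have "(\<lambda>x\<in>S. (\<lambda>x\<in>S. 0) x + f x) \<in> W +>\<^bsub>fun_space S\<^esub> f"
    by (rule coset_memI linear_subset.zero W)+
  then obtain w where w: "w \<in> W" "(\<lambda>x\<in>S. (\<lambda>x\<in>S. 0) x + f x) = (\<lambda>x\<in>S. w x + g x)"
    unfolding eq by (rule coset_memE)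
  have "(\<lambda>x\<in>S. f x - g x) = w"
  proof (rule extensionalityI)
    show "w \<in> extensional S" using linear_subset.extensional[OF W w(1)] .
    fix x assume "x \<in> S"
    then show "(\<lambda>x\<in>S. f x - g x) x = w x" using fun_cong[OF w(2), of x] by simp
  qed auto
  with w show "(\<lambda>x\<in>S. f x - g x) \<in> W" by simp
next
  assume d: "(\<lambda>x\<in>S. f x - g x) \<in> W"
  have "(\<lambda>x\<in>S. w x + f x) \<in> (\<lambda>w. \<lambda>x\<in>S. w x + g x) ` W" if "w \<in> W" for w
  proof (rule image_eqI)
    show "(\<lambda>x\<in>S. w x + (\<lambda>x\<in>S. f x - g x) x) \<in> W" using linear_subset.add[OF W that d] .
  qed (auto simp: restrict_def)
  moreover have "(\<lambda>x\<in>S. w x + g x) \<in> (\<lambda>w. \<lambda>x\<in>S. w x + f x) ` W" if "w \<in> W" for w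
  proof (rule image_eqI)
    show "(\<lambda>x\<in>S. w x - (\<lambda>x\<in>S. f x - g x) x) \<in> W" using linear_subset_diff[OF W that d] .
  qed (auto simp: restrict_def)
  ultimately show "W +>\<^bsub>fun_space S\<^esub> f = W +>\<^bsub>fun_space S\<^esub> g"
    unfolding coset_fun_space by (intro equalityI image_subsetI)
qed

lemma coset_add:
  assumes W: "linear_subset S W"
  shows "(W +>\<^bsub>fun_space S\<^esub> f) <+>\<^bsub>(fun_space S)\<lparr>carrier := Z\<rparr>\<^esub> (W +>\<^bsub>fun_space S\<^esub> g)
    = W +>\<^bsub>fun_space S\<^esub> (\<lambda>x\<in>S. f x + g x)" (is "?L = ?R")
proof
  show "?L \<subseteq> ?R"
  proof
    fix h assume "h \<in> ?L"
    then obtain v w where vw: "v \<in> W" "w \<in> W" "h = (\<lambda>x\<in>S. (\<lambda>x\<in>S. v x + f x) x + (\<lambda>x\<in>S. w x + g x) x)"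
      unfolding coset_fun_space by (auto simp: set_add_def')
    then have "(\<lambda>x\<in>S. v x + w x) \<in> W" using linear_subset.add[OF W] by simp
    moreover have "h = (\<lambda>x\<in>S. (\<lambda>x\<in>S. v x + w x) x + (\<lambda>x\<in>S. f x + g x) x)"
      using vw by (auto simp: restrict_def algebra_simps)
    ultimately show "h \<in> ?R" unfolding coset_fun_space by blast
  qed
  show "?R \<subseteq> ?L"
  proof
    fix h assume "h \<in> ?R"
    then obtain w where w: "w \<in> W" and h: "h = (\<lambda>x\<in>S. w x + (\<lambda>x\<in>S. f x + g x) x)"
      by (rule coset_memE)
    have z: "(\<lambda>x\<in>S. 0) \<in> W" using linear_subset.zero[OF W] .
    have "h = (\<lambda>x\<in>S. w x + f x) \<oplus>\<^bsub>(fun_space S)\<lparr>carrier := Z\<rparr>\<^esub> (\<lambda>x\<in>S. (\<lambda>x\<in>S. 0) x + g x)"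
      unfolding h by (auto simp: restrict_def algebra_simps)
    moreover have "(\<lambda>x\<in>S. w x + f x) \<in> W +>\<^bsub>fun_space S\<^esub> f" "(\<lambda>x\<in>S. (\<lambda>x\<in>S. 0) x + g x) \<in> W +>\<^bsub>fun_space S\<^esub> g"
      by (intro coset_memI w z)+
    ultimately show "h \<in> ?L" 
      unfolding set_add_def' by (intro UN_I) (assumption | simp only: singleton_iff)+
  qed
qed

lemma coset_smult:
  assumes W: "linear_subset S W" and f: "f \<in> extensional S"
  shows "(\<Union>h\<in>W +>\<^bsub>fun_space S\<^esub> f. W +>\<^bsub>fun_space S\<^esub> (\<lambda>x\<in>S. c * h x)) = W +>\<^bsub>fun_space S\<^esub> (\<lambda>x\<in>S. c * f x)"
proof -
  have "W +>\<^bsub>fun_space S\<^esub> (\<lambda>x\<in>S. c * h x) = W +>\<^bsub>fun_space S\<^esub> (\<lambda>x\<in>S. c * f x)"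
    if h: "h \<in> W +>\<^bsub>fun_space S\<^esub> f" for h
  proof -
    obtain w where w: "w \<in> W" "h = (\<lambda>x\<in>S. w x + f x)" using h by (rule coset_memE)
    have "(\<lambda>x\<in>S. c * w x) \<in> W" using linear_subset.smult[OF W w(1)] .
    moreover have "(\<lambda>x\<in>S. (\<lambda>x\<in>S. c * h x) x - (\<lambda>x\<in>S. c * f x) x) = (\<lambda>x\<in>S. c * w x)"
      using w by (auto simp: restrict_def algebra_simps)
    ultimately show ?thesis by (subst coset_eq_iff[OF W]) auto
  qed
  moreover have "W +>\<^bsub>fun_space S\<^esub> f \<noteq> {}"
    unfolding coset_fun_space using linear_subset.zero[OF W] by auto
  ultimately show ?thesis by auto
qed

lemma sing_coboundariesI:
  "\<eta> \<in> sing_cochains (p - Suc 0) X S \<Longrightarrow>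
    (\<lambda>x\<in>singular_chain_set p X. \<eta> (chain_boundary p x)) \<in> sing_coboundaries p X S"
  unfolding sing_coboundaries_eq by (rule imageI)

lemma linear_subset_cochains: "linear_subset (singular_chain_set p X) (sing_cochains p X S :: ('a chain \<Rightarrow> 'f::field) set)"
proof (rule linear_subset.intro)
  show "f \<in> sing_cochains p X S \<Longrightarrow> f \<in> extensional (singular_chain_set p X)" for f :: "'a chain \<Rightarrow> 'f"
    by (auto simp: sing_cochains_def)
  show "(\<lambda>x\<in>singular_chain_set p X. 0 :: 'f) \<in> sing_cochains p X S"
    by (rule sing_cochainI) auto
next
  fix f g :: "'a chain \<Rightarrow> 'f" assume "f \<in> sing_cochains p X S" "g \<in> sing_cochains p X S"
  then show "(\<lambda>x\<in>singular_chain_set p X. f x + g x) \<in> sing_cochains p X S"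
    by (intro sing_cochainI) (simp_all add: sing_cochain_add sing_cochain_rel)
next
  fix c and f :: "'a chain \<Rightarrow> 'f" assume "f \<in> sing_cochains p X S"
  then show "(\<lambda>x\<in>singular_chain_set p X. c * f x) \<in> sing_cochains p X S"
    by (intro sing_cochainI) (simp_all add: sing_cochain_add sing_cochain_rel distrib_left)
qed

lemma linear_subset_cocycles: "linear_subset (singular_chain_set p X) (sing_cocycles p X S :: ('a chain \<Rightarrow> 'f::field) set)"
proof (rule linear_subset.intro)
  note L = linear_subset_cochains[of p X S]
  show "f \<in> sing_cocycles p X S \<Longrightarrow> f \<in> extensional (singular_chain_set p X)" for f :: "'a chain \<Rightarrow> 'f"
    using linear_subset.extensional[OF L sing_cocycle_cochain] .
  show "(\<lambda>x\<in>singular_chain_set p X. 0 :: 'f) \<in> sing_cocycles p X S"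
    using linear_subset.zero[OF L] by (simp add: sing_cocycles_iff singular_chain_boundary_alt)
  show "(\<lambda>x\<in>singular_chain_set p X. f x + g x) \<in> sing_cocycles p X S"
    if "f \<in> sing_cocycles p X S" "g \<in> sing_cocycles p X S" for f g :: "'a chain \<Rightarrow> 'f"
    using linear_subset.add[OF L that[THEN sing_cocycle_cochain]] that
    by (simp add: sing_cocycles_iff singular_chain_boundary_alt)
  show "(\<lambda>x\<in>singular_chain_set p X. c * f x) \<in> sing_cocycles p X S"
    if "f \<in> sing_cocycles p X S" for c and f :: "'a chain \<Rightarrow> 'f"
    using linear_subset.smult[OF L that[THEN sing_cocycle_cochain]] that
    by (simp add: sing_cocycles_iff singular_chain_boundary_alt)
qed

lemma linear_subset_coboundaries: "linear_subset (singular_chain_set p X) (sing_coboundaries p X S :: ('a chain \<Rightarrow> 'f::field) set)"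
proof (rule linear_subset.intro)
  let ?d = "\<lambda>\<eta>. \<lambda>x\<in>singular_chain_set p X. \<eta> (chain_boundary p x)"
  note L = linear_subset_cochains[of "p - Suc 0" X S]
  let ?Q = "singular_chain_set (p - Suc 0) X"
  show "f \<in> extensional (singular_chain_set p X)" if "f \<in> sing_coboundaries p X S" for f :: "'a chain \<Rightarrow> 'f"
    using that by (auto simp: sing_coboundaries_eq)
  have eq: "(\<lambda>x\<in>singular_chain_set p X. 0 :: 'f) = ?d (\<lambda>x\<in>?Q. 0)"
    by (auto simp: singular_chain_boundary restrict_def)
  show "(\<lambda>x\<in>singular_chain_set p X. 0 :: 'f) \<in> sing_coboundaries p X S"
    by (subst eq) (rule sing_coboundariesI[OF linear_subset.zero[OF L]])
  fix f g :: "'a chain \<Rightarrow> 'f"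
  assume f: "f \<in> sing_coboundaries p X S"
  then obtain f' where f': "f' \<in> sing_cochains (p - Suc 0) X S" "f = ?d f'"
    by (auto simp: sing_coboundaries_eq)
  have eq: "(\<lambda>x\<in>singular_chain_set p X. c * f x) = ?d (\<lambda>x\<in>?Q. c * f' x)" for c
    unfolding f' by (auto simp: singular_chain_boundary restrict_def)
  show "(\<lambda>x\<in>singular_chain_set p X. c * f x) \<in> sing_coboundaries p X S" for c
    by (subst eq) (rule sing_coboundariesI[OF linear_subset.smult[OF L f'(1)]])
  assume g: "g \<in> sing_coboundaries p X S"
  then obtain g' where g': "g' \<in> sing_cochains (p - Suc 0) X S" "g = ?d g'"
    by (auto simp: sing_coboundaries_eq)
  have eq: "(\<lambda>x\<in>singular_chain_set p X. f x + g x) = ?d (\<lambda>x\<in>?Q. f' x + g' x)"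
    unfolding f' g' by (auto simp: singular_chain_boundary restrict_def)
  show "(\<lambda>x\<in>singular_chain_set p X. f x + g x) \<in> sing_coboundaries p X S"
    by (subst eq) (rule sing_coboundariesI[OF linear_subset.add[OF L f'(1) g'(1)]])
qed

definition cohomology_class :: "nat \<Rightarrow> 'a topology \<Rightarrow> 'a set \<Rightarrow> ('a chain \<Rightarrow> 'f::field) \<Rightarrow> ('a chain \<Rightarrow> 'f) set"
  where "cohomology_class p X S \<phi> = sing_coboundaries p X S +>\<^bsub>fun_space (singular_chain_set p X)\<^esub> \<phi>"

lemma cohomology_class_eq_iff:
  assumes "\<phi> \<in> sing_cocycles p X S" "\<psi> \<in> sing_cocycles p X S"
  shows "cohomology_class p X S \<phi> = cohomology_class p X S \<psi> \<longleftrightarrow>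
    (\<lambda>x\<in>singular_chain_set p X. \<phi> x - \<psi> x) \<in> sing_coboundaries p X S"
  unfolding cohomology_class_def
  by (intro coset_eq_iff linear_subset_coboundaries assms(1)[THEN linear_subset.extensional[OF linear_subset_cocycles]]
    assms(2)[THEN linear_subset.extensional[OF linear_subset_cocycles]])

lemma sing_cohomology_simps:
  fixes \<phi> \<psi> :: "'a chain \<Rightarrow> 'f::field"
  shows "carrier (sing_cohomology p X S :: ('f, _) module) = cohomology_class p X S ` sing_cocycles p X S"
  "zero (sing_cohomology p X S) = cohomology_class p X S (\<lambda>x\<in>singular_chain_set p X. 0 :: 'f)"
  "\<phi> \<in> sing_cocycles p X S \<Longrightarrow> \<psi> \<in> sing_cocycles p X S \<Longrightarrow>
     cohomology_class p X S \<phi> \<oplus>\<^bsub>sing_cohomology p X S\<^esub> cohomology_class p X S \<psi>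
     = cohomology_class p X S (\<lambda>x\<in>singular_chain_set p X. \<phi> x + \<psi> x)"
  "\<phi> \<in> sing_cocycles p X S \<Longrightarrow>
     k \<odot>\<^bsub>sing_cohomology p X S\<^esub> cohomology_class p X S \<phi>
     = cohomology_class p X S (\<lambda>x\<in>singular_chain_set p X. k * \<phi> x)"
proof -
  let ?V = "fun_space (singular_chain_set p X)"
  show "carrier (sing_cohomology p X S :: ('f, _) module) = cohomology_class p X S ` sing_cocycles p X S"
    by (auto simp: sing_cohomology_def quotient_space_def A_RCOSETS_def' coset_fun_space_carrier cohomology_class_def)
  have "sing_coboundaries p X S = cohomology_class p X S (\<lambda>x\<in>singular_chain_set p X. 0 :: 'f)"
    (is "?B = _")
  proof -
    have "(\<lambda>x\<in>singular_chain_set p X. w x + (\<lambda>x\<in>singular_chain_set p X. 0) x) = w" if "w \<in> ?B" for w :: "'a chain \<Rightarrow> 'f"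
      using linear_subset.extensional[OF linear_subset_coboundaries that]
      by (auto simp: fun_eq_iff restrict_def extensional_def)
    then show ?thesis by (simp add: cohomology_class_def coset_fun_space)
  qed
  then show "zero (sing_cohomology p X S) = cohomology_class p X S (\<lambda>x\<in>singular_chain_set p X. 0 :: 'f)"
    by (simp add: sing_cohomology_def quotient_space_def)
next
  assume "\<phi> \<in> sing_cocycles p X S" "\<psi> \<in> sing_cocycles p X S"
  show "cohomology_class p X S \<phi> \<oplus>\<^bsub>sing_cohomology p X S\<^esub> cohomology_class p X S \<psi>
     = cohomology_class p X S (\<lambda>x\<in>singular_chain_set p X. \<phi> x + \<psi> x)"
    using coset_add[OF linear_subset_coboundaries]
    by (simp add: sing_cohomology_def quotient_space_def cohomology_class_def)
next
  assume "\<phi> \<in> sing_cocycles p X S"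
  note linear_subset.extensional[OF linear_subset_cocycles this]
  then show "k \<odot>\<^bsub>sing_cohomology p X S\<^esub> cohomology_class p X S \<phi>
     = cohomology_class p X S (\<lambda>x\<in>singular_chain_set p X. k * \<phi> x)"
    using coset_smult[OF linear_subset_coboundaries]
    by (simp add: sing_cohomology_def quotient_space_def cohomology_class_def coset_fun_space_carrier)
qed

text \<open>
  A class is the set of its representatives, and \<open>sing_restriction\<close> is the union of the
  classes of all their restrictions; these classes coincide since restrictions of coboundaries are
  coboundaries.
\<close>

lemma sing_restriction_class:
  assumes ch: "\<And>x q. singular_chain q X x \<Longrightarrow> singular_chain q Y x"
    and rel: "\<And>x q. singular_chain q (subtopology X S) x \<Longrightarrow> singular_chain q (subtopology Y T) x"
  shows "sing_restriction p X S (cohomology_class p Y T \<phi>)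
     = cohomology_class p X S (restrict \<phi> (singular_chain_set p X))"
proof -
  let ?c = "singular_chain_set p X"
  have eq: "cohomology_class p X S (restrict h ?c) = cohomology_class p X S (restrict \<phi> ?c)"
    if h: "h \<in> cohomology_class p Y T \<phi>" for h
  proof -
    obtain \<eta> where \<eta>: "\<eta> \<in> sing_cochains (p - Suc 0) Y T"
      and h: "h = (\<lambda>x\<in>singular_chain_set p Y. (\<lambda>x\<in>singular_chain_set p Y. \<eta> (chain_boundary p x)) x + \<phi> x)"
      using h unfolding cohomology_class_def sing_coboundaries_eq by (elim coset_memE imageE) simp
    have "restrict \<eta> (singular_chain_set (p - Suc 0) X) \<in> sing_cochains (p - Suc 0) X S"
      by (rule sing_cochainI) (auto simp: ch rel sing_cochain_add[OF \<eta>] sing_cochain_rel[OF \<eta>])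
    moreover have "(\<lambda>x\<in>?c. restrict h ?c x - restrict \<phi> ?c x)
       = (\<lambda>x\<in>?c. restrict \<eta> (singular_chain_set (p - Suc 0) X) (chain_boundary p x))"
      using ch by (auto simp: h singular_chain_boundary restrict_def)
    ultimately have "(\<lambda>x\<in>?c. restrict h ?c x - restrict \<phi> ?c x) \<in> sing_coboundaries p X S"
      unfolding sing_coboundaries_eq by blast
    then show ?thesis
      unfolding cohomology_class_def by (subst coset_eq_iff[OF linear_subset_coboundaries]) auto
  qed
  moreover have "cohomology_class p Y T \<phi> \<noteq> {}"
    unfolding cohomology_class_def coset_fun_space using linear_subset.zero[OF linear_subset_coboundaries[of p Y T]]
    by auto
  ultimately show ?thesis
    unfolding sing_restriction_def cohomology_class_def[symmetric] by auto
qed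

section \<open>Classes with compact support\<close>

text \<open>
  The element of the colimit given by the compact set \<open>A\<close> and a cocycle
  \<open>\<phi>\<close> relative to its complement.
\<close>

definition cpt_class :: "nat \<Rightarrow> 'a topology \<Rightarrow> 'a set \<Rightarrow> ('a chain \<Rightarrow> 'f::field) \<Rightarrow> ('a set \<times> ('a chain \<Rightarrow> 'f) set) set"
  where "cpt_class p X A \<phi> = colim_rel {A. compactin X A} (cpt_objects p X) (cpt_maps p X) ``
     {(A, cohomology_class p X (topspace X - A) \<phi>)}"

text \<open>
  Equality in the colimit, for representing cocycles: their difference is a coboundary relative to
  the complement of some compact set, which need not contain the supports.
\<close>

definition cpt_equiv :: "nat \<Rightarrow> 'a topology \<Rightarrow> ('a chain \<Rightarrow> 'f::field) \<Rightarrow> ('a chain \<Rightarrow> 'f) \<Rightarrow> bool"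
  where "cpt_equiv p X \<phi> \<psi> \<longleftrightarrow> (\<exists>K. compactin X K \<and>
     (\<lambda>x\<in>singular_chain_set p X. \<phi> x - \<psi> x) \<in> sing_coboundaries p X (topspace X - K))"

lemma cpt_equivI:
  "compactin X K \<Longrightarrow> (\<lambda>x\<in>singular_chain_set p X. \<phi> x - \<psi> x) \<in> sing_coboundaries p X (topspace X - K)
    \<Longrightarrow> cpt_equiv p X \<phi> \<psi>"
  unfolding cpt_equiv_def by (intro exI conjI)

lemma cpt_equivE:
  assumes "cpt_equiv p X \<phi> \<psi>"
  obtains K where "compactin X K" "(\<lambda>x\<in>singular_chain_set p X. \<phi> x - \<psi> x) \<in> sing_coboundaries p X (topspace X - K)"
  using assms unfolding cpt_equiv_def by (elim exE conjE) (rule that)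

text \<open>
  The coboundaries relative to complements of compact sets form a subspace, because two compact sets
  are contained in a third. Symmetry, transitivity and compatibility with the operations are special
  cases.
\<close>

lemma cpt_equiv_lincomb:
  assumes "cpt_equiv p X \<phi> \<phi>'" "cpt_equiv p X \<psi> \<psi>'"
    and "\<And>x. singular_chain p X x \<Longrightarrow> \<alpha> x - \<alpha>' x = (\<phi> x - \<phi>' x) + k * (\<psi> x - \<psi>' x)"
  shows "cpt_equiv p X \<alpha> \<alpha>'"
proof -
  let ?c = "singular_chain_set p X"
  obtain K where K: "compactin X K" "(\<lambda>x\<in>?c. \<phi> x - \<phi>' x) \<in> sing_coboundaries p X (topspace X - K)"
    using assms(1) by (rule cpt_equivE)
  obtain L where L: "compactin X L" "(\<lambda>x\<in>?c. \<psi> x - \<psi>' x) \<in> sing_coboundaries p X (topspace X - L)"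
    using assms(2) by (rule cpt_equivE)
  let ?B = "sing_coboundaries p X (topspace X - (K \<union> L)) :: ('a chain \<Rightarrow> 'b) set"
  have 1: "(\<lambda>x\<in>?c. \<phi> x - \<phi>' x) \<in> ?B"
    by (rule subsetD[OF sing_coboundaries_mono K(2)]) auto
  have 2: "(\<lambda>x\<in>?c. \<psi> x - \<psi>' x) \<in> ?B"
    by (rule subsetD[OF sing_coboundaries_mono L(2)]) auto
  note lin = linear_subset_coboundaries[of p X "topspace X - (K \<union> L)", where 'f = 'b]
  have "(\<lambda>x\<in>?c. (\<lambda>x\<in>?c. \<phi> x - \<phi>' x) x + (\<lambda>x\<in>?c. k * (\<lambda>x\<in>?c. \<psi> x - \<psi>' x) x) x) \<in> ?B"
    by (rule linear_subset.add[OF lin 1 linear_subset.smult[OF lin 2]])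
  also have "(\<lambda>x\<in>?c. (\<lambda>x\<in>?c. \<phi> x - \<phi>' x) x + (\<lambda>x\<in>?c. k * (\<lambda>x\<in>?c. \<psi> x - \<psi>' x) x) x) = (\<lambda>x\<in>?c. \<alpha> x - \<alpha>' x)"
    using assms(3) by (auto simp: restrict_def)
  finally show ?thesis
    by (rule cpt_equivI[rotated]) (rule compactin_Un[OF K(1) L(1)])
qed

lemma cpt_equiv_refl: "(\<And>x. singular_chain p X x \<Longrightarrow> \<phi> x = \<psi> x) \<Longrightarrow> cpt_equiv p X \<phi> \<psi>"
  using linear_subset.zero[OF linear_subset_coboundaries[of p X "topspace X - {}"]]
  by (intro cpt_equivI[of X "{}"]) (auto cong: restrict_cong)

lemma cpt_equiv_sym: "cpt_equiv p X \<phi> \<psi> \<Longrightarrow> cpt_equiv p X \<psi> \<phi>"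
  by (rule cpt_equiv_lincomb[where k = "-1", OF cpt_equiv_refl[where \<phi> = \<psi> and \<psi> = \<psi>]]) auto

lemma cpt_equiv_trans:
  assumes "cpt_equiv p X \<phi> \<psi>" "cpt_equiv p X \<psi> \<xi>"
  shows "cpt_equiv p X \<phi> \<xi>"
  by (rule cpt_equiv_lincomb[where k = 1, OF assms]) simp

lemma cpt_maps_class:
  assumes "A \<subseteq> B" "\<phi> \<in> sing_cocycles p X (topspace X - A)"
  shows "cpt_maps p X A B (cohomology_class p X (topspace X - A) \<phi>) = cohomology_class p X (topspace X - B) \<phi>"
proof -
  have "restrict \<phi> (singular_chain_set p X) = \<phi>"
    using linear_subset.extensional[OF linear_subset_cocycles assms(2)] by (rule extensional_restrict)
  moreover have "singular_chain q (subtopology X (topspace X - A)) x"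
    if "singular_chain q (subtopology X (topspace X - B)) x" for q x
    using that by (rule singular_chain_mono) (use assms in auto)
  ultimately show ?thesis
    by (subst sing_restriction_class) auto
qed

text \<open>
  The colimit relation compares two classes over a compact set that contains both \<open>A\<close>
  and \<open>B\<close>, whereas \<open>cpt_equiv\<close> allows any compact set; enlarging the
  compact set reconciles them.
\<close>

lemma colim_rel_cpt_iff:
  assumes A: "compactin X A" and B: "compactin X B"
    and \<phi>: "\<phi> \<in> sing_cocycles p X (topspace X - A)" and \<psi>: "\<psi> \<in> sing_cocycles p X (topspace X - B)"
  shows "((A, cohomology_class p X (topspace X - A) \<phi>), (B, cohomology_class p X (topspace X - B) \<psi>))
      \<in> colim_rel {A. compactin X A} (cpt_objects p X) (cpt_maps p X) \<longleftrightarrow> cpt_equiv p X \<phi> \<psi>"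
    (is "?L \<longleftrightarrow> _")
proof -
  have eq: "cpt_maps p X A K (cohomology_class p X (topspace X - A) \<phi>) = cpt_maps p X B K (cohomology_class p X (topspace X - B) \<psi>)
      \<longleftrightarrow> (\<lambda>x\<in>singular_chain_set p X. \<phi> x - \<psi> x) \<in> sing_coboundaries p X (topspace X - K)"
    if "A \<subseteq> K" "B \<subseteq> K" for K
  proof -
    have "\<phi> \<in> sing_cocycles p X (topspace X - K)"
      by (rule subsetD[OF sing_cocycles_mono \<phi>]) (use that in blast)
    moreover have "\<psi> \<in> sing_cocycles p X (topspace X - K)"
      by (rule subsetD[OF sing_cocycles_mono \<psi>]) (use that in blast)
    ultimately show ?thesis
      unfolding cpt_maps_class[OF that(1) \<phi>] cpt_maps_class[OF that(2) \<psi>]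
      by (rule cohomology_class_eq_iff)
  qed
  show ?thesis
  proof
    assume ?L
    then obtain K where K: "compactin X K" "A \<subseteq> K" "B \<subseteq> K"
      "cpt_maps p X A K (cohomology_class p X (topspace X - A) \<phi>) = cpt_maps p X B K (cohomology_class p X (topspace X - B) \<psi>)"
      unfolding colim_rel_def by auto
    show "cpt_equiv p X \<phi> \<psi>"
      using K(1) K(4)[unfolded eq[OF K(2,3)]] by (rule cpt_equivI)
  next
    assume "cpt_equiv p X \<phi> \<psi>"
    then obtain K where K: "compactin X K" "(\<lambda>x\<in>singular_chain_set p X. \<phi> x - \<psi> x) \<in> sing_coboundaries p X (topspace X - K)"
      by (rule cpt_equivE)
    let ?K = "A \<union> B \<union> K"
    have K': "compactin X ?K" by (intro compactin_Un A B K(1))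
    have "(\<lambda>x\<in>singular_chain_set p X. \<phi> x - \<psi> x) \<in> sing_coboundaries p X (topspace X - ?K)"
      by (rule subsetD[OF sing_coboundaries_mono K(2)]) auto
    then have e: "cpt_maps p X A ?K (cohomology_class p X (topspace X - A) \<phi>) = cpt_maps p X B ?K (cohomology_class p X (topspace X - B) \<psi>)"
      by (subst eq) auto
    have "\<exists>K\<in>{A. compactin X A}. A \<subseteq> K \<and> B \<subseteq> K \<and>
      cpt_maps p X A K (cohomology_class p X (topspace X - A) \<phi>) = cpt_maps p X B K (cohomology_class p X (topspace X - B) \<psi>)"
      by (rule bexI[of _ ?K]) (use e K' in auto)
    then show ?L
      using A B \<phi> \<psi> by (auto simp: colim_rel_def sing_cohomology_simps)
  qed
qed

lemma mem_cpt_class_iff: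
  assumes A: "compactin X A" and \<phi>: "\<phi> \<in> sing_cocycles p X (topspace X - A)"
  shows "x \<in> cpt_class p X A \<phi> \<longleftrightarrow> (\<exists>B \<psi>. compactin X B \<and> \<psi> \<in> sing_cocycles p X (topspace X - B) \<and>
     x = (B, cohomology_class p X (topspace X - B) \<psi>) \<and> cpt_equiv p X \<phi> \<psi>)" (is "_ \<longleftrightarrow> ?R")
proof
  assume x: "x \<in> cpt_class p X A \<phi>"
  obtain B y where xy: "x = (B, y)" by (cases x)
  have r: "((A, cohomology_class p X (topspace X - A) \<phi>), (B, y)) \<in> colim_rel {A. compactin X A} (cpt_objects p X) (cpt_maps p X)"
    using x by (simp add: cpt_class_def xy)
  then have B: "compactin X B" and "y \<in> carrier (cpt_objects p X B)"
    by (auto simp: colim_rel_def)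
  then obtain \<psi> where \<psi>: "\<psi> \<in> sing_cocycles p X (topspace X - B)" "y = cohomology_class p X (topspace X - B) \<psi>"
    unfolding sing_cohomology_simps by (elim imageE)
  have "cpt_equiv p X \<phi> \<psi>" using r unfolding \<psi>(2) colim_rel_cpt_iff[OF A B \<phi> \<psi>(1)] .
  with B \<psi> xy show ?R by (intro exI conjI) simp_all
next
  assume ?R
  then obtain B \<psi> where B: "compactin X B" and \<psi>: "\<psi> \<in> sing_cocycles p X (topspace X - B)"
    and x: "x = (B, cohomology_class p X (topspace X - B) \<psi>)" and e: "cpt_equiv p X \<phi> \<psi>"
    by (elim exE conjE)
  show "x \<in> cpt_class p X A \<phi>"
    using e unfolding x colim_rel_cpt_iff[OF A B \<phi> \<psi>, symmetric] by (simp add: cpt_class_def)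
qed

lemma cpt_class_self:
  assumes A: "compactin X A" and \<phi>: "\<phi> \<in> sing_cocycles p X (topspace X - A)"
  shows "(A, cohomology_class p X (topspace X - A) \<phi>) \<in> cpt_class p X A \<phi>"
  using colim_rel_cpt_iff[OF A A \<phi> \<phi>] cpt_equiv_refl[of p X \<phi> \<phi>] by (simp add: cpt_class_def)

lemma cpt_class_eq_iff:
  assumes A: "compactin X A" and \<phi>: "\<phi> \<in> sing_cocycles p X (topspace X - A)"
    and B: "compactin X B" and \<psi>: "\<psi> \<in> sing_cocycles p X (topspace X - B)"
  shows "cpt_class p X A \<phi> = cpt_class p X B \<psi> \<longleftrightarrow> cpt_equiv p X \<phi> \<psi>"
proof
  assume eq: "cpt_class p X A \<phi> = cpt_class p X B \<psi>"
  have "(B, cohomology_class p X (topspace X - B) \<psi>) \<in> cpt_class p X A \<phi>"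
    unfolding eq by (rule cpt_class_self[OF B \<psi>])
  then show "cpt_equiv p X \<phi> \<psi>"
    using colim_rel_cpt_iff[OF A B \<phi> \<psi>] by (simp add: cpt_class_def)
next
  assume e: "cpt_equiv p X \<phi> \<psi>"
  have same: "cpt_equiv p X \<phi> \<xi> \<longleftrightarrow> cpt_equiv p X \<psi> \<xi>" for \<xi>
    using cpt_equiv_trans[OF e] cpt_equiv_trans[OF cpt_equiv_sym[OF e]] by blast
  show "cpt_class p X A \<phi> = cpt_class p X B \<psi>"
    unfolding set_eq_iff mem_cpt_class_iff[OF A \<phi>] mem_cpt_class_iff[OF B \<psi>] same by simp
qed

lemma cpt_cohomology_carrier:
  "carrier (cpt_cohomology p X :: ('f::field, _) module)
    = {cpt_class p X A \<phi> | A \<phi>. compactin X A \<and> \<phi> \<in> sing_cocycles p X (topspace X - A)}"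
proof -
  let ?r = "colim_rel {A. compactin X A} (cpt_objects p X :: _ \<Rightarrow> ('f, _) module) (cpt_maps p X)"
  have "carrier (cpt_cohomology p X :: ('f, _) module)
     = (\<Union>u\<in>(SIGMA A:{A. compactin X A}. carrier (cpt_objects p X A :: ('f, _) module)). {?r `` {u}})"
    unfolding cpt_cohomology_def directed_colimit_def quotient_def by simp
  then show ?thesis
    unfolding cpt_class_def sing_cohomology_simps by blast
qed

lemma zero_cocycle: "(\<lambda>x\<in>singular_chain_set p X. 0 :: 'f::field) \<in> sing_cocycles p X S"
  by (rule linear_subset.zero[OF linear_subset_cocycles])

lemma UN_eq_constI: "x \<in> A \<Longrightarrow> (\<And>x. x \<in> A \<Longrightarrow> f x = c) \<Longrightarrow> (\<Union>x\<in>A. f x) = c"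
  by blast

lemma cpt_cohomology_zero:
  assumes A: "compactin X A"
  shows "zero (cpt_cohomology p X :: ('f::field, _) module) = cpt_class p X A (\<lambda>x\<in>singular_chain_set p X. 0)"
proof -
  have eq: "cpt_class p X B (\<lambda>x\<in>singular_chain_set p X. 0) = cpt_class p X A (\<lambda>x\<in>singular_chain_set p X. 0 :: 'f)"
    if "compactin X B" for B
    by (rule iffD2[OF cpt_class_eq_iff[OF that zero_cocycle A zero_cocycle] cpt_equiv_refl[OF refl]])
  have "A \<in> {A. compactin X A}" using A by simp
  then have "(\<Union>B\<in>{A. compactin X A}. cpt_class p X B (\<lambda>x\<in>singular_chain_set p X. 0 :: 'f))
     = cpt_class p X A (\<lambda>x\<in>singular_chain_set p X. 0)"
    by (rule UN_eq_constI) (elim CollectE, rule eq)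
  then show ?thesis
    unfolding cpt_cohomology_def directed_colimit_def cpt_class_def
    by (simp only: module.simps ring.simps sing_cohomology_simps)
qed

text \<open>
  The colimit defines the sum as a union over all representatives and all larger compact sets; every
  member of the union is the class on the right.
\<close>

lemma cpt_cohomology_add:
  assumes A: "compactin X A" and \<phi>: "\<phi> \<in> sing_cocycles p X (topspace X - A)"
    and B: "compactin X B" and \<psi>: "\<psi> \<in> sing_cocycles p X (topspace X - B)"
  shows "cpt_class p X A \<phi> \<oplus>\<^bsub>cpt_cohomology p X\<^esub> cpt_class p X B \<psi>
    = cpt_class p X (A \<union> B) (\<lambda>x\<in>singular_chain_set p X. \<phi> x + \<psi> x)" (is "_ = ?R")
proof -
  let ?r = "colim_rel {A. compactin X A} (cpt_objects p X) (cpt_maps p X)"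
  have sum: "(\<lambda>x\<in>singular_chain_set p X. \<phi> x + \<psi> x) \<in> sing_cocycles p X (topspace X - K)"
    if "A \<subseteq> K" "B \<subseteq> K" "\<phi> \<in> sing_cocycles p X (topspace X - A)" "\<psi> \<in> sing_cocycles p X (topspace X - B)"
    for A B K and \<phi> \<psi> :: "'a chain \<Rightarrow> 'b"
    by (rule linear_subset.add[OF linear_subset_cocycles
          subsetD[OF sing_cocycles_mono that(3)] subsetD[OF sing_cocycles_mono that(4)]])
       (use that(1,2) in blast)+
  have inner: "?r `` {(k, cpt_maps p X (fst u) k (snd u) \<oplus>\<^bsub>cpt_objects p X k\<^esub> cpt_maps p X (fst v) k (snd v))} = ?R"
    if u: "u \<in> cpt_class p X A \<phi>" and v: "v \<in> cpt_class p X B \<psi>"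
      and k: "compactin X k" "fst u \<subseteq> k" "fst v \<subseteq> k" for u v k
  proof -
    obtain A' \<phi>' where A': "compactin X A'" and \<phi>': "\<phi>' \<in> sing_cocycles p X (topspace X - A')"
      and u': "u = (A', cohomology_class p X (topspace X - A') \<phi>')" and e: "cpt_equiv p X \<phi> \<phi>'"
      using u unfolding mem_cpt_class_iff[OF A \<phi>] by (elim exE conjE)
    obtain B' \<psi>' where B': "compactin X B'" and \<psi>': "\<psi>' \<in> sing_cocycles p X (topspace X - B')"
      and v': "v = (B', cohomology_class p X (topspace X - B') \<psi>')" and e': "cpt_equiv p X \<psi> \<psi>'"
      using v unfolding mem_cpt_class_iff[OF B \<psi>] by (elim exE conjE)
    have k': "A' \<subseteq> k" "B' \<subseteq> k" using k u' v' by auto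
    have "\<phi>' \<in> sing_cocycles p X (topspace X - k)"
      by (rule subsetD[OF sing_cocycles_mono \<phi>']) (use k' in blast)
    moreover have "\<psi>' \<in> sing_cocycles p X (topspace X - k)"
      by (rule subsetD[OF sing_cocycles_mono \<psi>']) (use k' in blast)
    ultimately have "?r `` {(k, cpt_maps p X (fst u) k (snd u) \<oplus>\<^bsub>cpt_objects p X k\<^esub> cpt_maps p X (fst v) k (snd v))}
       = cpt_class p X k (\<lambda>x\<in>singular_chain_set p X. \<phi>' x + \<psi>' x)"
      unfolding u' v' fst_conv snd_conv cpt_maps_class[OF k'(1) \<phi>'] cpt_maps_class[OF k'(2) \<psi>']
      by (simp add: sing_cohomology_simps cpt_class_def)
    also have "\<dots> = ?R"
    proof (subst cpt_class_eq_iff)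
      show "cpt_equiv p X (\<lambda>x\<in>singular_chain_set p X. \<phi>' x + \<psi>' x) (\<lambda>x\<in>singular_chain_set p X. \<phi> x + \<psi> x)"
        by (rule cpt_equiv_lincomb[where k = 1, OF cpt_equiv_sym[OF e] cpt_equiv_sym[OF e']]) simp
      show "compactin X k" by (rule k(1))
      show "compactin X (A \<union> B)" using A B by (rule compactin_Un)
      show "(\<lambda>x\<in>singular_chain_set p X. \<phi>' x + \<psi>' x) \<in> sing_cocycles p X (topspace X - k)"
        by (rule sum[OF k' \<phi>' \<psi>'])
      show "(\<lambda>x\<in>singular_chain_set p X. \<phi> x + \<psi> x) \<in> sing_cocycles p X (topspace X - (A \<union> B))"
        by (rule sum[OF Un_upper1 Un_upper2 \<phi> \<psi>])
    qed
    finally show ?thesis .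
  qed
  have "(\<Union>u\<in>cpt_class p X A \<phi>. \<Union>v\<in>cpt_class p X B \<psi>. \<Union>k\<in>{k\<in>{A. compactin X A}. fst u \<subseteq> k \<and> fst v \<subseteq> k}.
      ?r `` {(k, cpt_maps p X (fst u) k (snd u) \<oplus>\<^bsub>cpt_objects p X k\<^esub> cpt_maps p X (fst v) k (snd v))}) = ?R"
  proof (intro UN_eq_constI[OF cpt_class_self[OF A \<phi>]] UN_eq_constI[OF cpt_class_self[OF B \<psi>]])
    fix u v assume u: "u \<in> cpt_class p X A \<phi>" and v: "v \<in> cpt_class p X B \<psi>"
    have "compactin X (fst u)" using u unfolding mem_cpt_class_iff[OF A \<phi>] by auto
    moreover have "compactin X (fst v)" using v unfolding mem_cpt_class_iff[OF B \<psi>] by auto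
    ultimately have "fst u \<union> fst v \<in> {k\<in>{A. compactin X A}. fst u \<subseteq> k \<and> fst v \<subseteq> k}"
      by (simp add: compactin_Un)
    then show "(\<Union>k\<in>{k\<in>{A. compactin X A}. fst u \<subseteq> k \<and> fst v \<subseteq> k}.
      ?r `` {(k, cpt_maps p X (fst u) k (snd u) \<oplus>\<^bsub>cpt_objects p X k\<^esub> cpt_maps p X (fst v) k (snd v))}) = ?R"
      by (rule UN_eq_constI) (elim CollectE conjE, rule inner[OF u v])
  qed
  then show ?thesis
    unfolding cpt_cohomology_def directed_colimit_def case_prod_unfold by (simp only: module.simps ring.simps)
qed

lemma cpt_cohomology_smult:
  assumes A: "compactin X A" and \<phi>: "\<phi> \<in> sing_cocycles p X (topspace X - A)"
  shows "c \<odot>\<^bsub>cpt_cohomology p X\<^esub> cpt_class p X A \<phi> = cpt_class p X A (\<lambda>x\<in>singular_chain_set p X. c * \<phi> x)" (is "_ = ?R")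
proof -
  let ?r = "colim_rel {A. compactin X A} (cpt_objects p X) (cpt_maps p X)"
  have "(\<Union>u\<in>cpt_class p X A \<phi>. ?r `` {(fst u, c \<odot>\<^bsub>cpt_objects p X (fst u)\<^esub> snd u)}) = ?R"
  proof (rule UN_eq_constI[OF cpt_class_self[OF A \<phi>]])
    fix u assume u: "u \<in> cpt_class p X A \<phi>"
    obtain A' \<phi>' where A': "compactin X A'" and \<phi>': "\<phi>' \<in> sing_cocycles p X (topspace X - A')"
      and u': "u = (A', cohomology_class p X (topspace X - A') \<phi>')" and e: "cpt_equiv p X \<phi> \<phi>'"
      using u unfolding mem_cpt_class_iff[OF A \<phi>] by (elim exE conjE)
    have "?r `` {(fst u, c \<odot>\<^bsub>cpt_objects p X (fst u)\<^esub> snd u)} = cpt_class p X A' (\<lambda>x\<in>singular_chain_set p X. c * \<phi>' x)"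
      using \<phi>' by (simp add: u' sing_cohomology_simps cpt_class_def)
    also have "\<dots> = ?R"
    proof (subst cpt_class_eq_iff)
      show "cpt_equiv p X (\<lambda>x\<in>singular_chain_set p X. c * \<phi>' x) (\<lambda>x\<in>singular_chain_set p X. c * \<phi> x)"
        by (rule cpt_equiv_lincomb[where k = c, OF cpt_equiv_refl[where \<phi> = \<phi> and \<psi> = \<phi>] cpt_equiv_sym[OF e]])
           (simp_all add: algebra_simps)
    qed (rule A A' linear_subset.smult[OF linear_subset_cocycles \<phi>'] linear_subset.smult[OF linear_subset_cocycles \<phi>])+
    finally show "?r `` {(fst u, c \<odot>\<^bsub>cpt_objects p X (fst u)\<^esub> snd u)} = ?R" .
  qed
  then show ?thesis
    unfolding cpt_cohomology_def directed_colimit_def case_prod_unfold by (simp only: module.simps ring.simps)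
qed

lemma restrict_cochain:
  fixes \<xi> :: "'a chain \<Rightarrow> 'f::field" and U :: "'a set"
  assumes \<xi>: "\<xi> \<in> sing_cochains p Y (topspace Y - A)"
  defines "X \<equiv> subtopology Y U"
  shows "restrict \<xi> (singular_chain_set p X) \<in> sing_cochains p X (topspace X - A)"
proof (rule sing_cochainI)
  fix x y assume "singular_chain p X x" "singular_chain p X y"
  then show "\<xi> (x + y) = \<xi> x + \<xi> y"
    by (intro sing_cochain_add[OF \<xi>]) (simp_all add: X_def singular_chain_subtopology)
next
  fix x assume "singular_chain p (subtopology X (topspace X - A)) x"
  then have "singular_chain p (subtopology Y (U \<inter> (topspace X - A))) x"
    by (simp add: X_def subtopology_subtopology)
  then have "singular_chain p (subtopology Y (topspace Y - A)) x"
    by (rule singular_chain_mono) (auto simp: X_def)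
  then show "\<xi> x = 0" by (rule sing_cochain_rel[OF \<xi>])
qed

lemma restrict_cocycle:
  fixes \<xi> :: "'a chain \<Rightarrow> 'f::field" and U :: "'a set"
  assumes \<xi>: "\<xi> \<in> sing_cocycles p Y (topspace Y - A)"
  defines "X \<equiv> subtopology Y U"
  shows "restrict \<xi> (singular_chain_set p X) \<in> sing_cocycles p X (topspace X - A)"
proof -
  have "singular_chain (Suc p) Y x" if "singular_chain (Suc p) X x" for x
    using that by (simp add: X_def singular_chain_subtopology)
  then show ?thesis
    using restrict_cochain[OF sing_cocycle_cochain[OF \<xi>], of U] \<xi>
    unfolding X_def[symmetric] by (simp add: sing_cocycles_iff singular_chain_boundary_alt)
qed

lemma restrict_coboundary:
  fixes \<xi> :: "'a chain \<Rightarrow> 'f::field" and U :: "'a set"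
  assumes \<xi>: "\<xi> \<in> sing_coboundaries p Y (topspace Y - A)"
  defines "X \<equiv> subtopology Y U"
  shows "restrict \<xi> (singular_chain_set p X) \<in> sing_coboundaries p X (topspace X - A)"
proof -
  have ch: "singular_chain p Y x" if "singular_chain p X x" for x
    using that by (simp add: X_def singular_chain_subtopology)
  obtain \<eta> where \<eta>: "\<eta> \<in> sing_cochains (p - Suc 0) Y (topspace Y - A)"
    and eq: "\<xi> = (\<lambda>x\<in>singular_chain_set p Y. \<eta> (chain_boundary p x))"
    using \<xi> unfolding sing_coboundaries_eq by (elim imageE)
  have "restrict \<xi> (singular_chain_set p X) = (\<lambda>x\<in>singular_chain_set p X.
      restrict \<eta> (singular_chain_set (p - Suc 0) X) (chain_boundary p x))"
    unfolding eq by (rule restrict_ext) (simp add: ch singular_chain_boundary)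
  then show ?thesis
    using sing_coboundariesI[OF restrict_cochain[OF \<eta>, of U]] unfolding X_def[symmetric] by simp
qed

text \<open>
  By excision, equality of classes on an open subspace \<open>U\<close> can be tested on
  \<open>Y\<close>, with compact subsets of \<open>U\<close> as supports.
\<close>

lemma cpt_equiv_restrict_iff:
  fixes \<phi> \<psi> :: "'a chain \<Rightarrow> 'f::field"
  assumes Y: "Hausdorff_space Y" and U: "openin Y U"
    and A: "compactin (subtopology Y U) A" and \<phi>: "\<phi> \<in> sing_cocycles p Y (topspace Y - A)"
    and B: "compactin (subtopology Y U) B" and \<psi>: "\<psi> \<in> sing_cocycles p Y (topspace Y - B)"
  defines "X \<equiv> subtopology Y U"
  shows "cpt_equiv p X (restrict \<phi> (singular_chain_set p X)) (restrict \<psi> (singular_chain_set p X)) \<longleftrightarrow>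
    (\<exists>L. compactin X L \<and> (\<lambda>x\<in>singular_chain_set p Y. \<phi> x - \<psi> x) \<in> sing_coboundaries p Y (topspace Y - L))"
    (is "?L \<longleftrightarrow> ?R")
proof -
  let ?c = "singular_chain_set p X" and ?\<theta> = "\<lambda>x\<in>singular_chain_set p Y. \<phi> x - \<psi> x"
  have tX: "topspace X = U" using openin_subset[OF U] by (auto simp: X_def)
  have ch: "x \<in> singular_chain_set p Y" if "x \<in> ?c" for x
    using that by (simp add: X_def singular_chain_subtopology)
  have res: "restrict ?\<theta> ?c = (\<lambda>x\<in>?c. restrict \<phi> ?c x - restrict \<psi> ?c x)"
    by (rule restrict_ext) (simp add: ch del: mem_Collect_eq)
  show ?thesis
  proof
    assume ?L
    then obtain L where L: "compactin X L" and cob: "restrict ?\<theta> ?c \<in> sing_coboundaries p X (topspace X - L)"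
      unfolding res by (rule cpt_equivE)
    \<comment> \<open>The difference must be a cocycle relative to the complement of the compact set before
      excision applies, so the supports of both cocycles are added.\<close>
    let ?L = "L \<union> (A \<union> B)"
    have L': "compactin X ?L" using L A B unfolding X_def by (intro compactin_Un)
    then have closed: "closedin Y ?L" "?L \<subseteq> U"
      using compactin_imp_closedin[OF Y, of ?L] unfolding X_def compactin_subtopology by blast+
    have cocycle: "?\<theta> \<in> sing_cocycles p Y (topspace Y - ?L)"
      by (intro linear_subset_diff[OF linear_subset_cocycles] subsetD[OF sing_cocycles_mono \<phi>]
          subsetD[OF sing_cocycles_mono \<psi>]) auto
    have "restrict ?\<theta> ?c \<in> sing_coboundaries p X (topspace X - ?L)"
      by (rule subsetD[OF sing_coboundaries_mono cob]) auto
    then have "?\<theta> \<in> sing_coboundaries p Y (topspace Y - ?L)"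
      using excision_inj[OF U closed cocycle] unfolding tX unfolding X_def by blast
    with L' show ?R by (intro exI conjI)
  next
    assume ?R
    then obtain L where L: "compactin X L" and cob: "?\<theta> \<in> sing_coboundaries p Y (topspace Y - L)"
      by (elim exE conjE)
    have "restrict ?\<theta> ?c \<in> sing_coboundaries p X (topspace X - L)"
      using restrict_coboundary[OF cob, of U] by (simp only: X_def)
    then show ?L unfolding res by (rule cpt_equivI[OF L])
  qed
qed

text \<open>
  The canonical map chooses preimages under the excision isomorphism. For the restriction of a
  cocycle \<open>\<psi>\<close> on \<open>Y\<close> any such preimage is equivalent to
  \<open>\<psi>\<close>, so no choice has to be followed.
\<close>

lemma cpt_extension_class:
  fixes \<psi> :: "'a chain \<Rightarrow> 'f::field"
  assumes Y: "Hausdorff_space Y" and U: "openin Y U"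
    and A: "compactin (subtopology Y U) A" and \<psi>: "\<psi> \<in> sing_cocycles p Y (topspace Y - A)"
  defines "X \<equiv> subtopology Y U"
  shows "cpt_extension p X Y (cpt_class p X A (restrict \<psi> (singular_chain_set p X))) = cpt_class p Y A \<psi>"
    (is "_ (cpt_class p X A ?\<phi>) = _")
proof -
  let ?r = "colim_rel {A. compactin Y A} (cpt_objects p Y) (cpt_maps p Y)"
  have UY: "U \<subseteq> topspace Y" using U openin_subset by blast
  have tX: "topspace X = U" using UY by (auto simp: X_def)
  have ch: "singular_chain q Y x" if "singular_chain q X x" for q x
    using that by (simp add: X_def singular_chain_subtopology)
  have chA: "singular_chain q (subtopology Y (topspace Y - A)) x" if "singular_chain q (subtopology X (topspace X - A)) x" for q x A
  proof -
    have "singular_chain q (subtopology Y (U \<inter> (topspace X - A))) x"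
      using that by (simp add: X_def subtopology_subtopology)
    then show ?thesis by (rule singular_chain_mono) (use UY tX in auto)
  qed
  have cpt: "compactin Y A \<and> closedin Y A \<and> A \<subseteq> U" if "compactin X A" for A
    using that Y unfolding X_def by (auto simp: compactin_subtopology compactin_imp_closedin)
  have restr: "restrict \<xi> (singular_chain_set p X) \<in> sing_cocycles p X (topspace X - A)"
    if "\<xi> \<in> sing_cocycles p Y (topspace Y - A)" for \<xi> :: "'a chain \<Rightarrow> 'f" and A
    using restrict_cocycle[OF that] by (simp only: X_def)
  have A': "compactin X A" using A by (simp add: X_def)
  have \<phi>: "?\<phi> \<in> sing_cocycles p X (topspace X - A)" using restr[OF \<psi>] .
  have "(\<Union>u\<in>cpt_class p X A ?\<phi>. ?r `` {(fst u,
        inv_into (carrier (cpt_objects p Y (fst u))) (sing_restriction p X (topspace X - fst u)) (snd u))}) = cpt_class p Y A \<psi>"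
  proof (rule UN_eq_constI[OF cpt_class_self[OF A' \<phi>]])
    fix u assume u: "u \<in> cpt_class p X A ?\<phi>"
    obtain B \<phi>' where B: "compactin X B" and \<phi>': "\<phi>' \<in> sing_cocycles p X (topspace X - B)"
      and u': "u = (B, cohomology_class p X (topspace X - B) \<phi>')" and e: "cpt_equiv p X ?\<phi> \<phi>'"
      using u unfolding mem_cpt_class_iff[OF A' \<phi>] by (elim exE conjE)
    note Bc = cpt[OF B, THEN conjunct1] cpt[OF B, THEN conjunct2, THEN conjunct1] cpt[OF B, THEN conjunct2, THEN conjunct2]
    have restrict_class: "sing_restriction p X (topspace X - B) (cohomology_class p Y (topspace Y - B) \<xi>)
        = cohomology_class p X (topspace X - B) (restrict \<xi> (singular_chain_set p X))" for \<xi> :: "'a chain \<Rightarrow> 'f"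
      by (rule sing_restriction_class) (use ch chA in auto)
    obtain \<xi>0 :: "'a chain \<Rightarrow> 'f" where \<xi>0: "\<xi>0 \<in> sing_cocycles p Y (topspace Y - B)"
      "restrict \<xi>0 (singular_chain_set p X) = \<phi>'"
      using excision_surj[OF U Bc(2,3)] \<phi>'[unfolded tX] unfolding X_def[symmetric] by metis
    have "snd u \<in> sing_restriction p X (topspace X - B) ` carrier (cpt_objects p Y B)"
      unfolding sing_cohomology_simps
      by (rule image_eqI[OF _ imageI[OF \<xi>0(1)]]) (simp add: u' restrict_class \<xi>0(2))
    then have inv: "inv_into (carrier (cpt_objects p Y B)) (sing_restriction p X (topspace X - B)) (snd u) \<in> carrier (cpt_objects p Y B)"
      "sing_restriction p X (topspace X - B) (inv_into (carrier (cpt_objects p Y B)) (sing_restriction p X (topspace X - B)) (snd u)) = snd u"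
      by (rule inv_into_into, rule f_inv_into_f)
    then obtain \<xi> where \<xi>: "\<xi> \<in> sing_cocycles p Y (topspace Y - B)"
      and inv_eq: "inv_into (carrier (cpt_objects p Y B)) (sing_restriction p X (topspace X - B)) (snd u) = cohomology_class p Y (topspace Y - B) \<xi>"
      unfolding sing_cohomology_simps by (elim imageE)
    have "cohomology_class p X (topspace X - B) (restrict \<xi> (singular_chain_set p X)) = cohomology_class p X (topspace X - B) \<phi>'"
      using inv(2) unfolding inv_eq restrict_class by (simp add: u')
    then have "(\<lambda>x\<in>singular_chain_set p X. restrict \<xi> (singular_chain_set p X) x - \<phi>' x) \<in> sing_coboundaries p X (topspace X - B)"
      unfolding cohomology_class_eq_iff[OF restr[OF \<xi>] \<phi>'] .
    then have "cpt_equiv p X (restrict \<xi> (singular_chain_set p X)) \<phi>'" by (rule cpt_equivI[OF B])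
    then have "cpt_equiv p X (restrict \<xi> (singular_chain_set p X)) ?\<phi>"
      using cpt_equiv_sym[OF e] by (rule cpt_equiv_trans)
    then obtain L where L: "compactin X L"
      and cob: "(\<lambda>x\<in>singular_chain_set p Y. \<xi> x - \<psi> x) \<in> sing_coboundaries p Y (topspace Y - L)"
      using cpt_equiv_restrict_iff[OF Y U, of B \<xi> p A \<psi>] B A \<xi> \<psi> unfolding X_def by blast
    then have "cpt_equiv p Y \<xi> \<psi>" using cpt[OF L] by (intro cpt_equivI[of Y L]) auto
    then have "cpt_class p Y B \<xi> = cpt_class p Y A \<psi>"
      by (subst cpt_class_eq_iff) (use Bc \<xi> \<psi> cpt[OF A'] in auto)
    moreover have "?r `` {(fst u, inv_into (carrier (cpt_objects p Y (fst u))) (sing_restriction p X (topspace X - fst u)) (snd u))}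
      = cpt_class p Y B \<xi>"
      using inv_eq by (simp add: u' cpt_class_def)
    ultimately show "?r `` {(fst u, inv_into (carrier (cpt_objects p Y (fst u))) (sing_restriction p X (topspace X - fst u)) (snd u))}
      = cpt_class p Y A \<psi>" by simp
  qed
  then show ?thesis
    unfolding cpt_extension_def case_prod_unfold .
qed

section \<open>Alternating cochains on vertex tuples\<close>

text \<open>
  Signs act on an arbitrary abelian group, so that the identity below applies both to cochains with
  values in a field and to chain-valued cochains.
\<close>

definition sign_act :: "nat \<Rightarrow> 'a::ab_group_add \<Rightarrow> 'a"
  where "sign_act n x = (if even n then x else - x)"

lemma sign_act_0 [simp]: "sign_act n 0 = 0"
  by (simp add: sign_act_def)

lemma sign_act_sum: "sign_act n (sum f I) = (\<Sum>i\<in>I. sign_act n (f i))"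
  by (simp add: sign_act_def sum_negf)

lemma sign_act_sign_act: "sign_act m (sign_act n x) = sign_act (m + n) x"
  by (simp add: sign_act_def)

lemma sign_act_cong: "even (m + n) \<Longrightarrow> sign_act m x = sign_act n x"
  by (auto simp: sign_act_def)

lemma sign_act_cancel: "odd (m + n) \<Longrightarrow> sign_act m x + sign_act n x = 0"
  by (auto simp: sign_act_def)

lemma sign_act_mult: "sign_act n (x :: 'a::ring_1) = (- 1) ^ n * x"
  by (auto simp: sign_act_def)

lemma sign_act_frag_cmul: "sign_act n c = frag_cmul ((- 1) ^ n) c"
  by (auto simp: sign_act_def)

lemma additive_sign_act: "Modules.additive T \<Longrightarrow> T (sign_act n x) = sign_act n (T x)"
  by (simp add: sign_act_def additive.minus)

text \<open>
  The monotone enumeration of the natural numbers without \<open>k\<close>, that is, the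
  \<open>k\<close>-th coface map.
\<close>

definition skip :: "nat \<Rightarrow> nat \<Rightarrow> nat"
  where "skip k i = (if i < k then i else Suc i)"

definition inversions :: "nat \<Rightarrow> (nat \<Rightarrow> 'v::linorder) \<Rightarrow> nat"
  where "inversions p t = card {(i, j). i < j \<and> j \<le> p \<and> t j < t i}"

text \<open>
  The alternating function on ordered vertex tuples that corresponds to a function on vertex sets:
  tuples with a repetition give zero, the others the value on the set with the sign of the sorting
  permutation.
\<close>

definition alternate :: "nat \<Rightarrow> ('v::linorder set \<Rightarrow> 'a::ab_group_add) \<Rightarrow> (nat \<Rightarrow> 'v) \<Rightarrow> 'a"
  where "alternate p c t = (if inj_on t {..p} then sign_act (inversions p t) (c (t ` {..p})) else 0)"

text \<open>
  The coboundary for simplices oriented by the vertex order, for all vertex sets at once.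
\<close>

definition simplicial_coboundary :: "('v::linorder set \<Rightarrow> 'a::ab_group_add) \<Rightarrow> 'v set \<Rightarrow> 'a"
  where "simplicial_coboundary c \<tau> = (\<Sum>v\<in>\<tau>. sign_act (card {u\<in>\<tau>. u < v}) (c (\<tau> - {v})))"

lemma skip_image: "k \<le> Suc p \<Longrightarrow> skip k ` {..p} = {..Suc p} - {k}"
proof (intro equalityI subsetI)
  fix j assume k: "k \<le> Suc p" and j: "j \<in> {..Suc p} - {k}"
  show "j \<in> skip k ` {..p}"
  proof (cases "j < k")
    case True
    with k show ?thesis by (intro image_eqI[of _ _ j]) (auto simp: skip_def)
  next
    case False
    with j show ?thesis by (intro image_eqI[of _ _ "j - 1"]) (auto simp: skip_def)
  qed
qed (auto simp: skip_def)

lemma strict_mono_skip: "strict_mono (skip k)"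
  by (auto simp: strict_mono_def skip_def)

lemma skip_neq: "skip k i \<noteq> k"
  by (auto simp: skip_def)

lemma inj_on_skip: "k \<le> Suc p \<Longrightarrow> inj_on (t \<circ> skip k) {..p} \<longleftrightarrow> inj_on t ({..Suc p} - {k})"
  using comp_inj_on_iff[of "skip k" "{..p}" t] strict_mono_imp_inj_on[OF strict_mono_skip, of k]
  by (metis inj_on_subset skip_image subset_UNIV)

text \<open>
  Inversions are sorted by whether they involve position \<open>k\<close>, and on which side.
\<close>

lemma inversions_skip:
  assumes k: "k \<le> Suc p"
  shows "inversions (Suc p) t = inversions p (t \<circ> skip k)
    + card {i. i < k \<and> t k < t i} + card {j. k < j \<and> j \<le> Suc p \<and> t j < t k}"
proof -
  let ?I = "{(i, j). i < j \<and> j \<le> p \<and> (t \<circ> skip k) j < (t \<circ> skip k) i}"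
  let ?f = "map_prod (skip k) (skip k)"
  let ?A = "{i. i < k \<and> t k < t i}" and ?B = "{j. k < j \<and> j \<le> Suc p \<and> t j < t k}"
  have fin: "finite ?I" by (rule finite_subset[of _ "{..p} \<times> {..p}"]) auto
  have split: "{(i, j). i < j \<and> j \<le> Suc p \<and> t j < t i} = ?f ` ?I \<union> ((\<lambda>i. (i, k)) ` ?A \<union> Pair k ` ?B)"
  proof (intro equalityI subsetI)
    fix x assume "x \<in> {(i, j). i < j \<and> j \<le> Suc p \<and> t j < t i}"
    then obtain i j where x: "x = (i, j)" "i < j" "j \<le> Suc p" "t j < t i" by auto
    show "x \<in> ?f ` ?I \<union> ((\<lambda>i. (i, k)) ` ?A \<union> Pair k ` ?B)"
    proof (cases "i = k \<or> j = k")
      case True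
      then show ?thesis using x k by auto
    next
      case False
      then have "i \<in> {..Suc p} - {k}" "j \<in> {..Suc p} - {k}" using x by auto
      then obtain i' j' where ij: "i = skip k i'" "j = skip k j'" "j' \<le> p"
        unfolding skip_image[OF k, symmetric] by auto
      then have "i' < j'" using x strict_mono_less[OF strict_mono_skip] by metis
      then show ?thesis using x ij by force
    qed
  next
    fix x assume "x \<in> ?f ` ?I \<union> ((\<lambda>i. (i, k)) ` ?A \<union> Pair k ` ?B)"
    then show "x \<in> {(i, j). i < j \<and> j \<le> Suc p \<and> t j < t i}"
      using k skip_image[OF k] strict_mono_less[OF strict_mono_skip, of k] by (auto simp: skip_def)
  qed
  have "inj ?f"
    using strict_mono_imp_inj_on[OF strict_mono_skip, of k] by (simp add: prod.inj_map)
  then have 1: "card (?f ` ?I) = inversions p (t \<circ> skip k)"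
    unfolding inversions_def by (intro card_image) (rule inj_on_subset, auto)
  have 2: "card ((\<lambda>i. (i, k)) ` ?A) = card ?A" "card (Pair k ` ?B) = card ?B"
    by (auto intro!: card_image inj_onI)
  have disj: "(\<lambda>i. (i, k)) ` ?A \<inter> Pair k ` ?B = {}" by auto
  have disj': "?f ` ?I \<inter> ((\<lambda>i. (i, k)) ` ?A \<union> Pair k ` ?B) = {}"
    using skip_neq[of k] by auto
  show ?thesis
    unfolding inversions_def[of "Suc p"] split
    using fin disj disj' 1 2 by (simp add: card_Un_disjoint)
qed

lemma alternate_cong:
  assumes "\<And>i. i \<le> p \<Longrightarrow> t i = t' i"
  shows "alternate p c t = alternate p c t'"
proof -
  have "{(i, j). i < j \<and> j \<le> p \<and> t j < t i} = {(i, j). i < j \<and> j \<le> p \<and> t' j < t' i}"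
    using assms by auto
  moreover have "inj_on t {..p} = inj_on t' {..p}" "t ` {..p} = t' ` {..p}"
    using assms by (auto intro!: inj_on_cong image_cong)
  ultimately show ?thesis by (simp add: alternate_def inversions_def)
qed

text \<open>
  Alternation is a cochain map from vertex sets to tuples. For an injective tuple this compares the
  position \<open>k\<close> of a vertex with its rank in the vertex set: they differ by inversions
  involving \<open>k\<close>, up to an even number. If \<open>t i = t j\<close>, only the omissions
  of \<open>i\<close> and \<open>j\<close> can contribute, and the two resulting tuples differ by a
  cycle of length \<open>j - i\<close>, so their terms cancel.
\<close>

lemma alternate_coboundary:
  "(\<Sum>k\<le>Suc p. sign_act k (alternate p c (t \<circ> skip k))) = alternate (Suc p) (simplicial_coboundary c) t"
proof (cases "inj_on t {..Suc p}")
  case inj: True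
  let ?\<tau> = "t ` {..Suc p}"
  have summand: "sign_act k (alternate p c (t \<circ> skip k))
      = sign_act (inversions (Suc p) t) (sign_act (card {u\<in>?\<tau>. u < t k}) (c (?\<tau> - {t k})))"
    if k: "k \<le> Suc p" for k
  proof -
    let ?a = "card {i. i < k \<and> t k < t i}" and ?b = "card {j. k < j \<and> j \<le> Suc p \<and> t j < t k}"
    let ?c = "card {i. i < k \<and> t i < t k}"
    have "k = card {..<k}" by simp
    also have "{..<k} = {i. i < k \<and> t k < t i} \<union> {i. i < k \<and> t i < t k}"
      using k inj_on_eq_iff[OF inj, of _ k] by (auto simp: not_less_iff_gr_or_eq)
    also have "card \<dots> = ?a + ?c" by (rule card_Un_disjoint) auto
    finally have ka: "k = ?a + ?c" .
    have below: "{u\<in>?\<tau>. u < t k} = t ` ({i. i < k \<and> t i < t k} \<union> {j. k < j \<and> j \<le> Suc p \<and> t j < t k})"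
    proof (intro equalityI subsetI)
      fix u assume "u \<in> {u\<in>?\<tau>. u < t k}"
      then obtain i where i: "i \<le> Suc p" "u = t i" "t i < t k" by auto
      then have "i \<noteq> k" by auto
      then show "u \<in> t ` ({i. i < k \<and> t i < t k} \<union> {j. k < j \<and> j \<le> Suc p \<and> t j < t k})"
        using i by (intro image_eqI[of _ _ i]) auto
    qed (use k in auto)
    have "card {u\<in>?\<tau>. u < t k} = card ({i. i < k \<and> t i < t k} \<union> {j. k < j \<and> j \<le> Suc p \<and> t j < t k})"
      unfolding below
      by (rule card_image, rule inj_on_subset[OF inj]) (use k in auto)
    also have "\<dots> = ?c + ?b" by (rule card_Un_disjoint) auto
    finally have rank: "card {u\<in>?\<tau>. u < t k} = ?c + ?b" .
    have im: "(t \<circ> skip k) ` {..p} = ?\<tau> - {t k}"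
      unfolding image_comp[symmetric] skip_image[OF k] using inj k
      by (subst inj_on_image_set_diff[OF inj]) auto
    have "inj_on (t \<circ> skip k) {..p}"
      unfolding inj_on_skip[OF k] by (rule inj_on_subset[OF inj]) auto
    then have "sign_act k (alternate p c (t \<circ> skip k)) = sign_act (k + inversions p (t \<circ> skip k)) (c (?\<tau> - {t k}))"
      unfolding alternate_def im by (simp add: sign_act_sign_act)
    also have "\<dots> = sign_act (inversions (Suc p) t + card {u\<in>?\<tau>. u < t k}) (c (?\<tau> - {t k}))"
      unfolding inversions_skip[OF k, of t] rank by (rule sign_act_cong) (subst ka, simp, blast)
    finally show ?thesis by (simp add: sign_act_sign_act)
  qed
  have "(\<Sum>k\<le>Suc p. sign_act k (alternate p c (t \<circ> skip k)))
    = sign_act (inversions (Suc p) t) (\<Sum>k\<le>Suc p. sign_act (card {u\<in>?\<tau>. u < t k}) (c (?\<tau> - {t k})))"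
    unfolding sign_act_sum by (rule sum.cong) (use summand in auto)
  also have "(\<Sum>k\<le>Suc p. sign_act (card {u\<in>?\<tau>. u < t k}) (c (?\<tau> - {t k}))) = simplicial_coboundary c ?\<tau>"
    unfolding simplicial_coboundary_def by (rule sum.reindex[OF inj, unfolded comp_def, symmetric])
  finally show ?thesis using inj by (simp only: alternate_def[of "Suc p"] if_True)
next
  case False
  then obtain i j where ij: "i < j" "j \<le> Suc p" "t i = t j"
    unfolding inj_on_def by (metis atMost_iff nat_neq_iff)
  let ?f = "\<lambda>k. sign_act k (alternate p c (t \<circ> skip k))"
  have zero: "?f k = 0" if "k \<le> Suc p" "k \<noteq> i" "k \<noteq> j" for k
  proof -
    have "\<not> inj_on (t \<circ> skip k) {..p}"
      unfolding inj_on_skip[OF that(1)] using ij that by (auto dest!: inj_onD)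
    then show ?thesis by (simp add: alternate_def)
  qed
  have "(\<Sum>k\<le>Suc p. ?f k) = (\<Sum>k\<in>{i, j}. ?f k)"
    by (rule sum.mono_neutral_right) (use zero ij in auto)
  also have "\<dots> = ?f i + ?f j" using ij by simp
  also have "\<dots> = 0"
  proof -
    have i: "i \<le> Suc p" using ij by simp
    have del: "t ` ({..Suc p} - {a}) = t ` {..Suc p}" if "b \<le> Suc p" "b \<noteq> a" "t a = t b" for a b
    proof (intro equalityI image_subsetI)
      fix l assume "l \<in> {..Suc p}"
      with that show "t l \<in> t ` ({..Suc p} - {a})" by (cases "l = a") auto
    qed auto
    have im: "(t \<circ> skip i) ` {..p} = t ` {..Suc p}" "(t \<circ> skip j) ` {..p} = t ` {..Suc p}"
      unfolding image_comp[symmetric] skip_image[OF i] skip_image[OF ij(2)]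
      using del[of j i] del[of i j] ij i by auto
    have inj_iff: "inj_on (t \<circ> skip k) {..p} \<longleftrightarrow> card (t ` {..Suc p}) = Suc p"
      if "(t \<circ> skip k) ` {..p} = t ` {..Suc p}" for k
      using inj_on_iff_eq_card[of "{..p}" "t \<circ> skip k"] that by simp
    show ?thesis
    proof (cases "card (t ` {..Suc p}) = Suc p")
      case True
      then have "inj_on t ({..Suc p} - {j})"
        using inj_iff[OF im(2)] inj_on_skip[OF ij(2), of t] by simp
      then have ne: "t l \<noteq> t i" if "i < l" "l < j" for l
        using inj_on_eq_iff[of t "{..Suc p} - {j}" l i] that ij by auto
      \<comment> \<open>The entries strictly between the two equal ones are counted according to whether they
        are above or below the repeated vertex.\<close>
      let ?g = "card {l. i < l \<and> l < j \<and> t i < t l}" and ?l = "card {l. i < l \<and> l < j \<and> t l < t i}"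
      have "{l. i < l \<and> l < j} = {l. i < l \<and> l < j \<and> t i < t l} \<union> {l. i < l \<and> l < j \<and> t l < t i}"
        using ne by (auto simp: neq_iff)
      moreover have "card {l. i < l \<and> l < j} = j - Suc i"
        using card_greaterThanLessThan[of i j] by (simp add: greaterThanLessThan_def greaterThan_def lessThan_def Int_def)
      moreover have "card ({l. i < l \<and> l < j \<and> t i < t l} \<union> {l. i < l \<and> l < j \<and> t l < t i}) = ?g + ?l"
        by (rule card_Un_disjoint) auto
      ultimately have gl: "j = ?g + ?l + Suc i" using ij by simp
      have "l < j \<and> t j < t l \<longleftrightarrow> (l < i \<and> t i < t l) \<or> (i < l \<and> l < j \<and> t i < t l)" for l
        using ij by (cases l i rule: linorder_cases) auto
      then have "{l. l < j \<and> t j < t l} = {l. l < i \<and> t i < t l} \<union> {l. i < l \<and> l < j \<and> t i < t l}"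
        by auto
      moreover have "card ({l. l < i \<and> t i < t l} \<union> {l. i < l \<and> l < j \<and> t i < t l}) = card {l. l < i \<and> t i < t l} + ?g"
        by (rule card_Un_disjoint) auto
      ultimately have aj: "card {l. l < j \<and> t j < t l} = card {l. l < i \<and> t i < t l} + ?g" by simp
      have "i < l \<and> l \<le> Suc p \<and> t l < t i \<longleftrightarrow> (i < l \<and> l < j \<and> t l < t i) \<or> (j < l \<and> l \<le> Suc p \<and> t l < t j)" for l
        using ij by (cases l j rule: linorder_cases) auto
      then have "{l. i < l \<and> l \<le> Suc p \<and> t l < t i} = {l. i < l \<and> l < j \<and> t l < t i} \<union> {l. j < l \<and> l \<le> Suc p \<and> t l < t j}"
        by auto
      moreover have "card ({l. i < l \<and> l < j \<and> t l < t i} \<union> {l. j < l \<and> l \<le> Suc p \<and> t l < t j}) = ?l + card {l. j < l \<and> l \<le> Suc p \<and> t l < t j}"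
        by (rule card_Un_disjoint) auto
      ultimately have bi: "card {l. i < l \<and> l \<le> Suc p \<and> t l < t i} = ?l + card {l. j < l \<and> l \<le> Suc p \<and> t l < t j}" by simp
      have "inversions p (t \<circ> skip i) + ?l = inversions p (t \<circ> skip j) + ?g"
        using inversions_skip[OF i, of t] inversions_skip[OF ij(2), of t] aj bi by simp
      then have "even (inversions p (t \<circ> skip i) + ?l + (inversions p (t \<circ> skip j) + ?g))" by simp
      then have "odd (i + inversions p (t \<circ> skip i) + (j + inversions p (t \<circ> skip j)))"
        using gl by presburger
      then show ?thesis
        using True inj_iff im by (simp add: alternate_def sign_act_sign_act sign_act_cancel)
    next
      case False
      then show ?thesis using inj_iff im by (simp add: alternate_def)
    qed
  qed
  finally show ?thesis using False by (simp only: alternate_def[of "Suc p"] if_False)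
qed

section \<open>Vertex approximation on the geometric realization\<close>

definition support :: "('v \<Rightarrow> real) \<Rightarrow> 'v set"
  where "support x = {v. x v \<noteq> 0}"

definition closed_simplex :: "'v set \<Rightarrow> ('v \<Rightarrow> real) set"
  where "closed_simplex \<tau> = {x. (\<forall>v. 0 \<le> x v) \<and> support x \<subseteq> \<tau> \<and> sum x \<tau> = 1}"

lemma mem_open_simplex_iff: "x \<in> open_simplex \<sigma> \<longleftrightarrow> support x = \<sigma> \<and> (\<forall>v. 0 \<le> x v) \<and> sum x \<sigma> = 1"
proof -
  have "(\<forall>v\<in>\<sigma>. 0 < x v) \<and> (\<forall>v. v \<notin> \<sigma> \<longrightarrow> x v = 0) \<longleftrightarrow> support x = \<sigma> \<and> (\<forall>v. 0 \<le> x v)"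
    unfolding support_def set_eq_iff mem_Collect_eq by (metis less_eq_real_def less_irrefl)
  then show ?thesis by (auto simp: open_simplex_def)
qed

lemma mem_underlying_set_iff:
  "x \<in> underlying_set A \<longleftrightarrow> support x \<in> A \<and> (\<forall>v. 0 \<le> x v) \<and> sum x (support x) = 1"
  by (auto simp: underlying_set_def mem_open_simplex_iff)

lemma openin_powertop_coordinates:
  assumes "finite V" "\<And>v. v \<in> V \<Longrightarrow> open (S v)"
  shows "openin (powertop_real UNIV) {x :: 'v \<Rightarrow> real. \<forall>v\<in>V. x v \<in> S v}"
proof -
  have "open {x :: 'v \<Rightarrow> real. x v \<in> S v}" if "v \<in> V" for v
    using open_vimage[OF assms(2)[OF that], of "\<lambda>x :: 'v \<Rightarrow> real. x v"]
    by (simp add: vimage_def continuous_on_product_coordinates)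
  then have "open (\<Inter>v\<in>V. {x :: 'v \<Rightarrow> real. x v \<in> S v})"
    using assms(1) by blast
  moreover have "(\<Inter>v\<in>V. {x :: 'v \<Rightarrow> real. x v \<in> S v}) = {x. \<forall>v\<in>V. x v \<in> S v}" by auto
  ultimately show ?thesis by (simp add: euclidean_product_topology)
qed

lemma closedin_powertop_coordinates:
  assumes "\<And>v. v \<in> V \<Longrightarrow> closed (S v)"
  shows "closedin (powertop_real UNIV) {x :: 'v \<Rightarrow> real. \<forall>v\<in>V. x v \<in> S v}"
proof -
  have "closed {x :: 'v \<Rightarrow> real. x v \<in> S v}" if "v \<in> V" for v
    using closed_vimage[OF assms(1)[OF that], of "\<lambda>x :: 'v \<Rightarrow> real. x v"]
    by (simp add: vimage_def continuous_on_product_coordinates)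
  then have "closed (\<Inter>v\<in>V. {x :: 'v \<Rightarrow> real. x v \<in> S v})" by blast
  moreover have "(\<Inter>v\<in>V. {x :: 'v \<Rightarrow> real. x v \<in> S v}) = {x. \<forall>v\<in>V. x v \<in> S v}" by auto
  ultimately show ?thesis by (simp add: euclidean_product_topology)
qed

lemma compactin_closed_simplex:
  assumes "finite \<tau>"
  shows "compactin (powertop_real UNIV) (closed_simplex \<tau>)"
proof (rule closed_compactin)
  show "compactin (powertop_real UNIV) (UNIV \<rightarrow>\<^sub>E {0..1::real})"
    by (simp add: compactin_PiE)
  show "closed_simplex \<tau> \<subseteq> UNIV \<rightarrow>\<^sub>E {0..1}"
  proof
    fix x assume x: "x \<in> closed_simplex \<tau>"
    have "x v \<le> 1" for v
    proof (cases "v \<in> \<tau>")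
      case True
      then have "x v \<le> sum x \<tau>"
        using x assms by (intro member_le_sum) (auto simp: closed_simplex_def)
      then show ?thesis using x by (simp add: closed_simplex_def)
    next
      case False
      then have "x v = 0" using x unfolding closed_simplex_def support_def by blast
      then show ?thesis by simp
    qed
    then show "x \<in> UNIV \<rightarrow>\<^sub>E {0..1}" using x by (auto simp: closed_simplex_def)
  qed
  have "closed {x :: 'a \<Rightarrow> real. sum x \<tau> = 1}"
    by (rule closed_Collect_eq) (auto intro!: continuous_on_sum continuous_on_product_coordinates)
  then have 1: "closedin (powertop_real UNIV) {x :: 'a \<Rightarrow> real. sum x \<tau> = 1}"
    by (simp add: euclidean_product_topology)
  have "closed_simplex \<tau> = {x. \<forall>v\<in>UNIV. x v \<in> {0..}} \<inter> {x. \<forall>v\<in>-\<tau>. x v \<in> {0}} \<inter> {x. sum x \<tau> = 1}"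
    by (auto simp: closed_simplex_def support_def)
  then show "closedin (powertop_real UNIV) (closed_simplex \<tau>)"
    using closedin_powertop_coordinates[of UNIV "\<lambda>_. {0..}"] closedin_powertop_coordinates[of "-\<tau>" "\<lambda>_. {0}"] 1
    by (auto intro!: closedin_Int)
qed

definition std_vertex :: "nat \<Rightarrow> nat \<Rightarrow> real"
  where "std_vertex i = (\<lambda>j. if j = i then 1 else 0)"

lemma std_vertex_in [simp]: "std_vertex i \<in> standard_simplex p \<longleftrightarrow> i \<le> p"
  by (simp add: std_vertex_def)

lemma simplical_face_std_vertex: "simplical_face k (std_vertex i) = std_vertex (skip k i)"
  by (auto simp: simplical_face_def std_vertex_def skip_def fun_eq_iff)

definition rank_in :: "'v::linorder set \<Rightarrow> 'v \<Rightarrow> nat"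
  where "rank_in \<tau> v = card {u\<in>\<tau>. u < v}"

lemma rank_in_less_iff:
  assumes "finite \<tau>" "u \<in> \<tau>" "v \<in> \<tau>"
  shows "rank_in \<tau> u < rank_in \<tau> v \<longleftrightarrow> u < v"
proof -
  have mono: "rank_in \<tau> u < rank_in \<tau> v" if "u < v" "u \<in> \<tau>" for u v
    unfolding rank_in_def using assms that by (intro psubset_card_mono) auto
  then show ?thesis using assms by (metis linorder_neqE not_less_iff_gr_or_eq)
qed

lemma bij_betw_rank_in: "finite \<tau> \<Longrightarrow> bij_betw (rank_in \<tau>) \<tau> {..<card \<tau>}"
proof -
  assume fin: "finite \<tau>"
  have inj: "inj_on (rank_in \<tau>) \<tau>"
    using rank_in_less_iff[OF fin] by (intro inj_onI) (metis less_irrefl linorder_neqE)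
  have "rank_in \<tau> v < card \<tau>" if "v \<in> \<tau>" for v
    unfolding rank_in_def using fin that by (intro psubset_card_mono) auto
  then have "rank_in \<tau> ` \<tau> \<subseteq> {..<card \<tau>}" by auto
  then have "rank_in \<tau> ` \<tau> = {..<card \<tau>}"
    by (intro card_subset_eq) (simp_all add: card_image[OF inj])
  with inj show ?thesis by (simp add: bij_betw_def)
qed

lemma rank_in_remove:
  assumes "finite \<tau>" "v \<in> \<tau>"
  shows "rank_in (\<tau> - {v}) u = (if v < u then rank_in \<tau> u - 1 else rank_in \<tau> u)"
proof -
  have "{w\<in>\<tau> - {v}. w < u} = (if v < u then {w\<in>\<tau>. w < u} - {v} else {w\<in>\<tau>. w < u})" by auto
  then show ?thesis using assms by (simp add: rank_in_def)
qed

text \<open>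
  The affine singular simplex that sends the \<open>i\<close>-th corner of the standard simplex to
  the \<open>i\<close>-th vertex of \<open>\<tau>\<close>.
\<close>

definition geom_simplex :: "nat \<Rightarrow> 'v::linorder set \<Rightarrow> (nat \<Rightarrow> real) \<Rightarrow> 'v \<Rightarrow> real"
  where "geom_simplex p \<tau> = (\<lambda>x\<in>standard_simplex p. \<lambda>u. if u \<in> \<tau> then x (rank_in \<tau> u) else 0)"

lemma geom_simplex_closed_simplex:
  assumes "finite \<tau>" "card \<tau> = Suc p"
  shows "geom_simplex p \<tau> ` standard_simplex p \<subseteq> closed_simplex \<tau>"
proof
  fix y assume "y \<in> geom_simplex p \<tau> ` standard_simplex p"
  then obtain x where x: "x \<in> standard_simplex p" "y = geom_simplex p \<tau> x" by auto
  have "sum y \<tau> = (\<Sum>u\<in>\<tau>. x (rank_in \<tau> u))"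
    using x by (intro sum.cong) (auto simp: geom_simplex_def)
  also have "\<dots> = (\<Sum>i\<in>{..<card \<tau>}. x i)"
    by (rule sum.reindex_bij_betw[OF bij_betw_rank_in[OF assms(1)]])
  also have "\<dots> = 1"
    using x assms(2) by (simp add: standard_simplex_def lessThan_Suc_atMost)
  finally show "y \<in> closed_simplex \<tau>"
    using x by (auto simp: closed_simplex_def support_def geom_simplex_def standard_simplex_def)
qed

lemma singular_simplex_geom_simplex:
  assumes "finite \<tau>" "card \<tau> = Suc p" "closed_simplex \<tau> \<subseteq> S"
  shows "singular_simplex p (subtopology (powertop_real UNIV) S) (geom_simplex p \<tau>)"
proof -
  have "continuous_map (subtopology (powertop_real UNIV) (standard_simplex p)) (powertop_real UNIV) (geom_simplex p \<tau>)"
    unfolding continuous_map_componentwise_UNIV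
  proof
    fix u
    have "continuous_map (subtopology (powertop_real UNIV) (standard_simplex p)) euclideanreal
       (\<lambda>x. if u \<in> \<tau> then x (rank_in \<tau> u) else 0)"
      by (auto intro!: continuous_map_from_subtopology continuous_map_product_projection)
    then show "continuous_map (subtopology (powertop_real UNIV) (standard_simplex p)) euclideanreal
       (\<lambda>x. geom_simplex p \<tau> x u)"
      by (rule continuous_map_eq) (simp add: geom_simplex_def)
  qed
  then show ?thesis
    using geom_simplex_closed_simplex[OF assms(1,2)] assms(3)
    by (auto simp: singular_simplex_def continuous_map_in_subtopology geom_simplex_def)
qed

lemma singular_face_geom_simplex:
  assumes fin: "finite \<tau>" and card: "card \<tau> = Suc (Suc p)" and v: "v \<in> \<tau>"
  shows "singular_face (Suc p) (rank_in \<tau> v) (geom_simplex (Suc p) \<tau>) = geom_simplex p (\<tau> - {v})"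
proof -
  have le: "rank_in \<tau> v \<le> Suc p"
    using bij_betw_apply[OF bij_betw_rank_in[OF fin] v] card by simp
  have "geom_simplex (Suc p) \<tau> (simplical_face (rank_in \<tau> v) x) = geom_simplex p (\<tau> - {v}) x"
    if x: "x \<in> standard_simplex p" for x
  proof -
    have x': "simplical_face (rank_in \<tau> v) x \<in> standard_simplex (Suc p)"
      using simplical_face_in_standard_simplex[of "Suc p" "rank_in \<tau> v" x] le x by simp
    have "simplical_face (rank_in \<tau> v) x (rank_in \<tau> u) = x (rank_in (\<tau> - {v}) u)" if "u \<in> \<tau>" "u \<noteq> v" for u
      using rank_in_less_iff[OF fin v that(1)] rank_in_less_iff[OF fin that(1) v] that
      by (cases u v rule: linorder_cases) (auto simp: simplical_face_def rank_in_remove[OF fin v])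
    then show ?thesis
      using x x' by (auto simp: geom_simplex_def fun_eq_iff simplical_face_def)
  qed
  then show ?thesis
    by (auto simp: singular_face_def geom_simplex_def restrict_def)
qed

text \<open>
  The faces of an affine simplex are affine simplices; the sum over positions becomes a sum over
  vertices along \<open>rank_in\<close>.
\<close>

lemma chain_boundary_geom_simplex:
  assumes fin: "finite \<tau>" and card: "card \<tau> = Suc (Suc p)"
  shows "chain_boundary (Suc p) (frag_of (geom_simplex (Suc p) \<tau>))
    = simplicial_coboundary (\<lambda>\<sigma>. frag_of (geom_simplex p \<sigma>)) \<tau>"
proof -
  let ?f = "\<lambda>k. sign_act k (frag_of (singular_face (Suc p) k (geom_simplex (Suc p) \<tau>)))"
  have "chain_boundary (Suc p) (frag_of (geom_simplex (Suc p) \<tau>)) = (\<Sum>k\<in>{..<card \<tau>}. ?f k)"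
    by (simp add: chain_boundary_of sign_act_frag_cmul card lessThan_Suc_atMost del: sum.lessThan_Suc sum.atMost_Suc)
  also have "\<dots> = (\<Sum>v\<in>\<tau>. ?f (rank_in \<tau> v))"
    by (rule sum.reindex_bij_betw[OF bij_betw_rank_in[OF fin], symmetric])
  also have "\<dots> = simplicial_coboundary (\<lambda>\<sigma>. frag_of (geom_simplex p \<sigma>)) \<tau>"
    unfolding simplicial_coboundary_def
    by (rule sum.cong) (use singular_face_geom_simplex[OF fin card] in \<open>auto simp: rank_in_def\<close>)
  finally show ?thesis .
qed

locale finite_complex =
  fixes K :: "'v::linorder set set"
  assumes complex: "finite_simplicial_complex K"
begin

abbreviation space_K :: "('v \<Rightarrow> real) topology"
  where "space_K \<equiv> subtopology (powertop_real UNIV) (underlying_set K)"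

lemma finite_K: "finite K" and finite_simplex: "\<sigma> \<in> K \<Longrightarrow> finite \<sigma>"
  and nonempty_simplex: "\<sigma> \<in> K \<Longrightarrow> \<sigma> \<noteq> {}"
  and face_in_K: "\<tau> \<in> K \<Longrightarrow> \<sigma> \<noteq> {} \<Longrightarrow> \<sigma> \<subseteq> \<tau> \<Longrightarrow> \<sigma> \<in> K"
  using complex unfolding finite_simplicial_complex_def by blast+

lemma finite_vertices: "finite (\<Union>K)"
  using finite_K finite_simplex by blast

lemma closed_simplex_subset:
  assumes "\<tau> \<in> K"
  shows "closed_simplex \<tau> \<subseteq> underlying_set K"
proof
  fix x assume x: "x \<in> closed_simplex \<tau>"
  have fin: "finite \<tau>" using finite_simplex assms .
  have "sum x (support x) = sum x \<tau>"
    using x fin by (intro sum.mono_neutral_left) (auto simp: closed_simplex_def support_def)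
  then have s: "sum x (support x) = 1" using x by (simp add: closed_simplex_def)
  then have "support x \<noteq> {}" by auto
  then have "support x \<in> K" using x face_in_K[OF assms] by (auto simp: closed_simplex_def)
  then show "x \<in> underlying_set K" using x s by (auto simp: mem_underlying_set_iff closed_simplex_def)
qed

text \<open>
  If \<open>K\<close> has \<open>N\<close> vertices, the coordinates of a point sum to 1, so one of
  them is at least \<open>1 / (N + 1) = 2 * mesh\<close>. The factor 2 leaves room for the variation
  of coordinates on a member of \<open>fine_cover\<close>.
\<close>

definition mesh :: real
  where "mesh = 1 / (2 * (real (card (\<Union>K)) + 1))"

lemma mesh_pos: "0 < mesh"
  by (simp add: mesh_def add_nonneg_pos)

definition heavy_vertex :: "('v \<Rightarrow> real) \<Rightarrow> 'v"
  where "heavy_vertex x = (SOME v. 2 * mesh \<le> x v)"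

lemma heavy_vertex: 
  assumes "x \<in> underlying_set K"
  shows "2 * mesh \<le> x (heavy_vertex x)"
proof -
  let ?N = "real (card (\<Union>K))"
  have "\<exists>v. 2 * mesh \<le> x v"
  proof (rule ccontr)
    assume "\<not> ?thesis"
    moreover have "2 * mesh = 1 / (?N + 1)" by (simp add: mesh_def divide_simps)
    ultimately have small: "x v < 1 / (?N + 1)" for v by (simp add: not_le)
    have "support x \<subseteq> \<Union>K" using assms by (auto simp: mem_underlying_set_iff)
    then have "sum x (support x) = sum x (\<Union>K)"
      using finite_vertices by (intro sum.mono_neutral_left) (auto simp: support_def)
    also have "\<dots> \<le> (\<Sum>v\<in>\<Union>K. 1 / (?N + 1))"
      using small by (intro sum_mono) (simp add: less_imp_le)
    also have "\<dots> = ?N / (?N + 1)" by simp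
    also have "\<dots> < 1" by (simp add: divide_less_eq_1 add_nonneg_pos)
    finally show False using assms by (simp add: mem_underlying_set_iff)
  qed
  then show ?thesis unfolding heavy_vertex_def by (rule someI_ex)
qed

definition fine_cover :: "('v \<Rightarrow> real) set set"
  where "fine_cover = (\<lambda>x. {y \<in> underlying_set K. \<forall>v\<in>\<Union>K. \<bar>y v - x v\<bar> < mesh / 2}) ` underlying_set K"

lemma openin_fine_cover: "\<forall>U\<in>fine_cover. openin space_K U"
proof
  fix U assume "U \<in> fine_cover"
  then obtain x where U: "U = {y \<in> underlying_set K. \<forall>v\<in>\<Union>K. \<bar>y v - x v\<bar> < mesh / 2}"
    by (auto simp: fine_cover_def)
  have "U = underlying_set K \<inter> {y. \<forall>v\<in>\<Union>K. y v \<in> ball (x v) (mesh / 2)}"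
    by (auto simp: U dist_real_def abs_minus_commute)
  then show "openin space_K U"
    using openin_powertop_coordinates[OF finite_vertices, of "\<lambda>v. ball (x v) (mesh / 2)"]
    by (auto simp: openin_subtopology)
qed

lemma fine_cover_covers: "topspace space_K \<subseteq> \<Union>fine_cover"
  using mesh_pos by (auto simp: fine_cover_def)

definition vertex_tuple :: "((nat \<Rightarrow> real) \<Rightarrow> 'v \<Rightarrow> real) \<Rightarrow> nat \<Rightarrow> 'v"
  where "vertex_tuple s i = heavy_vertex (s (std_vertex i))"

lemma vertex_tuple_face:
  assumes "i \<le> p"
  shows "vertex_tuple (singular_face (Suc p) k s) i = (vertex_tuple s \<circ> skip k) i"
  using assms by (simp add: vertex_tuple_def singular_face_def simplical_face_std_vertex)

text \<open>
  Two points of a small simplex differ by less than \<open>mesh\<close> in each coordinate, so a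
  coordinate of at least \<open>2 * mesh\<close> at a corner stays above \<open>mesh\<close> on the
  whole simplex.
\<close>

lemma small_simplex_vertices:
  assumes s: "singular_simplex p space_K s" "small_chain p fine_cover (frag_of s)"
    and y: "y \<in> s ` standard_simplex p" and i: "i \<le> p"
  shows "mesh < y (vertex_tuple s i)"
proof -
  let ?v = "vertex_tuple s i"
  obtain x where x: "\<And>z. z \<in> s ` standard_simplex p \<Longrightarrow> z \<in> underlying_set K \<and> (\<forall>v\<in>\<Union>K. \<bar>z v - x v\<bar> < mesh / 2)"
    using s(2) unfolding small_chain_frag_of fine_cover_def by blast
  have e: "s (std_vertex i) \<in> s ` standard_simplex p" using i by simp
  then have ge: "2 * mesh \<le> s (std_vertex i) ?v"
    using x heavy_vertex by (simp add: vertex_tuple_def)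
  then have "?v \<in> support (s (std_vertex i))" using mesh_pos by (auto simp: support_def)
  then have "?v \<in> \<Union>K" using x[OF e] by (auto simp: mem_underlying_set_iff)
  then have "\<bar>s (std_vertex i) ?v - x ?v\<bar> < mesh / 2" "\<bar>y ?v - x ?v\<bar> < mesh / 2"
    using x[OF e] x[OF y] by blast+
  with ge show ?thesis by linarith
qed

text \<open>
  The vertices attached to the corners all have positive coordinate at any point of the simplex;
  hence they belong to the support of that point, which is a simplex of \<open>K\<close>.
\<close>

lemma small_simplex_vertex_set:
  assumes s: "singular_simplex p space_K s" "small_chain p fine_cover (frag_of s)"
  shows "y \<in> s ` standard_simplex p \<Longrightarrow> vertex_tuple s ` {..p} \<subseteq> support y"
    and "vertex_tuple s ` {..p} \<in> K"
proof -
  show *: "vertex_tuple s ` {..p} \<subseteq> support y" if "y \<in> s ` standard_simplex p" for y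
    using small_simplex_vertices[OF s that] mesh_pos by (force simp: support_def)
  have e: "s (std_vertex 0) \<in> s ` standard_simplex p" by simp
  moreover have "s ` standard_simplex p \<subseteq> underlying_set K"
    using s(1) by (simp add: singular_simplex_subtopology)
  ultimately have "support (s (std_vertex 0)) \<in> K"
    by (metis mem_underlying_set_iff subsetD)
  then show "vertex_tuple s ` {..p} \<in> K"
    by (rule face_in_K) (use *[OF e] in auto)
qed

text \<open>
  The cochain map property of alternation for the tuples \<open>vertex_tuple s\<close>. The values
  are left in an arbitrary abelian group: it is used with field values for \<open>pull\<close> and
  with chains for the straightening map.
\<close>

lemma alternating_boundary:
  fixes c :: "'v set \<Rightarrow> 'g::ab_group_add"
  assumes T: "Modules.additive T" "\<And>s. T (frag_of s) = alternate p c (vertex_tuple s)"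
    and T': "Modules.additive T'" "\<And>s. T' (frag_of s) = alternate (Suc p) (simplicial_coboundary c) (vertex_tuple s)"
  shows "T (chain_boundary (Suc p) z) = T' z"
proof -
  have "Poly_Mapping.keys z \<subseteq> UNIV" by simp
  then show ?thesis
  proof (induction z rule: frag_induction)
    case (one s)
    have face: "alternate p c (vertex_tuple (singular_face (Suc p) k s)) = alternate p c (vertex_tuple s \<circ> skip k)" for k
      by (rule alternate_cong) (rule vertex_tuple_face)
    have "T (chain_boundary (Suc p) (frag_of s))
       = (\<Sum>k\<le>Suc p. T (sign_act k (frag_of (singular_face (Suc p) k s))))"
      by (simp add: chain_boundary_of sign_act_frag_cmul additive.sum[OF T(1)] del: sum.atMost_Suc)
    also have "\<dots> = (\<Sum>k\<le>Suc p. sign_act k (alternate p c (vertex_tuple s \<circ> skip k)))"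
      unfolding additive_sign_act[OF T(1)] by (simp only: T(2) face)
    finally show ?case by (simp only: alternate_coboundary T'(2))
  qed (auto simp: additive.zero[OF T(1)] additive.diff[OF T(1)] additive.zero[OF T'(1)] additive.diff[OF T'(1)]
      chain_boundary_diff)
qed

text \<open>
  The value of a simplicial cochain on a singular chain via vertex approximation. It is meaningful
  on small chains, where the attached vertices span simplices of \<open>K\<close>.
\<close>

definition pull :: "nat \<Rightarrow> ('v set \<Rightarrow> 'f::comm_ring_1) \<Rightarrow> ('v \<Rightarrow> real) chain \<Rightarrow> 'f"
  where "pull p c = frag_eval (\<lambda>s. alternate p c (vertex_tuple s))"

lemma additive_pull: "Modules.additive (pull p c)"
  unfolding pull_def by (rule additive_frag_eval)

lemma pull_boundary: "pull p c (chain_boundary (Suc p) z) = pull (Suc p) (simplicial_coboundary c) z"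
  by (rule alternating_boundary) (simp_all add: pull_def additive_frag_eval)

end

section \<open>Cones over singular chains\<close>

text \<open>
  The join of the point \<open>w\<close>, placed at the new corner 0, with \<open>s\<close> on the
  opposite face.
\<close>

definition cone_simplex :: "nat \<Rightarrow> ('v \<Rightarrow> real) \<Rightarrow> ((nat \<Rightarrow> real) \<Rightarrow> 'v \<Rightarrow> real) \<Rightarrow> (nat \<Rightarrow> real) \<Rightarrow> 'v \<Rightarrow> real"
  where "cone_simplex p w s = (\<lambda>x\<in>standard_simplex (Suc p). \<lambda>u.
    if x 0 = 1 then w u else x 0 * w u + (1 - x 0) * s (\<lambda>i. x (Suc i) / (1 - x 0)) u)"

lemma standard_simplex_project:
  assumes x: "x \<in> standard_simplex (Suc p)" and x0: "x 0 \<noteq> 1"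
  shows "(\<lambda>i. x (Suc i) / (1 - x 0)) \<in> standard_simplex p"
proof -
  have pos: "0 < 1 - x 0" using x x0 by (auto simp: standard_simplex_def less_le)
  have sum: "(\<Sum>i\<le>p. x (Suc i)) = 1 - x 0"
    using x by (simp add: standard_simplex_def sum.atMost_Suc_shift del: sum.atMost_Suc)
  have "x (Suc i) \<le> 1 - x 0" for i
  proof (cases "i \<le> p")
    case True
    then have "x (Suc i) \<le> (\<Sum>i\<le>p. x (Suc i))"
      using x by (intro member_le_sum) (auto simp: standard_simplex_def)
    then show ?thesis by (simp add: sum)
  next
    case False
    then show ?thesis using x pos by (auto simp: standard_simplex_def)
  qed
  then show ?thesis
    using x pos sum by (auto simp: standard_simplex_def divide_simps simp flip: sum_divide_distrib)
qed

lemma cone_simplex_face_0: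
  assumes "s \<in> extensional (standard_simplex p)"
  shows "singular_face (Suc p) 0 (cone_simplex p w s) = s"
proof (rule extensionalityI)
  show "singular_face (Suc p) 0 (cone_simplex p w s) \<in> extensional (standard_simplex p)"
    by (simp add: singular_face_def)
  fix y assume y: "y \<in> standard_simplex p"
  have "simplical_face 0 y \<in> standard_simplex (Suc p)"
    using simplical_face_in_standard_simplex[of "Suc p" 0 y] y by simp
  then show "singular_face (Suc p) 0 (cone_simplex p w s) y = s y"
    using y by (simp add: singular_face_def cone_simplex_def simplical_face_def)
qed (fact assms)

lemma cone_simplex_face_Suc:
  assumes k: "k \<le> Suc q"
  shows "singular_face (Suc (Suc q)) (Suc k) (cone_simplex (Suc q) w s) = cone_simplex q w (singular_face (Suc q) k s)"
proof (rule extensionalityI)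
  fix y assume y: "y \<in> standard_simplex (Suc q)"
  have x: "simplical_face (Suc k) y \<in> standard_simplex (Suc (Suc q))"
    using simplical_face_in_standard_simplex[of "Suc (Suc q)" "Suc k" y] y k by simp
  have y0: "simplical_face (Suc k) y 0 = y 0" by (simp add: simplical_face_def)
  have "(\<lambda>i. simplical_face (Suc k) y (Suc i) / (1 - y 0)) = simplical_face k (\<lambda>i. y (Suc i) / (1 - y 0))"
    by (auto simp: simplical_face_def fun_eq_iff Suc_diff_1 dest: gr0_implies_Suc)
  then show "singular_face (Suc (Suc q)) (Suc k) (cone_simplex (Suc q) w s) y
      = cone_simplex q w (singular_face (Suc q) k s) y"
    using y x standard_simplex_project[OF y]
    by (auto simp: singular_face_def cone_simplex_def y0)
qed (auto simp: singular_face_def cone_simplex_def)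

lemma cone_simplex_face_1:
  "singular_face (Suc 0) (Suc 0) (cone_simplex 0 w s) = (\<lambda>x\<in>standard_simplex 0. w)"
proof (rule extensionalityI)
  fix y assume y: "y \<in> standard_simplex 0"
  have x: "simplical_face (Suc 0) y \<in> standard_simplex (Suc 0)"
    using simplical_face_in_standard_simplex[of "Suc 0" "Suc 0" y] y by simp
  have "y 0 = 1" using y by (simp add: standard_simplex_def)
  then show "singular_face (Suc 0) (Suc 0) (cone_simplex 0 w s) y = (\<lambda>x\<in>standard_simplex 0. w) y"
    using y x by (simp add: singular_face_def cone_simplex_def simplical_face_def)
qed (auto simp: singular_face_def)

definition cone_chain :: "nat \<Rightarrow> ('v \<Rightarrow> real) \<Rightarrow> ('v \<Rightarrow> real) chain \<Rightarrow> ('v \<Rightarrow> real) chain"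
  where "cone_chain p w = frag_extend (\<lambda>s. frag_of (cone_simplex p w s))"

lemma additive_cone_chain: "Modules.additive (cone_chain p w)"
  unfolding cone_chain_def by (rule additive_frag_extend)

text \<open>
  In degree zero the cone over a point has the apex as second boundary term, which cancels for a
  difference of two points.
\<close>

lemma boundary_cone_0:
  assumes "a \<in> extensional (standard_simplex 0)" "b \<in> extensional (standard_simplex 0)"
  shows "chain_boundary (Suc 0) (cone_chain 0 w (frag_of a - frag_of b)) = frag_of a - frag_of b"
proof -
  have "chain_boundary (Suc 0) (cone_chain 0 w (frag_of s)) = frag_of s - frag_of (\<lambda>x\<in>standard_simplex 0. w)"
    if "s \<in> extensional (standard_simplex 0)" for s
    using cone_simplex_face_0[OF that, of w]
    by (simp add: cone_chain_def chain_boundary_of cone_simplex_face_1)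
  with assms show ?thesis
    by (simp add: additive.diff[OF additive_cone_chain] chain_boundary_diff)
qed

lemma boundary_cone_Suc:
  assumes "singular_chain (Suc p) X c"
  shows "chain_boundary (Suc (Suc p)) (cone_chain (Suc p) w c) = c - cone_chain p w (chain_boundary (Suc p) c)"
  using assms unfolding singular_chain_def
proof (induction c rule: frag_induction)
  case (one s)
  then have "s \<in> extensional (standard_simplex (Suc p))" by (simp add: singular_simplex_def)
  note f0 = cone_simplex_face_0[OF this, of w]
  have "chain_boundary (Suc (Suc p)) (cone_chain (Suc p) w (frag_of s))
    = (\<Sum>k\<le>Suc (Suc p). frag_cmul ((-1) ^ k) (frag_of (singular_face (Suc (Suc p)) k (cone_simplex (Suc p) w s))))"
    by (simp add: cone_chain_def chain_boundary_of del: sum.atMost_Suc)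
  also have "\<dots> = frag_of s + (\<Sum>k\<le>Suc p. frag_cmul ((-1) ^ Suc k) (frag_of (singular_face (Suc (Suc p)) (Suc k) (cone_simplex (Suc p) w s))))"
    by (subst sum.atMost_Suc_shift) (simp add: f0 del: sum.atMost_Suc power_Suc)
  also have "(\<Sum>k\<le>Suc p. frag_cmul ((-1) ^ Suc k) (frag_of (singular_face (Suc (Suc p)) (Suc k) (cone_simplex (Suc p) w s))))
     = (\<Sum>k\<le>Suc p. - cone_chain p w (frag_cmul ((-1) ^ k) (frag_of (singular_face (Suc p) k s))))"
    by (rule sum.cong) (auto simp: cone_simplex_face_Suc cone_chain_def frag_extend_cmul)
  also have "\<dots> = - cone_chain p w (chain_boundary (Suc p) (frag_of s))"
    by (simp add: chain_boundary_of sum_negf additive.sum[OF additive_cone_chain] del: sum.atMost_Suc)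
  finally show ?case by simp
qed (auto simp: additive.zero[OF additive_cone_chain] additive.diff[OF additive_cone_chain] chain_boundary_diff)

lemma continuous_on_coordinate: "continuous_on T (\<lambda>y :: 'i \<Rightarrow> real. y i)"
  by (rule continuous_on_subset[OF continuous_on_product_coordinates]) auto

text \<open>
  Away from the apex this is a composition of continuous maps. At the apex the factor \<open>1 - x
  0\<close> tends to zero and the other factor is bounded.
\<close>

lemma continuous_on_cone_coordinate:
  fixes s :: "(nat \<Rightarrow> real) \<Rightarrow> 'v \<Rightarrow> real"
  assumes s: "continuous_on (standard_simplex p) s"
    and bound: "\<And>x. x \<in> standard_simplex p \<Longrightarrow> \<bar>s x u\<bar> \<le> 1"
  shows "continuous_on (standard_simplex (Suc p))
     (\<lambda>x. if x 0 = 1 then 0 else (1 - x 0) * s (\<lambda>i. x (Suc i) / (1 - x 0)) u)" (is "continuous_on ?S ?h")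
  unfolding continuous_on_eq_continuous_within
proof
  fix x assume x: "x \<in> ?S"
  note c0 = continuous_on_coordinate
  show "continuous (at x within ?S) ?h"
  proof (cases "x 0 = 1")
    case True
    have "((\<lambda>y. 1 - y 0) \<longlongrightarrow> 1 - x 0) (at x within ?S)"
      using c0[of ?S 0] x by (intro tendsto_diff tendsto_const) (simp add: continuous_on_def)
    then have lim: "((\<lambda>y. 1 - y 0) \<longlongrightarrow> 0) (at x within ?S)" by (simp add: True)
    have "norm (?h y) \<le> 1 - y 0" if y: "y \<in> ?S" for y
    proof (cases "y 0 = 1")
      case False
      have "0 \<le> 1 - y 0" using y by (simp add: standard_simplex_def)
      then show ?thesis
        using bound[OF standard_simplex_project[OF y False]] False
        by (simp add: abs_mult mult_left_le)
    qed simp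
    then have "\<forall>\<^sub>F y in at x within ?S. norm (?h y) \<le> 1 - y 0"
      by (simp add: eventually_at_topological) (metis UNIV_I open_UNIV)
    then have "(?h \<longlongrightarrow> 0) (at x within ?S)" by (rule Lim_null_comparison[OF _ lim])
    then show ?thesis by (simp add: continuous_within True)
  next
    case False
    let ?T = "{y :: nat \<Rightarrow> real. y 0 \<noteq> 1}"
    have T: "open ?T"
      by (rule open_Collect_neq[OF c0 continuous_on_const])
    have p1: "continuous_on (?S \<inter> ?T) (\<lambda>y i. y (Suc i) / (1 - y 0))"
      by (intro continuous_on_coordinatewise_then_product continuous_on_divide continuous_on_diff c0 continuous_on_const) auto
    have p2: "(\<lambda>y i. y (Suc i) / (1 - y 0)) ` (?S \<inter> ?T) \<subseteq> standard_simplex p"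
      using standard_simplex_project by auto
    have p3: "continuous_on (?S \<inter> ?T) (\<lambda>y. s (\<lambda>i. y (Suc i) / (1 - y 0)) u)"
      using continuous_on_compose2[OF s p1 p2] by (rule continuous_on_product_then_coordinatewise)
    have "continuous_on (?S \<inter> ?T) (\<lambda>y. (1 - y 0) * s (\<lambda>i. y (Suc i) / (1 - y 0)) u)"
      by (rule continuous_on_mult[OF continuous_on_diff[OF continuous_on_const c0] p3])
    then have "continuous_on (?S \<inter> ?T) ?h"
      by (rule continuous_on_eq) auto
    then have "continuous (at x within ?S \<inter> ?T) ?h"
      using x False by (simp add: continuous_on_eq_continuous_within)
    moreover have "at x within ?S \<inter> ?T = at x within ?S"
      by (rule at_within_nhd[OF _ T]) (use False in auto)
    ultimately show ?thesis by simp
  qed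
qed

text \<open>
  The cone stays inside any set that contains \<open>s\<close> and is star-shaped about the apex.
\<close>

lemma singular_simplex_cone:
  fixes W :: "('v \<Rightarrow> real) set"
  assumes s: "singular_simplex p (subtopology (powertop_real UNIV) W) s"
    and star: "\<And>z r. z \<in> W \<Longrightarrow> 0 \<le> r \<Longrightarrow> r \<le> 1 \<Longrightarrow> (\<lambda>u. (1 - r) * z u + r * w u) \<in> W"
    and bound: "\<And>z u. z \<in> W \<Longrightarrow> \<bar>z u\<bar> \<le> 1"
  shows "singular_simplex (Suc p) (subtopology (powertop_real UNIV) W) (cone_simplex p w s)"
proof -
  have sW: "s x \<in> W" if "x \<in> standard_simplex p" for x
    using s that by (auto simp: singular_simplex_subtopology)
  have "continuous_map (subtopology (powertop_real UNIV) (standard_simplex p)) (powertop_real UNIV) s"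
    using s by (simp add: singular_simplex_def continuous_map_in_subtopology)
  then have cont: "continuous_on (standard_simplex p) s"
    by (simp add: euclidean_product_topology)
  have "continuous_on (standard_simplex (Suc p)) (\<lambda>x. cone_simplex p w s x u)" for u
  proof -
    have "continuous_on (standard_simplex (Suc p)) (\<lambda>x. x 0 * w u +
      (if x 0 = 1 then 0 else (1 - x 0) * s (\<lambda>i. x (Suc i) / (1 - x 0)) u))"
      using sW bound
      by (intro continuous_on_add continuous_on_mult continuous_on_const continuous_on_coordinate
          continuous_on_cone_coordinate[OF cont]) auto
    then show ?thesis by (rule continuous_on_eq) (simp add: cone_simplex_def)
  qed
  then have "continuous_on (standard_simplex (Suc p)) (cone_simplex p w s)"
    by (rule continuous_on_coordinatewise_then_product)
  then have 1: "continuous_map (subtopology (powertop_real UNIV) (standard_simplex (Suc p))) (powertop_real UNIV) (cone_simplex p w s)"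
    by (simp add: euclidean_product_topology)
  have wW: "w \<in> W"
  proof -
    have "s (std_vertex 0) \<in> W" by (rule sW) simp
    from star[OF this, of 1] show ?thesis by simp
  qed
  have "cone_simplex p w s x \<in> W" if x: "x \<in> standard_simplex (Suc p)" for x
  proof (cases "x 0 = 1")
    case True
    then show ?thesis using x wW by (simp add: cone_simplex_def)
  next
    case False
    have "0 \<le> x 0" "x 0 \<le> 1" using x by (auto simp: standard_simplex_def)
    from star[OF sW[OF standard_simplex_project[OF x False]] this] show ?thesis
      using x False by (simp add: cone_simplex_def add.commute)
  qed
  then have "cone_simplex p w s \<in> standard_simplex (Suc p) \<rightarrow> W" by auto
  moreover have "cone_simplex p w s \<in> extensional (standard_simplex (Suc p))" by (simp add: cone_simplex_def)
  ultimately show ?thesis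
    using 1 by (simp add: singular_simplex_def continuous_map_in_subtopology image_subset_iff_funcset)
qed

lemma singular_chain_cone:
  fixes W :: "('v \<Rightarrow> real) set"
  assumes c: "singular_chain p (subtopology (powertop_real UNIV) W) c"
    and star: "\<And>z r. z \<in> W \<Longrightarrow> 0 \<le> r \<Longrightarrow> r \<le> 1 \<Longrightarrow> (\<lambda>u. (1 - r) * z u + r * w u) \<in> W"
    and bound: "\<And>z u. z \<in> W \<Longrightarrow> \<bar>z u\<bar> \<le> 1"
  shows "singular_chain (Suc p) (subtopology (powertop_real UNIV) W) (cone_chain p w c)"
  unfolding cone_chain_def
proof (rule singular_chain_extend)
  fix s assume "s \<in> Poly_Mapping.keys c"
  then have "singular_simplex p (subtopology (powertop_real UNIV) W) s"
    using c by (auto simp: singular_chain_def)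
  then have "singular_simplex (Suc p) (subtopology (powertop_real UNIV) W) (cone_simplex p w s)"
    by (rule singular_simplex_cone) (fact star, fact bound)
  then show "singular_chain (Suc p) (subtopology (powertop_real UNIV) W) (frag_of (cone_simplex p w s))"
    by (simp add: singular_chain_of)
qed

section \<open>Compact sets in the realization of a supcomplex\<close>

context finite_complex
begin

lemma supcomplex_subset: "supcomplex K A \<Longrightarrow> A \<subseteq> K"
  by (simp add: supcomplex_def)

lemma supcomplex_upward: "supcomplex K A \<Longrightarrow> \<sigma> \<in> A \<Longrightarrow> \<tau> \<in> K \<Longrightarrow> \<sigma> \<subseteq> \<tau> \<Longrightarrow> \<tau> \<in> A"
  by (simp add: supcomplex_def)

lemma underlying_set_mono: "A \<subseteq> B \<Longrightarrow> underlying_set A \<subseteq> underlying_set B"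
  by (auto simp: underlying_set_def)

text \<open>
  Since a supcomplex is closed under cofaces, membership of the support in \<open>A\<close> only
  requires some simplex of \<open>A\<close> below the support. This exhibits \<open>|A|\<close> as
  an open condition on finitely many coordinates.
\<close>

lemma underlying_set_supcomplex:
  assumes A: "supcomplex K A"
  shows "underlying_set A = {x \<in> underlying_set K. \<exists>\<sigma>\<in>A. \<forall>v\<in>\<sigma>. 0 < x v}"
proof (intro equalityI subsetI)
  fix x assume x: "x \<in> underlying_set A"
  then have "x \<in> underlying_set K" using underlying_set_mono[OF supcomplex_subset[OF A]] by blast
  moreover have "\<forall>v\<in>support x. 0 < x v" "support x \<in> A"
    using x by (auto simp: mem_underlying_set_iff support_def less_le)
  ultimately show "x \<in> {x \<in> underlying_set K. \<exists>\<sigma>\<in>A. \<forall>v\<in>\<sigma>. 0 < x v}" by blast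
next
  fix x assume "x \<in> {x \<in> underlying_set K. \<exists>\<sigma>\<in>A. \<forall>v\<in>\<sigma>. 0 < x v}"
  then obtain \<sigma> where x: "x \<in> underlying_set K" "\<sigma> \<in> A" "\<forall>v\<in>\<sigma>. 0 < x v" by blast
  then have "\<sigma> \<subseteq> support x" by (force simp: support_def)
  then have "support x \<in> A" using supcomplex_upward[OF A x(2)] x by (simp add: mem_underlying_set_iff)
  then show "x \<in> underlying_set A" using x by (simp add: mem_underlying_set_iff)
qed

lemma openin_superlevel:
  assumes A: "A \<subseteq> K"
  shows "openin space_K {x \<in> underlying_set K. \<exists>\<sigma>\<in>A. \<forall>v\<in>\<sigma>. \<delta> < x v}"
proof -
  have "openin (powertop_real UNIV) {x :: 'v \<Rightarrow> real. \<forall>v\<in>\<sigma>. x v \<in> {\<delta><..}}" if "\<sigma> \<in> A" for \<sigma>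
    using finite_simplex that A by (intro openin_powertop_coordinates) auto
  then have opn: "openin (powertop_real UNIV) (\<Union>\<sigma>\<in>A. {x :: 'v \<Rightarrow> real. \<forall>v\<in>\<sigma>. x v \<in> {\<delta><..}})"
    by (intro openin_Union) auto
  have eq: "{x \<in> underlying_set K. \<exists>\<sigma>\<in>A. \<forall>v\<in>\<sigma>. \<delta> < x v}
     = (\<Union>\<sigma>\<in>A. {x. \<forall>v\<in>\<sigma>. x v \<in> {\<delta><..}}) \<inter> underlying_set K" by auto
  show ?thesis unfolding openin_subtopology by (intro exI conjI) (rule opn, rule eq)
qed

lemma openin_underlying_set: "supcomplex K A \<Longrightarrow> openin space_K (underlying_set A)"
  using openin_superlevel[OF supcomplex_subset, of A 0] by (simp add: underlying_set_supcomplex)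

lemma Hausdorff_space_K: "Hausdorff_space space_K"
  by (intro Hausdorff_space_subtopology) (simp add: Hausdorff_space_product_topology)

text \<open>
  For a supcomplex \<open>A\<close> and \<open>\<delta> > 0\<close> these are compact subsets of
  \<open>|A|\<close>, and they exhaust it as \<open>\<delta>\<close> decreases.
\<close>

definition thick :: "'v set set \<Rightarrow> real \<Rightarrow> ('v \<Rightarrow> real) set"
  where "thick A \<delta> = {x \<in> underlying_set K. \<exists>\<sigma>\<in>A. \<forall>v\<in>\<sigma>. \<delta> \<le> x v}"

lemma thick_subset: "supcomplex K A \<Longrightarrow> 0 < \<delta> \<Longrightarrow> thick A \<delta> \<subseteq> underlying_set A"
  by (force simp: thick_def underlying_set_supcomplex)

lemma compactin_thick_powertop:
  assumes A: "A \<subseteq> K"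
  shows "compactin (powertop_real UNIV) (thick A \<delta>)"
proof -
  have eq: "thick A \<delta> = (\<Union>\<sigma>\<in>A. \<Union>\<tau>\<in>K. closed_simplex \<tau> \<inter> {x. \<forall>v\<in>\<sigma>. x v \<in> {\<delta>..}})"
  proof (intro equalityI subsetI)
    fix x assume "x \<in> thick A \<delta>"
    then obtain \<sigma> where "x \<in> underlying_set K" "\<sigma> \<in> A" "\<forall>v\<in>\<sigma>. \<delta> \<le> x v" by (auto simp: thick_def)
    moreover from this have "support x \<in> K" "x \<in> closed_simplex (support x)"
      by (auto simp: mem_underlying_set_iff closed_simplex_def)
    ultimately show "x \<in> (\<Union>\<sigma>\<in>A. \<Union>\<tau>\<in>K. closed_simplex \<tau> \<inter> {x. \<forall>v\<in>\<sigma>. x v \<in> {\<delta>..}})" by auto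
  qed (use closed_simplex_subset in \<open>auto simp: thick_def\<close>)
  have "compactin (powertop_real UNIV) (closed_simplex \<tau> \<inter> {x. \<forall>v\<in>\<sigma>. x v \<in> {\<delta>..}})"
    if "\<tau> \<in> K" for \<sigma> \<tau>
    by (intro compact_Int_closedin compactin_closed_simplex closedin_powertop_coordinates finite_simplex that) auto
  then have "compactin (powertop_real UNIV) (\<Union>\<tau>\<in>K. closed_simplex \<tau> \<inter> {x. \<forall>v\<in>\<sigma>. x v \<in> {\<delta>..}})" for \<sigma>
    by (intro compactin_Union) (auto simp: finite_K)
  then show ?thesis
    unfolding eq using finite_subset[OF A finite_K] by (intro compactin_Union) auto
qed

lemma compactin_thick:
  assumes "supcomplex K A" "0 < \<delta>"
  shows "compactin (underlying_space K A) (thick A \<delta>)"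
  using compactin_thick_powertop[OF supcomplex_subset[OF assms(1)]] thick_subset[OF assms]
    underlying_set_mono[OF supcomplex_subset[OF assms(1)]]
  unfolding underlying_space_def compactin_subtopology by blast

text \<open>
  The superlevel sets with strict inequality at \<open>1/(n+1)\<close> form an increasing open cover
  of \<open>|A|\<close>.
\<close>

lemma compact_subset_thick:
  assumes A: "supcomplex K A" and C: "compactin (underlying_space K A) C"
  obtains \<delta> where "0 < \<delta>" "\<delta> \<le> mesh" "C \<subseteq> thick A \<delta>"
proof -
  let ?U = "\<lambda>n::nat. {x \<in> underlying_set K. \<exists>\<sigma>\<in>A. \<forall>v\<in>\<sigma>. 1 / (real n + 1) < x v}"
  have cpt: "compactin space_K C" and sub: "C \<subseteq> underlying_set A"
    using C by (auto simp: underlying_space_def compactin_subtopology)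
  have opn: "openin space_K (?U n)" for n
    by (rule openin_superlevel[OF supcomplex_subset[OF A]])
  have mono: "?U m \<subseteq> ?U n" if "m \<le> n" for m n
  proof -
    have "1 / (real n + 1) \<le> 1 / (real m + 1)" using that by (intro divide_left_mono) auto
    then show ?thesis by (auto intro: le_less_trans)
  qed
  have "C \<subseteq> (\<Union>n. ?U n)"
  proof
    fix x assume "x \<in> C"
    with sub have x: "x \<in> underlying_set A" by auto
    then have S: "support x \<in> A" by (simp add: mem_underlying_set_iff)
    then have "support x \<in> K" using supcomplex_subset[OF A] by auto
    note fin = finite_simplex[OF this] and ne = nonempty_simplex[OF this]
    have "0 < x v" if "v \<in> support x" for v
      using x that by (auto simp: mem_underlying_set_iff support_def less_le)
    then have "0 < Min (x ` support x)" using fin ne by simp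
    then obtain n where n: "1 / (real n + 1) < Min (x ` support x)"
      using reals_Archimedean by (auto simp: inverse_eq_divide add.commute)
    have "1 / (real n + 1) < x v" if "v \<in> support x" for v
      using n fin that by (meson Min_le finite_imageI imageI less_le_trans)
    moreover have "x \<in> underlying_set K" using x underlying_set_mono[OF supcomplex_subset[OF A]] by blast
    ultimately show "x \<in> (\<Union>n. ?U n)" using S by blast
  qed
  then have "\<exists>\<F>. finite \<F> \<and> \<F> \<subseteq> range ?U \<and> C \<subseteq> \<Union>\<F>"
    by (intro compactinD[OF cpt]) (elim rangeE, simp only: opn)
  then obtain \<F> where \<F>: "finite \<F>" "\<F> \<subseteq> range ?U" "C \<subseteq> \<Union>\<F>"
    by (elim exE conjE)
  obtain N where N: "finite N" "\<F> = ?U ` N"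
    using finite_subset_image[OF \<F>(1,2)] by (elim exE conjE)
  define n where "n = Max (insert 0 N)"
  have n: "m \<le> n" if "m \<in> N" for m using N(1) that by (simp add: n_def)
  have "\<Union>\<F> \<subseteq> ?U n" unfolding N(2) by (rule UN_least) (rule mono, rule n)
  then have "C \<subseteq> ?U n" using \<F>(3) by (rule order_trans[rotated])
  also have "?U n \<subseteq> thick A (min mesh (1 / (real n + 1)))"
  proof
    fix x assume "x \<in> ?U n"
    then obtain \<sigma> where "x \<in> underlying_set K" "\<sigma> \<in> A" and v: "\<forall>v\<in>\<sigma>. 1 / (real n + 1) < x v" by blast
    moreover have "\<forall>v\<in>\<sigma>. min mesh (1 / (real n + 1)) \<le> x v"
      using v by (auto intro: min.coboundedI2 less_imp_le)
    ultimately show "x \<in> thick A (min mesh (1 / (real n + 1)))" unfolding thick_def by blast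
  qed
  finally have "C \<subseteq> thick A (min mesh (1 / (real n + 1)))" .
  then show thesis by (intro that[of "min mesh (1 / (real n + 1))"]) (use mesh_pos in auto)
qed

text \<open>
  The union of the joins of points \<open>y\<close> of \<open>s\<close> with the closed simplex
  spanned by the vertices attached to \<open>s\<close>: points that off these vertices are a
  multiple \<open>\<kappa> * y\<close> with \<open>0 \<le> \<kappa> \<le> 1\<close>, and at these
  vertices at least that. It contains \<open>s\<close> (for \<open>\<kappa> = 1\<close>) and its
  straightening (for \<open>\<kappa> = 0\<close>), is star-shaped about each attached vertex, and
  for \<open>\<delta> \<le> mesh\<close> avoids \<open>thick A \<delta>\<close> if \<open>s\<close>
  is small and does. Hence it carries the homotopy from \<open>s\<close> to its straightening.
\<close>

definition join_hull :: "nat \<Rightarrow> ((nat \<Rightarrow> real) \<Rightarrow> 'v \<Rightarrow> real) \<Rightarrow> ('v \<Rightarrow> real) set"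
  where "join_hull p s = {z. (\<forall>v. 0 \<le> z v) \<and> sum z (\<Union>K) = 1 \<and>
    (\<exists>y\<in>s ` standard_simplex p. \<exists>\<kappa>. 0 \<le> \<kappa> \<and> \<kappa> \<le> 1 \<and> (\<forall>v. \<kappa> * y v \<le> z v) \<and>
       (\<forall>v. v \<notin> vertex_tuple s ` {..p} \<longrightarrow> z v = \<kappa> * y v))}"

lemma sum_vertices:
  assumes "x \<in> underlying_set K"
  shows "sum x (\<Union>K) = 1"
proof -
  have "support x \<subseteq> \<Union>K" using assms by (auto simp: mem_underlying_set_iff)
  then have "sum x (support x) = sum x (\<Union>K)"
    using finite_vertices by (intro sum.mono_neutral_left) (auto simp: support_def)
  then show ?thesis using assms by (simp add: mem_underlying_set_iff)
qed

context
  fixes p s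
  assumes s: "singular_simplex p space_K s" "small_chain p fine_cover (frag_of s)"
begin

lemma simplex_image_underlying: "y \<in> s ` standard_simplex p \<Longrightarrow> y \<in> underlying_set K"
  using s(1) by (auto simp: singular_simplex_subtopology)

lemma join_hull_support:
  assumes "y \<in> s ` standard_simplex p" "\<forall>v. v \<notin> vertex_tuple s ` {..p} \<longrightarrow> z v = \<kappa> * y v"
  shows "support z \<subseteq> support y"
proof
  fix v assume v: "v \<in> support z"
  show "v \<in> support y"
  proof (cases "v \<in> vertex_tuple s ` {..p}")
    case True
    then show ?thesis using small_simplex_vertex_set(1)[OF s assms(1)] by blast
  next
    case False
    then show ?thesis using assms(2) v by (auto simp: support_def)
  qed
qed

lemma join_hull_subset: "join_hull p s \<subseteq> underlying_set K"
proof
  fix z assume "z \<in> join_hull p s"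
  then obtain y \<kappa> where z: "\<forall>v. 0 \<le> z v" "sum z (\<Union>K) = 1" and y: "y \<in> s ` standard_simplex p"
    and off: "\<forall>v. v \<notin> vertex_tuple s ` {..p} \<longrightarrow> z v = \<kappa> * y v"
    by (auto simp: join_hull_def)
  have supp: "support z \<subseteq> support y" using join_hull_support[OF y off] .
  have yK: "support y \<in> K" using simplex_image_underlying[OF y] by (simp add: mem_underlying_set_iff)
  then have "sum z (support z) = sum z (\<Union>K)"
    using finite_vertices supp by (intro sum.mono_neutral_left) (auto simp: support_def)
  with z have 1: "sum z (support z) = 1" by simp
  then have "support z \<noteq> {}" by auto
  then have "support z \<in> K" using face_in_K[OF yK] supp by blast
  with z 1 show "z \<in> underlying_set K" by (simp add: mem_underlying_set_iff)
qed

lemma join_hull_bounded: "z \<in> join_hull p s \<Longrightarrow> \<bar>z u\<bar> \<le> 1"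
proof -
  assume "z \<in> join_hull p s"
  then have z: "z \<in> underlying_set K" using join_hull_subset by blast
  have "z u \<le> 1"
  proof (cases "u \<in> \<Union>K")
    case True
    then have "z u \<le> sum z (\<Union>K)"
      using z finite_vertices by (intro member_le_sum) (auto simp: mem_underlying_set_iff)
    then show ?thesis by (simp add: sum_vertices[OF z])
  next
    case False
    then have "z u = 0" using z unfolding mem_underlying_set_iff support_def by blast
    then show ?thesis by simp
  qed
  then show ?thesis using z by (simp add: mem_underlying_set_iff)
qed

lemma join_hull_star:
  assumes z: "z \<in> join_hull p s" and r: "0 \<le> r" "r \<le> 1" and w: "w \<in> vertex_tuple s ` {..p}"
  shows "(\<lambda>u. (1 - r) * z u + r * (if u = w then 1 else 0)) \<in> join_hull p s"
proof -
  obtain y \<kappa> where z: "\<forall>v. 0 \<le> z v" "sum z (\<Union>K) = 1" and y: "y \<in> s ` standard_simplex p"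
    and \<kappa>: "0 \<le> \<kappa>" "\<kappa> \<le> 1" and ge: "\<forall>v. \<kappa> * y v \<le> z v"
    and off: "\<forall>v. v \<notin> vertex_tuple s ` {..p} \<longrightarrow> z v = \<kappa> * y v"
    using z by (auto simp: join_hull_def)
  let ?z = "\<lambda>u. (1 - r) * z u + r * (if u = w then 1 else 0)"
  have "w \<in> \<Union>K" using small_simplex_vertex_set(2)[OF s] w by blast
  then have "(\<Sum>u\<in>\<Union>K. if u = w then 1 else 0 :: real) = 1"
    using finite_vertices by (simp add: sum.delta)
  then have "sum ?z (\<Union>K) = 1"
    using z by (simp add: sum.distrib flip: sum_distrib_left)
  moreover have "\<forall>v. 0 \<le> ?z v" using z r by simp
  moreover have "0 \<le> (1 - r) * \<kappa>" "(1 - r) * \<kappa> \<le> 1" using \<kappa> r by (auto intro: mult_le_one)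
  moreover have "(1 - r) * \<kappa> * y v \<le> ?z v" for v
  proof -
    have "(1 - r) * (\<kappa> * y v) \<le> (1 - r) * z v" using ge r by (intro mult_left_mono) auto
    then show ?thesis unfolding mult.assoc by (rule add_increasing2[rotated]) (use r in simp)
  qed
  moreover have "\<forall>v. v \<notin> vertex_tuple s ` {..p} \<longrightarrow> ?z v = (1 - r) * \<kappa> * y v"
    using off w by auto
  ultimately show ?thesis using y unfolding join_hull_def by blast
qed

lemma simplex_subset_join_hull: "s ` standard_simplex p \<subseteq> join_hull p s"
proof
  fix y assume y: "y \<in> s ` standard_simplex p"
  have "\<forall>v. 0 \<le> y v" "sum y (\<Union>K) = 1"
    using simplex_image_underlying[OF y] sum_vertices by (auto simp: mem_underlying_set_iff)
  then show "y \<in> join_hull p s"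
    unfolding join_hull_def by (intro CollectI conjI bexI[OF _ y] exI[of _ 1]) auto
qed

lemma closed_simplex_subset_join_hull: "closed_simplex (vertex_tuple s ` {..p}) \<subseteq> join_hull p s"
proof
  fix z assume z: "z \<in> closed_simplex (vertex_tuple s ` {..p})"
  have y: "s (std_vertex 0) \<in> s ` standard_simplex p" by simp
  have "z \<in> underlying_set K"
    using z closed_simplex_subset[OF small_simplex_vertex_set(2)[OF s]] by blast
  then have "\<forall>v. 0 \<le> z v" "sum z (\<Union>K) = 1" using sum_vertices by (auto simp: mem_underlying_set_iff)
  moreover have "\<forall>v. v \<notin> vertex_tuple s ` {..p} \<longrightarrow> z v = 0"
    using z unfolding closed_simplex_def support_def by blast
  ultimately show "z \<in> join_hull p s"
    unfolding join_hull_def by (intro CollectI conjI bexI[OF _ y] exI[of _ 0]) auto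
qed

text \<open>
  Suppose \<open>z\<close> has coordinates at least \<open>\<delta>\<close> on a simplex
  \<open>\<sigma>\<close> of \<open>A\<close>. Then so does the point \<open>y\<close> of
  \<open>s\<close> it is joined from: at attached vertices \<open>y\<close> exceeds \<open>mesh
  \<ge> \<delta>\<close>, and at other vertices \<open>z\<close> is at most \<open>y\<close>.
\<close>

lemma join_hull_avoids_thick:
  assumes \<delta>: "\<delta> \<le> mesh" and avoid: "s ` standard_simplex p \<inter> thick A \<delta> = {}"
  shows "join_hull p s \<inter> thick A \<delta> = {}"
proof (rule ccontr)
  assume "\<not> ?thesis"
  then obtain z \<sigma> where z: "z \<in> join_hull p s" and \<sigma>: "\<sigma> \<in> A" "\<forall>v\<in>\<sigma>. \<delta> \<le> z v"
    by (auto simp: thick_def)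
  then obtain y \<kappa> where y: "y \<in> s ` standard_simplex p" and \<kappa>: "0 \<le> \<kappa>" "\<kappa> \<le> 1"
    and off: "\<forall>v. v \<notin> vertex_tuple s ` {..p} \<longrightarrow> z v = \<kappa> * y v"
    by (auto simp: join_hull_def)
  have yK: "y \<in> underlying_set K" using simplex_image_underlying[OF y] .
  have "\<delta> \<le> y v" if v: "v \<in> \<sigma>" for v
  proof (cases "v \<in> vertex_tuple s ` {..p}")
    case True
    then show ?thesis using small_simplex_vertices[OF s y] \<delta> by fastforce
  next
    case False
    have "z v \<le> y v"
      using False off \<kappa> yK by (simp add: mult_left_le_one_le mem_underlying_set_iff)
    then show ?thesis using \<sigma>(2) v by fastforce
  qed
  then have "y \<in> thick A \<delta>" using yK \<sigma>(1) by (auto simp: thick_def)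
  with y avoid show False by blast
qed

end

lemma face_small:
  assumes "singular_simplex (Suc p) space_K s" "small_chain (Suc p) fine_cover (frag_of s)" "k \<le> Suc p"
  shows "singular_simplex p space_K (singular_face (Suc p) k s)"
    "singular_face (Suc p) k s ` standard_simplex p \<subseteq> s ` standard_simplex (Suc p)"
    "small_chain p fine_cover (frag_of (singular_face (Suc p) k s))"
    "join_hull p (singular_face (Suc p) k s) \<subseteq> join_hull (Suc p) s"
proof -
  show 1: "singular_simplex p space_K (singular_face (Suc p) k s)"
    using singular_simplex_singular_face[OF assms(1), of k] assms(3) by simp
  show 2: "singular_face (Suc p) k s ` standard_simplex p \<subseteq> s ` standard_simplex (Suc p)"
    using simplical_face_in_standard_simplex[of "Suc p" k] assms(3) by (auto simp: singular_face_def)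
  show "small_chain p fine_cover (frag_of (singular_face (Suc p) k s))"
    using 2 assms(2) unfolding small_chain_frag_of by blast
  have "vertex_tuple (singular_face (Suc p) k s) ` {..p} = (vertex_tuple s \<circ> skip k) ` {..p}"
    by (rule image_cong) (auto simp del: comp_apply intro: vertex_tuple_face)
  also have "\<dots> \<subseteq> vertex_tuple s ` {..Suc p}"
    unfolding image_comp[symmetric] skip_image[OF assms(3)] by auto
  finally have 3: "vertex_tuple (singular_face (Suc p) k s) ` {..p} \<subseteq> vertex_tuple s ` {..Suc p}" .
  show "join_hull p (singular_face (Suc p) k s) \<subseteq> join_hull (Suc p) s"
  proof
    fix z assume "z \<in> join_hull p (singular_face (Suc p) k s)"
    then obtain y \<kappa> where z: "\<forall>v. 0 \<le> z v" "sum z (\<Union>K) = 1"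
      and y: "y \<in> singular_face (Suc p) k s ` standard_simplex p"
      and \<kappa>: "0 \<le> \<kappa>" "\<kappa> \<le> 1" "\<forall>v. \<kappa> * y v \<le> z v"
      and off: "\<forall>v. v \<notin> vertex_tuple (singular_face (Suc p) k s) ` {..p} \<longrightarrow> z v = \<kappa> * y v"
      by (auto simp: join_hull_def)
    have "\<forall>v. v \<notin> vertex_tuple s ` {..Suc p} \<longrightarrow> z v = \<kappa> * y v" using off 3 by blast
    moreover have "y \<in> s ` standard_simplex (Suc p)" using y 2 by blast
    ultimately show "z \<in> join_hull (Suc p) s" unfolding join_hull_def using z \<kappa> by blast
  qed
qed

end

section \<open>Straightening small chains\<close>

lemma inversions_0: "inversions 0 t = 0"
  by (auto simp: inversions_def card_eq_0_iff)

context finite_complex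
begin

text \<open>
  A singular simplex is replaced by the affine simplex on its attached vertices, oriented by the
  tuple and zero if vertices repeat.
\<close>

definition straighten :: "nat \<Rightarrow> ('v \<Rightarrow> real) chain \<Rightarrow> ('v \<Rightarrow> real) chain"
  where "straighten p = frag_extend (\<lambda>s. alternate p (\<lambda>\<sigma>. frag_of (geom_simplex p \<sigma>)) (vertex_tuple s))"

lemma additive_straighten: "Modules.additive (straighten p)"
  unfolding straighten_def by (rule additive_frag_extend)

lemma straighten_boundary:
  "chain_boundary (Suc p) (straighten (Suc p) z) = straighten p (chain_boundary (Suc p) z)"
proof (rule alternating_boundary[symmetric])
  show "Modules.additive (straighten p)" by (rule additive_straighten)
  show "straighten p (frag_of s) = alternate p (\<lambda>\<sigma>. frag_of (geom_simplex p \<sigma>)) (vertex_tuple s)" for s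
    by (simp add: straighten_def)
  show "Modules.additive (\<lambda>z. chain_boundary (Suc p) (straighten (Suc p) z))"
    by unfold_locales (simp add: additive.add[OF additive_straighten] chain_boundary_add)
  fix s
  let ?t = "vertex_tuple s"
  show "chain_boundary (Suc p) (straighten (Suc p) (frag_of s))
     = alternate (Suc p) (simplicial_coboundary (\<lambda>\<sigma>. frag_of (geom_simplex p \<sigma>))) ?t"
  proof (cases "inj_on ?t {..Suc p}")
    case True
    have "finite (?t ` {..Suc p})" "card (?t ` {..Suc p}) = Suc (Suc p)"
      using card_image[OF True] by auto
    with True show ?thesis
      by (simp add: straighten_def alternate_def additive_sign_act[OF additive_chain_boundary]
          chain_boundary_geom_simplex del: atMost_Suc)
  next
    case False
    then show ?thesis by (simp add: straighten_def alternate_def del: atMost_Suc)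
  qed
qed

lemma singular_chain_sign_act: "singular_chain p X c \<Longrightarrow> singular_chain p X (sign_act n c)"
  unfolding sign_act_frag_cmul by (rule singular_chain_cmul)

lemma straighten_simplex_chain:
  assumes s: "singular_simplex p space_K s" "small_chain p fine_cover (frag_of s)"
  shows "singular_chain p (subtopology (powertop_real UNIV) (join_hull p s)) (straighten p (frag_of s))"
proof (cases "inj_on (vertex_tuple s) {..p}")
  case True
  have "singular_simplex p (subtopology (powertop_real UNIV) (join_hull p s)) (geom_simplex p (vertex_tuple s ` {..p}))"
    using card_image[OF True] by (intro singular_simplex_geom_simplex closed_simplex_subset_join_hull[OF s]) auto
  then show ?thesis
    using True by (simp add: straighten_def alternate_def singular_chain_sign_act singular_chain_of)
next
  case False
  then show ?thesis by (simp add: straighten_def alternate_def)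
qed

text \<open>
  The homotopy from the identity to straightening on one simplex, by the method of acyclic carriers:
  \<open>straighten s - s - contraction (boundary s)\<close> is a cycle in \<open>join_hull p
  s\<close>, and it bounds its cone with apex at the vertex attached to corner 0.
\<close>

primrec contraction :: "nat \<Rightarrow> ((nat \<Rightarrow> real) \<Rightarrow> 'v \<Rightarrow> real) \<Rightarrow> ('v \<Rightarrow> real) chain"
  where
    "contraction 0 = (\<lambda>s. cone_chain 0 (\<lambda>u. if u = vertex_tuple s 0 then 1 else 0)
       (straighten 0 (frag_of s) - frag_of s))"
  | "contraction (Suc p) = (\<lambda>s. cone_chain (Suc p) (\<lambda>u. if u = vertex_tuple s 0 then 1 else 0)
       (straighten (Suc p) (frag_of s) - frag_of s
        - frag_extend (contraction p) (chain_boundary (Suc p) (frag_of s))))"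

definition contract :: "nat \<Rightarrow> ('v \<Rightarrow> real) chain \<Rightarrow> ('v \<Rightarrow> real) chain"
  where "contract p = frag_extend (contraction p)"

lemma additive_contract: "Modules.additive (contract p)"
  unfolding contract_def by (rule additive_frag_extend)

text \<open>
  The homotopy formula is linear in the chain, so it only has to be known on small simplices. It is
  stated with this as a hypothesis because the induction on the degree uses it for one degree before
  all degrees are available.
\<close>

lemma contract_homotopy_extend:
  assumes "\<And>s. singular_simplex p space_K s \<Longrightarrow> small_chain p fine_cover (frag_of s) \<Longrightarrow>
      chain_boundary (Suc p) (contract p (frag_of s)) + contract (p - Suc 0) (chain_boundary p (frag_of s))
        = straighten p (frag_of s) - frag_of s"
    and "singular_chain p space_K z" "small_chain p fine_cover z"
  shows "chain_boundary (Suc p) (contract p z) + contract (p - Suc 0) (chain_boundary p z) = straighten p z - z"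
proof -
  have "Poly_Mapping.keys z \<subseteq> {s. singular_simplex p space_K s \<and> small_chain p fine_cover (frag_of s)}"
    using assms(2,3) by (auto simp: singular_chain_def small_chain_def)
  then show ?thesis
  proof (induction rule: frag_induction)
    case zero
    then show ?case by (simp add: additive.zero[OF additive_contract] additive.zero[OF additive_straighten])
  next
    case (diff a b)
    let ?H = "\<lambda>z. chain_boundary (Suc p) (contract p z) + contract (p - Suc 0) (chain_boundary p z)"
    have "?H (a - b) = ?H a - ?H b"
      by (simp add: additive.diff[OF additive_contract] chain_boundary_diff)
    also have "\<dots> = (straighten p a - a) - (straighten p b - b)" by (simp only: diff)
    finally show ?case by (simp add: additive.diff[OF additive_straighten])
  qed (use assms(1) in auto)
qed

text \<open>
  The homotopy formula in degree \<open>p\<close> shows that the chain coned over in degree \<open>p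
  + 1\<close> is a cycle; its carrier is star-shaped about the apex and contains the carriers of the
  faces.
\<close>

lemma contraction_properties:
  assumes "singular_simplex p space_K s" "small_chain p fine_cover (frag_of s)"
  shows "singular_chain (Suc p) (subtopology (powertop_real UNIV) (join_hull p s)) (contraction p s)
    \<and> chain_boundary (Suc p) (contract p (frag_of s)) + contract (p - Suc 0) (chain_boundary p (frag_of s))
        = straighten p (frag_of s) - frag_of s"
  using assms
proof (induction p arbitrary: s)
  case (0 s)
  note s = 0
  let ?W = "join_hull 0 s" and ?w = "\<lambda>u. if u = vertex_tuple s 0 then 1 else 0 :: real"
  have sW: "singular_simplex 0 (subtopology (powertop_real UNIV) ?W) s"
    using s(1) simplex_subset_join_hull[OF s] by (simp add: singular_simplex_subtopology)
  have st: "straighten 0 (frag_of s) = frag_of (geom_simplex 0 {vertex_tuple s 0})"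
    by (simp add: straighten_def alternate_def inversions_0 sign_act_def)
  have "singular_chain 0 (subtopology (powertop_real UNIV) ?W) (straighten 0 (frag_of s) - frag_of s)"
    using straighten_simplex_chain[OF s] sW by (intro singular_chain_diff) (simp_all add: singular_chain_of)
  then have "singular_chain (Suc 0) (subtopology (powertop_real UNIV) ?W) (contraction 0 s)"
    unfolding contraction.simps
    by (rule singular_chain_cone) (rule join_hull_star[OF s], simp_all add: join_hull_bounded[OF s])
  moreover have "chain_boundary (Suc 0) (contraction 0 s) = straighten 0 (frag_of s) - frag_of s"
    unfolding contraction.simps st
    by (rule boundary_cone_0) (use sW in \<open>auto simp: geom_simplex_def singular_simplex_def\<close>)
  ultimately show ?case by (simp add: contract_def chain_boundary_def[of 0])
next
  case (Suc p s)
  note s = Suc.prems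
  let ?W = "join_hull (Suc p) s" and ?w = "\<lambda>u. if u = vertex_tuple s 0 then 1 else 0 :: real"
  let ?T = "subtopology (powertop_real UNIV) ?W"
  let ?d = "chain_boundary (Suc p) (frag_of s)"
  let ?z = "straighten (Suc p) (frag_of s) - frag_of s - contract p ?d"
  have sW: "singular_simplex (Suc p) ?T s"
    using s(1) simplex_subset_join_hull[OF s] by (simp add: singular_simplex_subtopology)
  have dK: "singular_chain p space_K ?d" "small_chain p fine_cover ?d"
    using singular_chain_boundary_alt[of p space_K "frag_of s"]
      small_chain_boundary[of "Suc p" space_K "frag_of s" fine_cover] s by (auto simp: singular_chain_of)
  have face: "singular_chain (Suc p) ?T (contraction p (singular_face (Suc p) k s))" if k: "k \<le> Suc p" for k
  proof -
    note f = face_small[OF s k]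
    from Suc.IH[OF f(1,3)] have "singular_chain (Suc p) (subtopology (powertop_real UNIV)
        (join_hull p (singular_face (Suc p) k s))) (contraction p (singular_face (Suc p) k s))" ..
    then show ?thesis using f(4) by (rule singular_chain_mono)
  qed
  have Gd: "singular_chain (Suc p) ?T (contract p ?d)"
    unfolding contract_def
  proof (rule singular_chain_extend)
    fix f assume "f \<in> Poly_Mapping.keys ?d"
    then obtain k where "k \<le> Suc p" "f = singular_face (Suc p) k s"
      unfolding chain_boundary_of using keys_sum[of "\<lambda>k. frag_cmul ((-1) ^ k) (frag_of (singular_face (Suc p) k s))" "{..Suc p}"]
      by (auto simp del: sum.atMost_Suc split: if_splits)
    then show "singular_chain (Suc p) ?T (contraction p f)" using face by simp
  qed
  have zW: "singular_chain (Suc p) ?T ?z"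
    using straighten_simplex_chain[OF s] sW Gd by (intro singular_chain_diff) (simp_all add: singular_chain_of)
  have con: "contraction (Suc p) s = cone_chain (Suc p) ?w ?z" by (simp add: contract_def)
  have chain: "singular_chain (Suc (Suc p)) ?T (contraction (Suc p) s)"
    unfolding con using zW
    by (rule singular_chain_cone) (rule join_hull_star[OF s], simp_all add: join_hull_bounded[OF s])
  have "chain_boundary p ?d = 0"
    using chain_boundary_boundary_alt[of p space_K "frag_of s"] s by (simp add: singular_chain_of)
  then have "chain_boundary (Suc p) (contract p ?d) = straighten p ?d - ?d"
    using contract_homotopy_extend[OF conjunct2[OF Suc.IH] dK] by (simp add: additive.zero[OF additive_contract])
  \<comment> \<open>The boundary of a cone over a cycle is the cycle itself.\<close>
  then have "chain_boundary (Suc p) ?z = 0"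
    by (simp add: chain_boundary_diff straighten_boundary)
  then have "chain_boundary (Suc (Suc p)) (contraction (Suc p) s) = ?z"
    unfolding con boundary_cone_Suc[OF zW] by (simp add: additive.zero[OF additive_cone_chain])
  then show ?case using chain by (simp add: contract_def)
qed

lemma contract_homotopy:
  assumes "singular_chain p space_K z" "small_chain p fine_cover z"
  shows "chain_boundary (Suc p) (contract p z) + contract (p - Suc 0) (chain_boundary p z) = straighten p z - z"
  by (rule contract_homotopy_extend[OF conjunct2[OF contraction_properties] assms])

lemma contract_avoids_thick:
  assumes z: "singular_chain p (subtopology space_K (underlying_set K - thick A \<delta>)) z" "small_chain p fine_cover z"
    and \<delta>: "\<delta> \<le> mesh"
  shows "singular_chain (Suc p) (subtopology space_K (underlying_set K - thick A \<delta>)) (contract p z)"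
  unfolding contract_def
proof (rule singular_chain_extend)
  fix s assume k: "s \<in> Poly_Mapping.keys z"
  have "singular_simplex p (subtopology space_K (underlying_set K - thick A \<delta>)) s"
    using z(1) k by (auto simp: singular_chain_def)
  then have s: "singular_simplex p space_K s" and image: "s ` standard_simplex p \<subseteq> underlying_set K - thick A \<delta>"
    unfolding singular_simplex_subtopology by auto
  have small: "small_chain p fine_cover (frag_of s)" using z(2) k by (auto simp: small_chain_def)
  note s = s small
  have "s ` standard_simplex p \<inter> thick A \<delta> = {}"
    using image by blast
  then have "join_hull p s \<subseteq> underlying_set K - thick A \<delta>"
    using join_hull_avoids_thick[OF s \<delta>] join_hull_subset[OF s] by blast
  then have "singular_chain (Suc p) (subtopology (powertop_real UNIV) (underlying_set K - thick A \<delta>)) (contraction p s)"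
    using contraction_properties[OF s] singular_chain_mono by blast
  moreover have "subtopology space_K (underlying_set K - thick A \<delta>)
     = subtopology (powertop_real UNIV) (underlying_set K - thick A \<delta>)"
    by (simp add: subtopology_subtopology Int_absorb1)
  ultimately show "singular_chain (Suc p) (subtopology space_K (underlying_set K - thick A \<delta>)) (contraction p s)"
    by simp
qed

text \<open>
  The set \<open>thick {} mesh\<close> is empty, so there is nothing to avoid.
\<close>

lemma contract_chain:
  assumes "singular_chain p space_K z" "small_chain p fine_cover z"
  shows "singular_chain (Suc p) space_K (contract p z)"
  using contract_avoids_thick[of p "{}" mesh z] assms by (simp add: thick_def subtopology_subtopology)

end

section \<open>Simplicial cochains as singular cochains\<close>

definition supported :: "'v set set \<Rightarrow> nat \<Rightarrow> ('v set \<Rightarrow> 'f::field) \<Rightarrow> bool"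
  where "supported A p c \<longleftrightarrow> (\<forall>\<sigma>. c \<sigma> \<noteq> 0 \<longrightarrow> \<sigma> \<in> A \<and> card \<sigma> = Suc p)"

text \<open>
  The operators \<open>\<rho>\<close> and \<open>D\<close> are fixed once, so that the comparison
  maps of all supcomplexes of \<open>K\<close> come from the same cochains of \<open>|K|\<close> and
  are compatible with inclusions.
\<close>

locale refined_complex = finite_complex K for K :: "'v::linorder set set" +
  fixes \<rho> D :: "nat \<Rightarrow> ('v \<Rightarrow> real) chain \<Rightarrow> ('v \<Rightarrow> real) chain"
  assumes retraction: "small_retraction space_K fine_cover \<rho> D"
begin

sublocale small_retraction space_K fine_cover \<rho> D
  by (rule retraction)

lemma small_keys:
  assumes "singular_chain p space_K z" "small_chain p fine_cover z" "s \<in> Poly_Mapping.keys z"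
  shows "singular_simplex p space_K s" "small_chain p fine_cover (frag_of s)"
  using assms by (auto simp: singular_chain_def small_chain_def)

lemma pull_cong_small:
  assumes z: "singular_chain p space_K z" "small_chain p fine_cover z"
    and eq: "\<And>\<tau>. \<tau> \<in> K \<Longrightarrow> card \<tau> = Suc p \<Longrightarrow> c \<tau> = c' \<tau>"
  shows "pull p c z = pull p c' z"
  unfolding pull_def
proof (rule frag_eval_cong)
  fix s assume "s \<in> Poly_Mapping.keys z"
  note s = small_keys[OF z this]
  have "c (vertex_tuple s ` {..p}) = c' (vertex_tuple s ` {..p})" if "inj_on (vertex_tuple s) {..p}"
    using eq[OF small_simplex_vertex_set(2)[OF s]] card_image[OF that] by simp
  then show "alternate p c (vertex_tuple s) = alternate p c' (vertex_tuple s)"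
    by (simp add: alternate_def)
qed

definition realize :: "nat \<Rightarrow> ('v set \<Rightarrow> 'f::field) \<Rightarrow> ('v \<Rightarrow> real) chain \<Rightarrow> 'f"
  where "realize p c = (\<lambda>x\<in>singular_chain_set p space_K. pull p c (\<rho> p x))"

text \<open>
  If the vertices attached to a small simplex \<open>s\<close> form a simplex of \<open>A\<close>,
  all points of \<open>s\<close> have coordinates above \<open>mesh\<close> there and thus belong to
  \<open>thick A mesh\<close>. On other small simplices the cochain vanishes.
\<close>

lemma realize_cochain:
  assumes c: "supported A p c"
  shows "realize p c \<in> sing_cochains p space_K (underlying_set K - thick A mesh)"
  unfolding realize_def
proof (rule sing_cochainI)
  fix x y show "pull p c (\<rho> p (x + y)) = pull p c (\<rho> p x) + pull p c (\<rho> p y)"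
    by (simp add: additive.add[OF \<rho>_additive] additive.add[OF additive_pull])
next
  fix x assume x: "singular_chain p (subtopology space_K (underlying_set K - thick A mesh)) x"
  then have xK: "singular_chain p space_K x" unfolding singular_chain_subtopology by blast
  show "pull p c (\<rho> p x) = 0"
    unfolding pull_def
  proof (rule frag_eval_eq_0)
    fix s assume k: "s \<in> Poly_Mapping.keys (\<rho> p x)"
    note s = small_keys[OF \<rho>_chain[OF xK] \<rho>_small[OF xK] k]
    have "s ` standard_simplex p \<subseteq> underlying_set K - thick A mesh"
      using \<rho>_subspace[OF x] k unfolding singular_chain_subtopology by blast
    then have y: "s (std_vertex 0) \<in> underlying_set K - thick A mesh"
      by (rule subsetD[OF _ imageI]) simp
    have "vertex_tuple s ` {..p} \<notin> A"
    proof
      assume A: "vertex_tuple s ` {..p} \<in> A"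
      have "mesh \<le> s (std_vertex 0) v" if "v \<in> vertex_tuple s ` {..p}" for v
        using small_simplex_vertices[OF s, of "s (std_vertex 0)"] that by (auto intro: less_imp_le)
      then have "s (std_vertex 0) \<in> thick A mesh" using A y by (auto simp: thick_def)
      with y show False by simp
    qed
    then have "c (vertex_tuple s ` {..p}) = 0" using c unfolding supported_def by blast
    then show "alternate p c (vertex_tuple s) = 0" by (simp add: alternate_def)
  qed
qed

lemma realize_cocycle:
  assumes c: "supported A p c"
    and coc: "\<And>\<tau>. \<tau> \<in> K \<Longrightarrow> card \<tau> = Suc (Suc p) \<Longrightarrow> simplicial_coboundary c \<tau> = 0"
  shows "realize p c \<in> sing_cocycles p space_K (underlying_set K - thick A mesh)"
  unfolding sing_cocycles_iff
proof (intro conjI allI impI realize_cochain c)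
  fix y assume y: "singular_chain (Suc p) space_K y"
  have "realize p c (chain_boundary (Suc p) y) = pull p c (chain_boundary (Suc p) (\<rho> (Suc p) y))"
    using y by (simp add: realize_def singular_chain_boundary_alt \<rho>_boundary)
  also have "\<dots> = pull (Suc p) (simplicial_coboundary c) (\<rho> (Suc p) y)" by (rule pull_boundary)
  also have "\<dots> = pull (Suc p) (\<lambda>_. 0) (\<rho> (Suc p) y)"
    by (rule pull_cong_small[OF \<rho>_chain[OF y] \<rho>_small[OF y]]) (rule coc)
  also have "\<dots> = 0" unfolding pull_def by (rule frag_eval_eq_0) (simp add: alternate_def)
  finally show "realize p c (chain_boundary (Suc p) y) = 0" .
qed

lemma realize_coboundary:
  assumes b: "supported A p b"
    and eq: "\<And>\<tau>. \<tau> \<in> K \<Longrightarrow> card \<tau> = Suc (Suc p) \<Longrightarrow> c \<tau> = simplicial_coboundary b \<tau>"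
  shows "realize (Suc p) c \<in> sing_coboundaries (Suc p) space_K (underlying_set K - thick A mesh)"
proof -
  have "realize (Suc p) c = (\<lambda>x\<in>singular_chain_set (Suc p) space_K. realize p b (chain_boundary (Suc p) x))"
    unfolding realize_def[of "Suc p"]
  proof (rule restrict_ext)
    fix x assume "x \<in> singular_chain_set (Suc p) space_K"
    then have x: "singular_chain (Suc p) space_K x" by simp
    have "pull (Suc p) c (\<rho> (Suc p) x) = pull (Suc p) (simplicial_coboundary b) (\<rho> (Suc p) x)"
      by (rule pull_cong_small[OF \<rho>_chain[OF x] \<rho>_small[OF x]]) (rule eq)
    also have "\<dots> = realize p b (chain_boundary (Suc p) x)"
      using x by (simp add: pull_boundary[symmetric] realize_def singular_chain_boundary_alt \<rho>_boundary)
    finally show "pull (Suc p) c (\<rho> (Suc p) x) = realize p b (chain_boundary (Suc p) x)" .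
  qed
  also have "\<dots> \<in> sing_coboundaries (Suc p) space_K (underlying_set K - thick A mesh)"
    by (rule sing_coboundariesI) (simp add: realize_cochain[OF b])
  finally show ?thesis .
qed

lemma geom_simplex_in_K:
  assumes "\<tau> \<in> K" "card \<tau> = Suc p"
  shows "singular_chain p space_K (frag_of (geom_simplex p \<tau>))"
  using singular_simplex_geom_simplex[OF finite_simplex assms(2) closed_simplex_subset] assms
  by (simp add: singular_chain_of)

text \<open>
  The only simplex with \<open>p + 1\<close> vertices spanned by vertices of \<open>\<tau>\<close>
  is \<open>\<tau>\<close> itself, so the cochain enters only through its value on
  \<open>\<tau>\<close>.
\<close>

lemma pull_in_simplex:
  assumes \<tau>: "\<tau> \<in> K" "card \<tau> = Suc p"
    and z: "singular_chain p (subtopology space_K (closed_simplex \<tau>)) z" "small_chain p fine_cover z"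
  shows "pull p c z = c \<tau> * pull p (\<lambda>\<sigma>. if \<sigma> = \<tau> then 1 else 0) z"
proof -
  have zK: "singular_chain p space_K z" using z(1) unfolding singular_chain_subtopology by blast
  have "alternate p c (vertex_tuple s) = c \<tau> * alternate p (\<lambda>\<sigma>. if \<sigma> = \<tau> then 1 else 0) (vertex_tuple s)"
    if k: "s \<in> Poly_Mapping.keys z" for s
  proof (cases "inj_on (vertex_tuple s) {..p}")
    case True
    note s = small_keys[OF zK z(2) k]
    have "s ` standard_simplex p \<subseteq> closed_simplex \<tau>"
      using z(1) k unfolding singular_chain_subtopology by blast
    then have "s (std_vertex 0) \<in> closed_simplex \<tau>" by (rule subsetD[OF _ imageI]) simp
    then have "vertex_tuple s ` {..p} \<subseteq> \<tau>"
      using small_simplex_vertex_set(1)[OF s, of "s (std_vertex 0)"] by (auto simp: closed_simplex_def)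
    moreover have "card (vertex_tuple s ` {..p}) = card \<tau>" using card_image[OF True] \<tau>(2) by simp
    ultimately have "vertex_tuple s ` {..p} = \<tau>" using finite_simplex[OF \<tau>(1)] by (intro card_subset_eq)
    then show ?thesis by (simp add: alternate_def sign_act_def)
  qed (simp add: alternate_def)
  then have "pull p c z = frag_eval (\<lambda>s. c \<tau> * alternate p (\<lambda>\<sigma>. if \<sigma> = \<tau> then 1 else 0) (vertex_tuple s)) z"
    unfolding pull_def by (rule frag_eval_cong)
  also have "\<dots> = c \<tau> * pull p (\<lambda>\<sigma>. if \<sigma> = \<tau> then 1 else 0) z"
    by (simp add: pull_def frag_eval_def sum_distrib_left algebra_simps)
  finally show ?thesis .
qed

lemma geom_simplex_in_closed:
  assumes "\<tau> \<in> K" "card \<tau> = Suc p"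
  shows "singular_chain p (subtopology space_K (closed_simplex \<tau>)) (frag_of (geom_simplex p \<tau>))"
proof -
  have "subtopology space_K (closed_simplex \<tau>) = subtopology (powertop_real UNIV) (closed_simplex \<tau>)"
    using closed_simplex_subset[OF assms(1)] by (simp add: subtopology_subtopology Int_absorb1)
  then show ?thesis
    using singular_simplex_geom_simplex[OF finite_simplex[OF assms(1)] assms(2) order_refl]
    by (simp add: singular_chain_of)
qed

text \<open>
  Sperner's lemma in signed form: in a subdivision of \<open>\<tau>\<close>, the simplices that
  carry all vertices as labels are counted with total sign 1. As in the usual proof, the induction
  passes to a facet, here the one opposite to the smallest vertex, whose incidence sign is positive:
  the indicator of \<open>\<tau>\<close> agrees on \<open>\<tau>\<close> with the coboundary of the
  indicator of that facet, and of all facets of \<open>\<tau>\<close> only this one contributes to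
  the value of the latter indicator on the boundary.
\<close>

lemma sperner:
  assumes "\<tau> \<in> K" "card \<tau> = Suc p"
  shows "pull p (\<lambda>\<sigma>. if \<sigma> = \<tau> then 1 else 0 :: 'f::field) (\<rho> p (frag_of (geom_simplex p \<tau>))) = 1"
  using assms
proof (induction p arbitrary: \<tau>)
  case 0
  then obtain v where \<tau>: "\<tau> = {v}" using card_1_singletonE by (metis One_nat_def)
  let ?s = "geom_simplex 0 \<tau>"
  have val: "?s x u = (if u = v then 1 else 0)" if "x \<in> standard_simplex 0" for x u
    using that by (auto simp: geom_simplex_def \<tau> rank_in_def standard_simplex_0)
  have sK: "singular_chain 0 space_K (frag_of ?s)" by (rule geom_simplex_in_K[OF 0])
  have "?s (std_vertex 0) \<in> underlying_set K"
    using sK by (auto simp: singular_chain_of singular_simplex_subtopology)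
  then have "\<exists>U\<in>fine_cover. ?s (std_vertex 0) \<in> U" using fine_cover_covers by auto
  moreover have "?s ` standard_simplex 0 = {?s (std_vertex 0)}" by (simp add: standard_simplex_0 std_vertex_def)
  ultimately have small: "small_chain 0 fine_cover (frag_of ?s)" by (auto simp: small_chain_frag_of)
  have "0 < ?s (std_vertex 0) (vertex_tuple ?s 0)"
    using small_simplex_vertices[OF _ small, of "?s (std_vertex 0)" 0] sK mesh_pos
    by (simp add: singular_chain_of)
  then have "vertex_tuple ?s 0 = v" using val[of "std_vertex 0" "vertex_tuple ?s 0"] by (auto split: if_splits)
  then show ?case
    unfolding \<rho>_id[OF sK small] by (simp add: pull_def alternate_def inversions_0 sign_act_def \<tau>)
next
  case (Suc p)
  let ?e = "\<lambda>\<tau> \<sigma>. if \<sigma> = \<tau> then 1 else 0 :: 'f"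
  note fin = finite_simplex[OF Suc.prems(1)]
  have ne: "\<tau> \<noteq> {}" using Suc.prems(2) by auto
  define v where "v = Min \<tau>"
  have v: "v \<in> \<tau>" and least: "{u\<in>\<tau>. u < v} = {}"
    using fin ne by (auto simp: v_def not_less)
  have card0: "card {u\<in>\<tau>. u < v} = 0" by (simp only: least card.empty)
  have face: "\<tau> - {u} \<in> K \<and> card (\<tau> - {u}) = Suc p" if "u \<in> \<tau>" for u
  proof -
    have "card (\<tau> - {u}) = Suc p" using that Suc.prems(2) fin by simp
    moreover from this have "\<tau> - {u} \<noteq> {}" by (metis Zero_not_Suc card.empty)
    ultimately show ?thesis using face_in_K[OF Suc.prems(1), of "\<tau> - {u}"] by auto
  qed
  let ?z = "frag_of (geom_simplex (Suc p) \<tau>)"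
  note zK = geom_simplex_in_K[OF Suc.prems] and zc = geom_simplex_in_closed[OF Suc.prems]
  have inj: "\<tau> - {u} = \<tau> - {v} \<longleftrightarrow> u = v" if "u \<in> \<tau>" for u using that v by auto
  have unit: "simplicial_coboundary (?e (\<tau> - {v})) \<tau> = 1"
  proof -
    have "simplicial_coboundary (?e (\<tau> - {v})) \<tau> = (\<Sum>u\<in>\<tau>. if u = v then 1 else 0 :: 'f)"
      unfolding simplicial_coboundary_def
      by (rule sum.cong) (use inj in \<open>auto simp: sign_act_def card0\<close>)
    then show ?thesis using fin v by simp
  qed
  have "pull (Suc p) (?e \<tau>) (\<rho> (Suc p) ?z) = pull (Suc p) (simplicial_coboundary (?e (\<tau> - {v}))) (\<rho> (Suc p) ?z)"
    using pull_in_simplex[OF Suc.prems \<rho>_subspace[OF zc] \<rho>_small[OF zK], of "simplicial_coboundary (?e (\<tau> - {v}))"]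
    by (simp add: unit)
  also have "\<dots> = pull p (?e (\<tau> - {v})) (\<rho> p (chain_boundary (Suc p) ?z))"
    by (simp add: pull_boundary[symmetric] \<rho>_boundary[OF zK])
  also have "\<dots> = (\<Sum>u\<in>\<tau>. sign_act (card {w\<in>\<tau>. w < u}) (pull p (?e (\<tau> - {v})) (\<rho> p (frag_of (geom_simplex p (\<tau> - {u}))))))"
    unfolding chain_boundary_geom_simplex[OF fin Suc.prems(2)] simplicial_coboundary_def
    by (simp add: additive.sum[OF \<rho>_additive] additive.sum[OF additive_pull]
        additive_sign_act[OF \<rho>_additive] additive_sign_act[OF additive_pull])
  also have "\<dots> = (\<Sum>u\<in>\<tau>. sign_act (card {w\<in>\<tau>. w < u}) (?e (\<tau> - {v}) (\<tau> - {u})))"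
  proof (rule sum.cong[OF refl])
    fix u assume u: "u \<in> \<tau>"
    note f = face[OF u, THEN conjunct1] face[OF u, THEN conjunct2]
    show "sign_act (card {w\<in>\<tau>. w < u}) (pull p (?e (\<tau> - {v})) (\<rho> p (frag_of (geom_simplex p (\<tau> - {u})))))
        = sign_act (card {w\<in>\<tau>. w < u}) (?e (\<tau> - {v}) (\<tau> - {u}))"
      using pull_in_simplex[OF f \<rho>_subspace[OF geom_simplex_in_closed[OF f]] \<rho>_small[OF geom_simplex_in_K[OF f]],
          of "?e (\<tau> - {v})"]
      by (simp only: Suc.IH[OF f] mult_1_right)
  qed
  also have "\<dots> = 1" using unit by (simp only: simplicial_coboundary_def)
  finally show ?case .
qed

text \<open>
  Sampling the realization of a cochain gives back the cochain.
\<close>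

lemma realize_geom_simplex:
  assumes "\<tau> \<in> K" "card \<tau> = Suc p"
  shows "realize p c (frag_of (geom_simplex p \<tau>)) = c \<tau>"
  using pull_in_simplex[OF assms \<rho>_subspace[OF geom_simplex_in_closed[OF assms]] \<rho>_small[OF geom_simplex_in_K[OF assms]], of c]
    sperner[OF assms, where 'f = 'a] geom_simplex_in_K[OF assms]
  by (simp add: realize_def)

definition sample :: "'v set set \<Rightarrow> nat \<Rightarrow> (('v \<Rightarrow> real) chain \<Rightarrow> 'f::field) \<Rightarrow> 'v set \<Rightarrow> 'f"
  where "sample A p \<phi> \<tau> = (if \<tau> \<in> A \<and> card \<tau> = Suc p then \<phi> (frag_of (geom_simplex p \<tau>)) else 0)"

lemma supported_sample: "supported A p (sample A p \<phi>)"
  by (auto simp: supported_def sample_def)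

text \<open>
  A simplex of \<open>K\<close> outside the supcomplex is disjoint from \<open>|A|\<close>, together
  with all its faces; so its affine simplex avoids \<open>C\<close> and \<open>\<phi>\<close>
  vanishes on it.
\<close>

lemma sample_eq:
  assumes A: "supcomplex K A" and C: "C \<subseteq> underlying_set A"
    and \<phi>: "\<phi> \<in> sing_cochains p space_K (underlying_set K - C)"
    and \<tau>: "\<tau> \<in> K" "card \<tau> = Suc p"
  shows "sample A p \<phi> \<tau> = \<phi> (frag_of (geom_simplex p \<tau>))"
proof (cases "\<tau> \<in> A")
  case False
  have "x \<notin> C" if x: "x \<in> closed_simplex \<tau>" for x
  proof
    assume "x \<in> C"
    then have "support x \<in> A" using C by (auto simp: mem_underlying_set_iff)
    then show False
      using supcomplex_upward[OF A _ \<tau>(1)] x False by (auto simp: closed_simplex_def)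
  qed
  then have "singular_chain p (subtopology space_K (underlying_set K - C)) (frag_of (geom_simplex p \<tau>))"
    using closed_simplex_subset[OF \<tau>(1)] by (intro singular_chain_mono[OF geom_simplex_in_closed[OF \<tau>]]) blast
  from sing_cochain_rel[OF \<phi> this] False show ?thesis by (simp add: sample_def)
qed (simp add: sample_def \<tau>)

lemma sample_coboundary:
  assumes A: "supcomplex K A" and C: "C \<subseteq> underlying_set A"
    and \<phi>: "\<phi> \<in> sing_cochains p space_K (underlying_set K - C)"
    and \<tau>: "\<tau> \<in> K" "card \<tau> = Suc (Suc p)"
  shows "simplicial_coboundary (sample A p \<phi>) \<tau> = \<phi> (chain_boundary (Suc p) (frag_of (geom_simplex (Suc p) \<tau>)))"
proof -
  have face: "\<tau> - {u} \<in> K \<and> card (\<tau> - {u}) = Suc p" if "u \<in> \<tau>" for u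
  proof -
    have "card (\<tau> - {u}) = Suc p" using that \<tau>(2) finite_simplex[OF \<tau>(1)] by simp
    moreover from this have "\<tau> - {u} \<noteq> {}" by (metis Zero_not_Suc card.empty)
    ultimately show ?thesis using face_in_K[OF \<tau>(1), of "\<tau> - {u}"] by auto
  qed
  have sg: "\<phi> (sign_act n x) = sign_act n (\<phi> x)" if "singular_chain p space_K x" for n x
    using sing_cochain_minus[OF \<phi> that] by (simp add: sign_act_def)
  have "\<phi> (chain_boundary (Suc p) (frag_of (geom_simplex (Suc p) \<tau>)))
     = (\<Sum>u\<in>\<tau>. \<phi> (sign_act (card {w\<in>\<tau>. w < u}) (frag_of (geom_simplex p (\<tau> - {u})))))"
    unfolding chain_boundary_geom_simplex[OF finite_simplex[OF \<tau>(1)] \<tau>(2)] simplicial_coboundary_def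
    by (rule sing_cochain_sum[OF \<phi>]) (use face geom_simplex_in_K singular_chain_sign_act in blast)
  also have "\<dots> = (\<Sum>u\<in>\<tau>. sign_act (card {w\<in>\<tau>. w < u}) (sample A p \<phi> (\<tau> - {u})))"
    by (rule sum.cong) (use face sample_eq[OF A C \<phi>] in \<open>auto simp: sg geom_simplex_in_K\<close>)
  finally show ?thesis by (simp add: simplicial_coboundary_def)
qed

text \<open>
  On small chains, the sampled cochain takes the value of \<open>\<phi>\<close> on the straightened
  chain. Hence the realization is \<open>\<phi>\<close> composed with straightening after
  \<open>\<rho>\<close>, which is chain homotopic to the identity by \<open>contract\<close> and
  \<open>D\<close>. Both homotopies map chains that avoid \<open>thick A \<delta>\<close> to such
  chains, so the resulting cochain is relative to the complement of \<open>thick A \<delta>\<close>.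
\<close>

lemma realize_sample_cohomologous:
  assumes A: "supcomplex K A" and \<delta>: "0 < \<delta>" "\<delta> \<le> mesh" and C: "C \<subseteq> thick A \<delta>"
    and \<phi>: "\<phi> \<in> sing_cocycles p space_K (underlying_set K - C)"
  shows "(\<lambda>x\<in>singular_chain_set p space_K. realize p (sample A p \<phi>) x - \<phi> x)
    \<in> sing_coboundaries p space_K (underlying_set K - thick A \<delta>)"
proof -
  let ?c = "sample A p \<phi>"
  note \<phi>' = sing_cocycle_cochain[OF \<phi>]
  have CA: "C \<subseteq> underlying_set A" using C thick_subset[OF A \<delta>(1)] by blast
  have straight: "pull p ?c z = \<phi> (straighten p z)"
    if z: "singular_chain p space_K z" "small_chain p fine_cover z" for z
  proof -
    have "Poly_Mapping.keys z \<subseteq> {s. singular_simplex p space_K s \<and> small_chain p fine_cover (frag_of s)}"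
      using z by (auto simp: singular_chain_def small_chain_def)
    then have "singular_chain p space_K (straighten p z) \<and> pull p ?c z = \<phi> (straighten p z)"
    proof (induction rule: frag_induction)
      case zero
      then show ?case
        using \<phi>' by (simp add: additive.zero[OF additive_straighten] additive.zero[OF additive_pull])
    next
      case (one s)
      then have s: "singular_simplex p space_K s" "small_chain p fine_cover (frag_of s)" by auto
      have K: "vertex_tuple s ` {..p} \<in> K" by (rule small_simplex_vertex_set(2)[OF s])
      show ?case
      proof (cases "inj_on (vertex_tuple s) {..p}")
        case True
        then have crd: "card (vertex_tuple s ` {..p}) = Suc p" by (simp add: card_image)
        note g = geom_simplex_in_K[OF K crd]
        show ?thesis
          using True g sample_eq[OF A CA \<phi>' K crd] sing_cochain_minus[OF \<phi>' g]
          by (simp add: straighten_def pull_def alternate_def singular_chain_sign_act) (simp add: sign_act_def)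
      next
        case False
        then show ?thesis using \<phi>' by (simp add: straighten_def pull_def alternate_def)
      qed
    next
      case (diff a b)
      then show ?case
        by (simp add: additive.diff[OF additive_straighten] additive.diff[OF additive_pull]
            singular_chain_diff sing_cochain_diff[OF \<phi>'])
    qed
    then show ?thesis ..
  qed
  have main: "realize p ?c y - \<phi> y = \<phi> (contract (p - Suc 0) (\<rho> (p - Suc 0) (chain_boundary p y)))
      + \<phi> (D (p - Suc 0) (chain_boundary p y))"
    and degree_0: "p = 0 \<Longrightarrow> realize p ?c y - \<phi> y = 0"
    if y: "singular_chain p space_K y" for y
  proof -
    have dy: "singular_chain (p - Suc 0) space_K (chain_boundary p y)"
      using singular_chain_boundary[OF y] .
    let ?u = "contract (p - Suc 0) (\<rho> (p - Suc 0) (chain_boundary p y))"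
    let ?w = "D (p - Suc 0) (chain_boundary p y)"
    have zero: "?u = 0" "?w = 0" if "p = 0"
      using that by (simp_all add: chain_boundary_def additive.zero[OF \<rho>_additive]
          additive.zero[OF D_additive] additive.zero[OF additive_contract])
    have u: "singular_chain p space_K ?u" and w: "singular_chain p space_K ?w"
      using zero contract_chain[OF \<rho>_chain[OF dy] \<rho>_small[OF dy]] D_chain[OF dy]
      by (cases "p = 0"; simp)+
    let ?z = "\<rho> p y"
    note z = \<rho>_chain[OF y] \<rho>_small[OF y]
    have cz: "singular_chain p space_K (chain_boundary (Suc p) (contract p ?z))"
      "\<phi> (chain_boundary (Suc p) (contract p ?z)) = 0"
      using singular_chain_boundary_alt[OF contract_chain[OF z]] \<phi> contract_chain[OF z]
      by (simp_all add: sing_cocycles_iff)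
    have "straighten p ?z = chain_boundary (Suc p) (contract p ?z) + ?u + ?z"
      using contract_homotopy[OF z] by (simp add: \<rho>_boundary[OF y] algebra_simps)
    then have 1: "\<phi> (straighten p ?z) = \<phi> ?u + \<phi> ?z"
      using cz u z(1) by (simp add: sing_cochain_add[OF \<phi>'] singular_chain_add)
    have Dy: "singular_chain p space_K (chain_boundary (Suc p) (D p y))" "\<phi> (chain_boundary (Suc p) (D p y)) = 0"
      using singular_chain_boundary_alt[OF D_chain[OF y]] \<phi> D_chain[OF y] by (simp_all add: sing_cocycles_iff)
    have "?z = chain_boundary (Suc p) (D p y) + ?w + y"
      using homotopy[OF y] by (simp add: algebra_simps)
    then have "\<phi> ?z = \<phi> (chain_boundary (Suc p) (D p y) + ?w + y)" by (rule arg_cong)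
    also have "\<dots> = \<phi> ?w + \<phi> y"
      using Dy w y by (simp add: sing_cochain_add[OF \<phi>'] singular_chain_add)
    finally have 2: "\<phi> ?z = \<phi> ?w + \<phi> y" .
    have "realize p ?c y = \<phi> (straighten p ?z)"
      using straight[OF z] y by (simp add: realize_def)
    then show m: "realize p ?c y - \<phi> y = \<phi> ?u + \<phi> ?w" using 1 2 by simp
    show "realize p ?c y - \<phi> y = 0" if "p = 0" unfolding m using zero[OF that] \<phi>' by simp
  qed
  \<comment> \<open>The case \<open>p = 0\<close> is separate since \<open>contract (p - Suc 0)\<close> and \<open>D (p - Suc 0)\<close> would raise the
    degree above that of \<open>\<phi>\<close>; there the boundary vanishes and so does the difference.\<close>
  define \<theta> where "\<theta> = (if p = 0 then \<lambda>_. 0 else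
    (\<lambda>w. \<phi> (contract (p - Suc 0) (\<rho> (p - Suc 0) w)) + \<phi> (D (p - Suc 0) w)))"
  have \<theta>: "restrict \<theta> (singular_chain_set (p - Suc 0) space_K)
      \<in> sing_cochains (p - Suc 0) space_K (underlying_set K - thick A \<delta>)"
  proof (cases p)
    case 0
    show ?thesis by (rule sing_cochainI) (simp_all add: \<theta>_def 0)
  next
    case (Suc q)
    show ?thesis
    proof (rule sing_cochainI)
      fix x y assume "singular_chain (p - Suc 0) space_K x" "singular_chain (p - Suc 0) space_K y"
      then have x: "singular_chain q space_K x" and y: "singular_chain q space_K y" by (simp_all add: Suc)
      show "\<theta> (x + y) = \<theta> x + \<theta> y"
        using sing_cochain_add[OF \<phi>'[unfolded Suc] contract_chain[OF \<rho>_chain[OF x] \<rho>_small[OF x]]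
              contract_chain[OF \<rho>_chain[OF y] \<rho>_small[OF y]]]
          sing_cochain_add[OF \<phi>'[unfolded Suc] D_chain[OF x] D_chain[OF y]]
        by (simp add: \<theta>_def Suc additive.add[OF \<rho>_additive] additive.add[OF D_additive] additive.add[OF additive_contract])
    next
      fix x assume "singular_chain (p - Suc 0) (subtopology space_K (underlying_set K - thick A \<delta>)) x"
      then have x: "singular_chain q (subtopology space_K (underlying_set K - thick A \<delta>)) x" by (simp add: Suc)
      then have xK: "singular_chain q space_K x" unfolding singular_chain_subtopology by blast
      have sub: "underlying_set K - thick A \<delta> \<subseteq> underlying_set K - C" using C by blast
      have 1: "singular_chain p (subtopology space_K (underlying_set K - C)) (contract q (\<rho> q x))"
        unfolding Suc by (rule singular_chain_mono[OF contract_avoids_thick[OF \<rho>_subspace[OF x] \<rho>_small[OF xK] \<delta>(2)] sub])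
      have 2: "singular_chain p (subtopology space_K (underlying_set K - C)) (D q x)"
        unfolding Suc by (rule singular_chain_mono[OF D_subspace[OF x] sub])
      show "\<theta> x = 0"
        using sing_cochain_rel[OF \<phi>' 1] sing_cochain_rel[OF \<phi>' 2] by (simp add: \<theta>_def Suc)
    qed
  qed
  have eq: "(\<lambda>x\<in>singular_chain_set p space_K. realize p ?c x - \<phi> x)
    = (\<lambda>x\<in>singular_chain_set p space_K. restrict \<theta> (singular_chain_set (p - Suc 0) space_K) (chain_boundary p x))"
  proof (rule restrict_ext)
    fix x assume "x \<in> singular_chain_set p space_K"
    then have x: "singular_chain p space_K x" by simp
    show "realize p ?c x - \<phi> x = restrict \<theta> (singular_chain_set (p - Suc 0) space_K) (chain_boundary p x)"
    proof (cases "p = 0")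
      case True
      then show ?thesis using degree_0[OF x True] singular_chain_boundary[OF x] by (simp add: \<theta>_def)
    next
      case False
      then show ?thesis using main[OF x] singular_chain_boundary[OF x] by (simp add: \<theta>_def)
    qed
  qed
  show ?thesis unfolding eq by (rule sing_coboundariesI[OF \<theta>])
qed

text \<open>
  If the realization of \<open>c\<close> is the coboundary of \<open>\<eta>\<close>, then sampling
  shows that \<open>c\<close> is the coboundary of the sampled \<open>\<eta>\<close>. Since
  \<open>\<eta>\<close> vanishes off a subset of \<open>|A|\<close>, its sample is supported on
  \<open>A\<close>.
\<close>

lemma realize_coboundary_imp:
  assumes A: "supcomplex K A" and C: "C \<subseteq> underlying_set A"
    and r: "realize p c \<in> sing_coboundaries p space_K (underlying_set K - C)"
  obtains b where "\<And>q. p = Suc q \<Longrightarrow> supported A q b"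
    "\<And>\<tau>. \<tau> \<in> K \<Longrightarrow> card \<tau> = Suc p \<Longrightarrow> c \<tau> = (if p = 0 then 0 else simplicial_coboundary b \<tau>)"
proof -
  obtain \<eta> where \<eta>: "\<eta> \<in> sing_cochains (p - Suc 0) space_K (underlying_set K - C)"
    and eq: "realize p c = (\<lambda>x\<in>singular_chain_set p space_K. \<eta> (chain_boundary p x))"
    using r unfolding sing_coboundaries_eq by (elim imageE)
  show thesis
  proof (rule that[of "sample A (p - Suc 0) \<eta>"])
    show "supported A q (sample A (p - Suc 0) \<eta>)" if "p = Suc q" for q
      using supported_sample[of A q \<eta>] that by simp
    fix \<tau> assume \<tau>: "\<tau> \<in> K" "card \<tau> = Suc p"
    have "c \<tau> = \<eta> (chain_boundary p (frag_of (geom_simplex p \<tau>)))"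
      using realize_geom_simplex[OF \<tau>, of c] fun_cong[OF eq, of "frag_of (geom_simplex p \<tau>)"] geom_simplex_in_K[OF \<tau>] by simp
    also have "\<dots> = (if p = 0 then 0 else simplicial_coboundary (sample A (p - Suc 0) \<eta>) \<tau>)"
    proof (cases p)
      case 0
      then show ?thesis using sing_cochain_zero[OF \<eta>] by (simp add: chain_boundary_def)
    next
      case (Suc q)
      then show ?thesis
        using sample_coboundary[OF A C, of \<eta> q \<tau>] \<eta> \<tau> by simp
    qed
    finally show "c \<tau> = (if p = 0 then 0 else simplicial_coboundary (sample A (p - Suc 0) \<eta>) \<tau>)" .
  qed
qed

end

section \<open>Linear algebra and Moebius inversion\<close>

text \<open>
  Linearly independent subsets of \<open>W\<close> have bounded size, and a maximal one is a finite
  basis.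
\<close>

lemma (in vectorspace) fin_dim_subspace:
  assumes fd: "fin_dim" and W: "LinearCombinations.submodule K W V"
  shows "vectorspace.fin_dim K (vs W)"
proof -
  have sub: "VectorSpace.subspace K W V"
    using W by (simp add: VectorSpace.subspace_def vectorspace_axioms)
  interpret W: vectorspace K "vs W" by (rule subspace_is_vs[OF sub])
  have WV: "W \<subseteq> carrier V" using W by (rule submodule.subset)
  let ?P = "\<lambda>S. S \<subseteq> carrier (vs W) \<and> W.lin_indpt S"
  have "finite S \<and> card S \<le> dim" if "?P S" for S
  proof -
    have "lin_indpt S" using span_li_not_depend(2)[of S W] that W by simp
    then show ?thesis using li_le_dim[OF fd, of S] that WV by auto
  qed
  moreover have "?P {}" by (simp add: W.lin_dep_def)
  ultimately obtain A where A: "finite A" "maximal A ?P"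
    using maximal_exists[of ?P dim "{}"] by blast
  then have "W.gen_set A" by (intro W.max_li_is_gen)
  with A show ?thesis unfolding W.fin_dim_def maximal_def by blast
qed

text \<open>
  The vector space axioms transfer along a surjection that preserves the operations. This makes the
  colimit a vector space without a study of its operations on arbitrary representatives.
\<close>

lemma vectorspace_hom_image:
  assumes V: "vectorspace R V" and f: "f \<in> module_hom R V W"
    and surj: "f ` carrier V = carrier W" and zero: "f \<zero>\<^bsub>V\<^esub> = \<zero>\<^bsub>W\<^esub>"
  shows "vectorspace R W"
proof -
  interpret V: vectorspace R V by (rule V)
  note add = module_hom_add[OF f, symmetric] and smult = module_hom_smult[OF f, symmetric]
  have pre: "\<exists>v\<in>carrier V. w = f v" if "w \<in> carrier W" for w
    using that unfolding surj[symmetric] by auto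
  have img: "f v \<in> carrier W" if "v \<in> carrier V" for v
    using that surj by auto
  have ab: "abelian_group W"
  proof (rule abelian_groupI)
    fix x y assume "x \<in> carrier W" "y \<in> carrier W"
    then obtain u v where "u \<in> carrier V" "v \<in> carrier V" "x = f u" "y = f v" using pre by metis
    then show "x \<oplus>\<^bsub>W\<^esub> y \<in> carrier W" "x \<oplus>\<^bsub>W\<^esub> y = y \<oplus>\<^bsub>W\<^esub> x"
      by (simp_all add: add img V.M.a_comm)
  next
    show "\<zero>\<^bsub>W\<^esub> \<in> carrier W" using img[of "\<zero>\<^bsub>V\<^esub>"] zero by simp
  next
    fix x y z assume "x \<in> carrier W" "y \<in> carrier W" "z \<in> carrier W"
    then obtain u v w where "u \<in> carrier V" "v \<in> carrier V" "w \<in> carrier V" "x = f u" "y = f v" "z = f w"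
      using pre by metis
    then show "x \<oplus>\<^bsub>W\<^esub> y \<oplus>\<^bsub>W\<^esub> z = x \<oplus>\<^bsub>W\<^esub> (y \<oplus>\<^bsub>W\<^esub> z)"
      by (simp add: add V.M.a_assoc)
  next
    fix x assume "x \<in> carrier W"
    then obtain u where u: "u \<in> carrier V" "x = f u" using pre by metis
    then show "\<zero>\<^bsub>W\<^esub> \<oplus>\<^bsub>W\<^esub> x = x" unfolding zero[symmetric] by (simp add: add)
    have "f (\<ominus>\<^bsub>V\<^esub> u) \<oplus>\<^bsub>W\<^esub> x = \<zero>\<^bsub>W\<^esub>"
      using u zero by (simp add: add V.M.l_neg)
    then show "\<exists>y\<in>carrier W. y \<oplus>\<^bsub>W\<^esub> x = \<zero>\<^bsub>W\<^esub>" using img[of "\<ominus>\<^bsub>V\<^esub> u"] u by auto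
  qed
  have "module R W"
  proof (rule moduleI[OF V.R.is_cring ab])
    fix a x assume "a \<in> carrier R" "x \<in> carrier W"
    moreover from this obtain u where "u \<in> carrier V" "x = f u" using pre by metis
    ultimately show "a \<odot>\<^bsub>W\<^esub> x \<in> carrier W" by (simp add: smult img)
  next
    fix a b x assume ab: "a \<in> carrier R" "b \<in> carrier R" "x \<in> carrier W"
    then obtain u where u: "u \<in> carrier V" "x = f u" using pre by metis
    then show "(a \<oplus>\<^bsub>R\<^esub> b) \<odot>\<^bsub>W\<^esub> x = a \<odot>\<^bsub>W\<^esub> x \<oplus>\<^bsub>W\<^esub> b \<odot>\<^bsub>W\<^esub> x"
      using ab by (simp add: smult add V.smult_l_distr)
    show "(a \<otimes>\<^bsub>R\<^esub> b) \<odot>\<^bsub>W\<^esub> x = a \<odot>\<^bsub>W\<^esub> (b \<odot>\<^bsub>W\<^esub> x)"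
      using ab u by (simp add: smult V.smult_assoc1)
  next
    fix a x y assume a: "a \<in> carrier R" "x \<in> carrier W" "y \<in> carrier W"
    then obtain u v where "u \<in> carrier V" "v \<in> carrier V" "x = f u" "y = f v" using pre by metis
    then show "a \<odot>\<^bsub>W\<^esub> (x \<oplus>\<^bsub>W\<^esub> y) = a \<odot>\<^bsub>W\<^esub> x \<oplus>\<^bsub>W\<^esub> a \<odot>\<^bsub>W\<^esub> y"
      using a by (simp add: smult add V.smult_r_distr)
  next
    fix x assume "x \<in> carrier W"
    then obtain u where "u \<in> carrier V" "x = f u" using pre by metis
    then show "\<one>\<^bsub>R\<^esub> \<odot>\<^bsub>W\<^esub> x = x" by (simp add: smult)
  qed
  then show ?thesis using V.field_axioms by (simp add: vectorspace_def)
qed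

lemma linear_mapI:
  "vectorspace R V \<Longrightarrow> vectorspace R W \<Longrightarrow> f \<in> module_hom R V W \<Longrightarrow> linear_map R V W f"
  by (simp add: linear_map_def mod_hom_def mod_hom_axioms_def vectorspace_def)

text \<open>
  Rank-nullity for \<open>T\<close> on the image of \<open>i\<close>, which has the dimension of
  \<open>V\<close>.
\<close>

lemma dim_kernel_in_image:
  assumes V: "vectorspace R V" "vectorspace.fin_dim R V" and W: "vectorspace R W" and X: "vectorspace R X"
    and i: "i \<in> module_hom R V W" "inj_on i (carrier V)" and T: "T \<in> module_hom R W X"
  shows "vectorspace.dim R (W\<lparr>carrier := i ` carrier V \<inter> {x \<in> carrier W. T x = \<zero>\<^bsub>X\<^esub>}\<rparr>)
    + vectorspace.dim R (X\<lparr>carrier := T ` i ` carrier V\<rparr>) = vectorspace.dim R V"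
proof -
  interpret V: vectorspace R V by (rule V(1))
  interpret W: vectorspace R W by (rule W)
  interpret X: vectorspace R X by (rule X)
  interpret i: linear_map R V W i by (rule linear_mapI[OF V(1) W i(1)])
  let ?U = "W\<lparr>carrier := i ` carrier V\<rparr>"
  have U: "vectorspace R ?U"
    using W.subspace_is_vs[OF i.imT_is_subspace] unfolding i.im_def .
  interpret U: vectorspace R ?U by (rule U)
  have i': "i \<in> module_hom R V ?U" using i(1) by (auto simp: module_hom_def)
  interpret iU: linear_map R V ?U i by (rule linear_mapI[OF V(1) U i'])
  have fd: "U.fin_dim" by (rule iU.surj_fin_dim[OF V(2)]) simp
  have dim: "V.dim = U.dim" by (rule iU.dim_eq[OF V(2) i(2)]) simp
  have T': "T \<in> module_hom R ?U X" using T i.f_im by (auto simp: module_hom_def)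
  interpret T: linear_map R ?U X T by (rule linear_mapI[OF U X T'])
  have "vectorspace.dim R (X\<lparr>carrier := T.im\<rparr>) + vectorspace.dim R (?U\<lparr>carrier := T.ker\<rparr>) = U.dim"
    by (rule T.rank_nullity[OF fd])
  moreover have "T.im = T ` i ` carrier V" by (simp add: T.im_def)
  moreover have "T.ker = i ` carrier V \<inter> {x \<in> carrier W. T x = \<zero>\<^bsub>X\<^esub>}"
    using i.f_im by (auto simp: T.ker_def)
  ultimately show ?thesis by (simp add: dim)
qed

text \<open>
  Values are determined upwards: a maximal element is removed, and its value is the one that makes
  the sum at this element correct without affecting the other sums.
\<close>

lemma moebius_inversion_exists:
  fixes Q :: "'q::order set" and m :: "'q \<Rightarrow> int"
  assumes "finite Q"
  shows "\<exists>f. \<forall>b\<in>Q. m b = (\<Sum>a\<in>{a\<in>Q. a \<le> b}. f a)"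
  using assms
proof (induction Q rule: finite_psubset_induct)
  case (psubset Q)
  show ?case
  proof (cases "Q = {}")
    case False
    then obtain t where t: "t \<in> Q" "\<And>b. b \<in> Q \<Longrightarrow> t \<le> b \<Longrightarrow> b = t"
      using finite_has_maximal[OF psubset.hyps] by metis
    then have "Q - {t} \<subset> Q" by auto
    from psubset.IH[OF this] obtain f where f: "\<forall>b\<in>Q - {t}. m b = (\<Sum>a\<in>{a\<in>Q - {t}. a \<le> b}. f a)" by blast
    let ?g = "f(t := m t - (\<Sum>a\<in>{a\<in>Q - {t}. a \<le> t}. f a))"
    have "m b = (\<Sum>a\<in>{a\<in>Q. a \<le> b}. ?g a)" if b: "b \<in> Q" for b
    proof (cases "b = t")
      case True
      have "{a\<in>Q. a \<le> t} = insert t {a\<in>Q - {t}. a \<le> t}" using t by auto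
      moreover have "(\<Sum>a\<in>{a\<in>Q - {t}. a \<le> t}. ?g a) = (\<Sum>a\<in>{a\<in>Q - {t}. a \<le> t}. f a)"
        by (rule sum.cong) auto
      ultimately show ?thesis using psubset.hyps by (simp add: True)
    next
      case False
      then have "{a\<in>Q. a \<le> b} = {a\<in>Q - {t}. a \<le> b}" using t b by auto
      moreover have "(\<Sum>a\<in>{a\<in>Q - {t}. a \<le> b}. ?g a) = (\<Sum>a\<in>{a\<in>Q - {t}. a \<le> b}. f a)"
        by (rule sum.cong) auto
      ultimately show ?thesis using f b False by simp
    qed
    then show ?thesis by (intro exI[of _ ?g]) blast
  qed simp
qed

text \<open>
  At a minimal element where two inversions differ, all other summands agree.
\<close>

lemma moebius_inversion_unique:
  fixes Q :: "'q::order set" and f g :: "'q \<Rightarrow> int"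
  assumes fin: "finite Q" and f: "\<forall>b\<in>Q. m b = (\<Sum>a\<in>{a\<in>Q. a \<le> b}. f a)"
    and g: "\<forall>b\<in>Q. m b = (\<Sum>a\<in>{a\<in>Q. a \<le> b}. g a)"
  shows "\<forall>b\<in>Q. f b = g b"
proof (rule ccontr)
  assume "\<not> ?thesis"
  then have "{b\<in>Q. f b \<noteq> g b} \<noteq> {}" by blast
  then obtain b where b: "b \<in> Q" "f b \<noteq> g b" and least: "\<And>a. a \<in> Q \<Longrightarrow> f a \<noteq> g a \<Longrightarrow> a \<le> b \<Longrightarrow> a = b"
    using finite_has_minimal[of "{b\<in>Q. f b \<noteq> g b}"] fin by auto
  let ?S = "{a\<in>Q. a \<le> b} - {b}"
  have split: "(\<Sum>a\<in>{a\<in>Q. a \<le> b}. h a) = h b + (\<Sum>a\<in>?S. h a)" for h :: "'q \<Rightarrow> int"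
    using fin b by (intro sum.remove) auto
  have "(\<Sum>a\<in>?S. f a) = (\<Sum>a\<in>?S. g a)" by (rule sum.cong) (use least in auto)
  moreover have "(\<Sum>a\<in>{a\<in>Q. a \<le> b}. f a) = (\<Sum>a\<in>{a\<in>Q. a \<le> b}. g a)"
    by (rule trans[OF sym[OF bspec[OF f b(1)]] bspec[OF g b(1)]])
  ultimately show False using b(2) unfolding split by simp
qed

lemma moebius_inversion_eqI:
  fixes Q :: "'q::order set"
  assumes fin: "finite Q" and f: "f \<in> extensional Q" "\<And>b. b \<in> Q \<Longrightarrow> m b = (\<Sum>a\<in>{a\<in>Q. a \<le> b}. f a)"
  shows "moebius_inversion Q m = f"
  unfolding moebius_inversion_def
proof (rule the_equality)
  fix g assume g: "g \<in> extensional Q \<and> (\<forall>b\<in>Q. m b = (\<Sum>a\<in>{a\<in>Q. a \<le> b}. g a))"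
  have "\<forall>b\<in>Q. g b = f b"
    by (rule moebius_inversion_unique[OF fin, of m]) (use f g in auto)
  then show "g = f" using f(1) g by (auto intro: extensionalityI)
qed (use f in auto)

lemma moebius_inversion_sum:
  fixes Q :: "'q::order set"
  assumes fin: "finite Q"
  shows "moebius_inversion Q m \<in> extensional Q"
    and "b \<in> Q \<Longrightarrow> m b = (\<Sum>a\<in>{a\<in>Q. a \<le> b}. moebius_inversion Q m a)"
proof -
  obtain f where f: "\<forall>b\<in>Q. m b = (\<Sum>a\<in>{a\<in>Q. a \<le> b}. f a)"
    using moebius_inversion_exists[OF fin] by blast
  have sc: "(\<Sum>a\<in>{a\<in>Q. a \<le> b}. restrict f Q a) = (\<Sum>a\<in>{a\<in>Q. a \<le> b}. f a)" for b
    by (rule sum.cong) auto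
  have eq: "moebius_inversion Q m = restrict f Q"
    by (rule moebius_inversion_eqI[OF fin]) (simp, unfold sc, rule bspec[OF f])
  show "moebius_inversion Q m \<in> extensional Q" by (simp add: eq)
  show "m b = (\<Sum>a\<in>{a\<in>Q. a \<le> b}. moebius_inversion Q m a)" if "b \<in> Q"
    unfolding eq sc by (rule bspec[OF f that])
qed

text \<open>
  The intervals \<open>[c,c]\<close> below \<open>[a,b]\<close> are those with \<open>c \<le>
  a\<close>. Hence putting the Moebius inversion of \<open>h\<close> on the diagonal and zero
  elsewhere inverts \<open>[a,b] \<mapsto> h a\<close>, and adding it to the inversion of
  \<open>m\<close> changes only diagonal values.
\<close>

lemma int_equiv_moebius_inversion:
  fixes m n :: "'p::{finite, order} \<times> 'p \<Rightarrow> int"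
  assumes mn: "\<And>a b. a \<le> b \<Longrightarrow> n (a, b) = m (a, b) + h a"
  shows "moebius_inversion Int_poset m \<sim>\<^sub>I moebius_inversion Int_poset n"
proof -
  let ?Q = "Int_poset :: ('p \<times> 'p) set"
  let ?f = "moebius_inversion ?Q m" and ?h = "moebius_inversion UNIV h"
  let ?g = "\<lambda>x\<in>?Q. ?f x + (if fst x = snd x then ?h (fst x) else 0)"
  have "moebius_inversion ?Q n = ?g"
  proof (rule moebius_inversion_eqI)
    fix b assume b: "b \<in> ?Q"
    obtain u v where uv: "b = (u, v)" "u \<le> v" using b by (auto simp: Int_poset_def)
    let ?S = "{a\<in>?Q. a \<le> b}"
    have "(\<Sum>a\<in>?S. if fst a = snd a then ?h (fst a) else 0) = (\<Sum>a\<in>{a\<in>?S. fst a = snd a}. ?h (fst a))"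
      by (rule sum.inter_filter[symmetric]) simp
    also have "{a\<in>?S. fst a = snd a} = (\<lambda>c. (c, c)) ` {c. c \<le> u}"
      using uv by (auto simp: Int_poset_def intro: order_trans)
    also have "(\<Sum>a\<in>(\<lambda>c. (c, c)) ` {c. c \<le> u}. ?h (fst a)) = (\<Sum>c\<in>{c. c \<le> u}. ?h c)"
      by (subst sum.reindex) (auto simp: inj_on_def)
    also have "\<dots> = h u" using moebius_inversion_sum(2)[of UNIV u h] by simp
    finally have "(\<Sum>a\<in>?S. ?f a + (if fst a = snd a then ?h (fst a) else 0)) = m b + h u"
      using moebius_inversion_sum(2)[of ?Q b m] b by (simp add: sum.distrib)
    moreover have "(\<Sum>a\<in>?S. ?g a) = (\<Sum>a\<in>?S. ?f a + (if fst a = snd a then ?h (fst a) else 0))"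
      by (rule sum.cong) auto
    ultimately show "n b = (\<Sum>a\<in>?S. ?g a)" using mn uv by simp
  qed auto
  then show ?thesis by (auto simp: int_equiv_def Int_poset_def less_le)
qed

section \<open>Simplicial cochains as functionals\<close>

lemma vectorspace_fun_space: "vectorspace class_ring (fun_space S :: ('f::field, 'x \<Rightarrow> 'f) module)"
proof -
  have "Module.module class_ring (fun_space S :: ('f, 'x \<Rightarrow> 'f) module)"
    by (rule class_cring.func_space_is_module)
  then show ?thesis using class_field.field_axioms by (rule vectorspace.intro)
qed

lemma submodule_linear_subset:
  fixes W :: "('x \<Rightarrow> 'f::field) set"
  assumes W: "linear_subset S W" "linear_subset S V" and sub: "W \<subseteq> V"
  shows "LinearCombinations.submodule class_ring W ((fun_space S :: ('f, 'x \<Rightarrow> 'f) module)\<lparr>carrier := V\<rparr>)"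
    and "vectorspace class_ring ((fun_space S :: ('f, 'x \<Rightarrow> 'f) module)\<lparr>carrier := V\<rparr>)"
proof -
  interpret vectorspace class_ring "fun_space S :: ('f, 'x \<Rightarrow> 'f) module" by (rule vectorspace_fun_space)
  have "LinearCombinations.submodule class_ring V (fun_space S :: ('f, 'x \<Rightarrow> 'f) module)"
    using linear_subset.extensional[OF W(2)] linear_subset.zero[OF W(2)] linear_subset.add[OF W(2)]
      linear_subset.smult[OF W(2)]
    by (intro submodule.intro) (auto intro: module_axioms)
  then have "VectorSpace.subspace class_ring V (fun_space S :: ('f, 'x \<Rightarrow> 'f) module)"
    using vectorspace_axioms by (simp add: VectorSpace.subspace_def)
  from subspace_is_vs[OF this]
  show vs: "vectorspace class_ring ((fun_space S :: ('f, 'x \<Rightarrow> 'f) module)\<lparr>carrier := V\<rparr>)" .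
  then interpret V: vectorspace class_ring "(fun_space S :: ('f, 'x \<Rightarrow> 'f) module)\<lparr>carrier := V\<rparr>" .
  show "LinearCombinations.submodule class_ring W ((fun_space S :: ('f, 'x \<Rightarrow> 'f) module)\<lparr>carrier := V\<rparr>)"
    using sub linear_subset.zero[OF W(1)] linear_subset.add[OF W(1)] linear_subset.smult[OF W(1)]
    by (intro submodule.intro) (auto intro: V.module_axioms)
qed

definition unit_chain :: "'v set \<Rightarrow> 'v set \<Rightarrow> 'f::field"
  where "unit_chain \<sigma> = (\<lambda>\<tau>. if \<tau> = \<sigma> then 1 else 0)"

text \<open>
  Cochains are functionals on chains; \<open>coefficients\<close> and \<open>functional\<close>
  translate between them and functions on simplices, for which \<open>simplicial_coboundary\<close>
  is available.
\<close>

definition coefficients :: "nat \<Rightarrow> 'v set set \<Rightarrow> (('v set \<Rightarrow> 'f::field) \<Rightarrow> 'f) \<Rightarrow> 'v set \<Rightarrow> 'f"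
  where "coefficients d A \<phi> \<sigma> = (if \<sigma> \<in> A \<and> card \<sigma> = Suc d then \<phi> (unit_chain \<sigma>) else 0)"

definition functional :: "nat \<Rightarrow> 'v set set \<Rightarrow> ('v set \<Rightarrow> 'f::field) \<Rightarrow> ('v set \<Rightarrow> 'f) \<Rightarrow> 'f"
  where "functional d A c = (\<lambda>x\<in>chains d A. \<Sum>\<sigma>\<in>A. c \<sigma> * x \<sigma>)"

lemma unit_chain_in [simp]: "\<sigma> \<in> A \<Longrightarrow> card \<sigma> = Suc d \<Longrightarrow> unit_chain \<sigma> \<in> chains d A"
  by (auto simp: unit_chain_def chains_def)

lemma chains_add: "x \<in> chains d A \<Longrightarrow> y \<in> chains d A \<Longrightarrow> (\<lambda>\<sigma>. x \<sigma> + y \<sigma>) \<in> chains d A"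
  unfolding chains_def by (clarsimp, metis add.right_neutral)

lemma chains_smult: "x \<in> chains d A \<Longrightarrow> (\<lambda>\<sigma>. k * x \<sigma>) \<in> chains d A"
  unfolding chains_def by auto

lemma supported_coefficients: "supported A d (coefficients d A \<phi>)"
  by (auto simp: supported_def coefficients_def)

lemma cochain_add: "\<phi> \<in> cochains d A \<Longrightarrow> x \<in> chains d A \<Longrightarrow> y \<in> chains d A \<Longrightarrow> \<phi> (\<lambda>\<sigma>. x \<sigma> + y \<sigma>) = \<phi> x + \<phi> y"
  and cochain_smult: "\<phi> \<in> cochains d A \<Longrightarrow> x \<in> chains d A \<Longrightarrow> \<phi> (\<lambda>\<sigma>. k * x \<sigma>) = k * \<phi> x"
  and cochain_extensional: "\<phi> \<in> cochains d A \<Longrightarrow> \<phi> \<in> extensional (chains d A)"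
  by (simp_all add: cochains_def)

lemma functional_coefficients:
  fixes \<phi> :: "('v set \<Rightarrow> 'f::field) \<Rightarrow> 'f"
  assumes A: "finite A" and \<phi>: "\<phi> \<in> cochains d A"
  shows "functional d A (coefficients d A \<phi>) = \<phi>"
proof (rule extensionalityI)
  show "functional d A (coefficients d A \<phi>) \<in> extensional (chains d A)" by (simp add: functional_def)
  show "\<phi> \<in> extensional (chains d A)" using \<phi> by (rule cochain_extensional)
  fix x :: "'v set \<Rightarrow> 'f" assume x: "x \<in> chains d A"
  have part: "(\<lambda>\<tau>. if \<tau> \<in> B then x \<tau> else 0) \<in> chains d A \<and>
      \<phi> (\<lambda>\<tau>. if \<tau> \<in> B then x \<tau> else 0) = (\<Sum>\<sigma>\<in>B. x \<sigma> * \<phi> (unit_chain \<sigma>))"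
    if "finite B" "B \<subseteq> {\<sigma>\<in>A. card \<sigma> = Suc d}" for B
    using that
  proof (induction B rule: finite_induct)
    case empty
    have z: "(\<lambda>\<tau>. 0) \<in> chains d A" by (simp add: chains_def)
    have "\<phi> (\<lambda>\<tau>. 0 * 0) = 0 * \<phi> (\<lambda>\<tau>. 0)" by (rule cochain_smult[OF \<phi> z])
    with z show ?case by simp
  next
    case (insert \<sigma> B)
    have u: "unit_chain \<sigma> \<in> chains d A" using insert.prems by simp
    have eq: "(\<lambda>\<tau>. if \<tau> \<in> insert \<sigma> B then x \<tau> else 0)
        = (\<lambda>\<tau>. x \<sigma> * unit_chain \<sigma> \<tau> + (if \<tau> \<in> B then x \<tau> else 0))"
      using insert.hyps by (auto simp: unit_chain_def fun_eq_iff)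
    note IH = insert.IH[OF order_trans[OF subset_insertI insert.prems]]
    show ?case
      unfolding eq using insert.hyps IH chains_add[OF chains_smult[OF u, of "x \<sigma>"] conjunct1[OF IH]]
      by (simp add: cochain_add[OF \<phi> chains_smult[OF u]] cochain_smult[OF \<phi> u])
  qed
  let ?B = "{\<sigma>\<in>A. card \<sigma> = Suc d}"
  have "(\<lambda>\<tau>. if \<tau> \<in> ?B then x \<tau> else 0) = x"
    using x by (auto simp: chains_def fun_eq_iff)
  then have "\<phi> x = (\<Sum>\<sigma>\<in>?B. x \<sigma> * \<phi> (unit_chain \<sigma>))"
    using part[of ?B] A by simp
  also have "\<dots> = (\<Sum>\<sigma>\<in>A. coefficients d A \<phi> \<sigma> * x \<sigma>)"
    using A by (intro sum.mono_neutral_cong_left) (auto simp: coefficients_def)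
  finally show "functional d A (coefficients d A \<phi>) x = \<phi> x" using x by (simp add: functional_def)
qed

lemma functional_cochain: "functional d A c \<in> cochains d A"
  by (auto simp: cochains_def functional_def chains_add chains_smult distrib_left sum.distrib sum_distrib_left
      mult.left_commute)

lemma coefficients_functional:
  assumes A: "finite A" and c: "supported A d c"
  shows "coefficients d A (functional d A c) = c"
proof
  fix \<sigma>
  show "coefficients d A (functional d A c) \<sigma> = c \<sigma>"
  proof (cases "\<sigma> \<in> A \<and> card \<sigma> = Suc d")
    case True
    have "(\<Sum>\<tau>\<in>A. c \<tau> * unit_chain \<sigma> \<tau>) = (\<Sum>\<tau>\<in>A. if \<tau> = \<sigma> then c \<sigma> else 0)"
      by (rule sum.cong) (simp_all add: unit_chain_def)
    then show ?thesis using True A by (simp add: coefficients_def functional_def)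
  next
    case False
    then have "c \<sigma> = 0" using c unfolding supported_def by blast
    then show ?thesis using False by (auto simp: coefficients_def)
  qed
qed

lemma cochain_eqI:
  assumes "finite A" "\<phi> \<in> cochains d A" "\<psi> \<in> cochains d A" "coefficients d A \<phi> = coefficients d A \<psi>"
  shows "\<phi> = \<psi>"
  by (rule trans[OF sym[OF functional_coefficients[OF assms(1,2)], unfolded assms(4)] functional_coefficients[OF assms(1,3)]])

lemma boundary_chains:
  fixes x :: "'v::linorder set \<Rightarrow> 'f::field"
  assumes x: "x \<in> chains (Suc d) A"
  shows "boundary A x \<in> chains d A"
  unfolding chains_def
proof (clarify)
  fix \<sigma> :: "'v set" assume nz: "boundary A x \<sigma> \<noteq> 0"
  then have "\<sigma> \<in> A" by (auto simp: boundary_def split: if_splits)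
  moreover have "card \<sigma> = Suc d"
  proof (rule ccontr)
    assume ne: "card \<sigma> \<noteq> Suc d"
    have "(if \<tau> - {v} = \<sigma> then (-1) ^ card {u\<in>\<tau>. u < v} * x \<tau> else 0) = 0" if "v \<in> \<tau>" for \<tau> v
    proof -
      have "x \<tau> = 0" if "\<tau> - {v} = \<sigma>"
      proof (rule ccontr)
        assume "x \<tau> \<noteq> 0"
        then have "card \<tau> = Suc (Suc d)" using x by (auto simp: chains_def)
        then have "card (\<tau> - {v}) = Suc d" using \<open>v \<in> \<tau>\<close> by (simp add: card_Diff_singleton)
        then show False using that ne by simp
      qed
      then show ?thesis by auto
    qed
    then have "boundary A x \<sigma> = 0" by (auto simp: boundary_def intro!: sum.neutral)
    with nz show False by simp
  qed
  ultimately show "\<sigma> \<in> A \<and> card \<sigma> = Suc d" ..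
qed

text \<open>
  The coboundary of functionals is the transpose of the boundary operator. Exchanging the sums gives
  each \<open>\<tau>\<close> its alternating sum over faces; faces outside \<open>A\<close>
  contribute nothing on either side, as \<open>c\<close> is supported on \<open>A\<close>.
\<close>

lemma functional_boundary:
  fixes c :: "'v::linorder set \<Rightarrow> 'f::field"
  assumes A: "finite A" "\<And>\<tau>. \<tau> \<in> A \<Longrightarrow> finite \<tau>" and c: "supported A d c" and x: "x \<in> chains (Suc d) A"
  shows "functional d A c (boundary A x) = (\<Sum>\<tau>\<in>A. simplicial_coboundary c \<tau> * x \<tau>)"
proof -
  let ?t = "\<lambda>\<tau> v \<sigma>. if \<tau> - {v} = \<sigma> then (-1) ^ card {u\<in>\<tau>. u < v} * x \<tau> else 0"
  have "functional d A c (boundary A x) = (\<Sum>\<sigma>\<in>A. c \<sigma> * (\<Sum>\<tau>\<in>A. \<Sum>v\<in>\<tau>. ?t \<tau> v \<sigma>))"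
    using boundary_chains[OF x] by (simp add: functional_def boundary_def)
  also have "\<dots> = (\<Sum>\<sigma>\<in>A. \<Sum>\<tau>\<in>A. \<Sum>v\<in>\<tau>. c \<sigma> * ?t \<tau> v \<sigma>)"
    by (simp only: sum_distrib_left)
  also have "\<dots> = (\<Sum>\<tau>\<in>A. \<Sum>\<sigma>\<in>A. \<Sum>v\<in>\<tau>. c \<sigma> * ?t \<tau> v \<sigma>)"
    by (rule sum.swap)
  also have "\<dots> = (\<Sum>\<tau>\<in>A. \<Sum>v\<in>\<tau>. \<Sum>\<sigma>\<in>A. c \<sigma> * ?t \<tau> v \<sigma>)"
    by (rule sum.cong[OF refl]) (rule sum.swap)
  also have "\<dots> = (\<Sum>\<tau>\<in>A. \<Sum>v\<in>\<tau>. c (\<tau> - {v}) * ((-1) ^ card {u\<in>\<tau>. u < v} * x \<tau>))"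
  proof (intro sum.cong refl)
    fix \<tau> v
    have "(\<Sum>\<sigma>\<in>A. c \<sigma> * ?t \<tau> v \<sigma>) = (\<Sum>\<sigma>\<in>A. if \<tau> - {v} = \<sigma> then c (\<tau> - {v}) * ((-1) ^ card {u\<in>\<tau>. u < v} * x \<tau>) else 0)"
      by (rule sum.cong) auto
    also have "\<dots> = (if \<tau> - {v} \<in> A then c (\<tau> - {v}) * ((-1) ^ card {u\<in>\<tau>. u < v} * x \<tau>) else 0)"
      by (rule sum.delta'[OF A(1)])
    also have "\<dots> = c (\<tau> - {v}) * ((-1) ^ card {u\<in>\<tau>. u < v} * x \<tau>)"
      using c by (auto simp: supported_def)
    finally show "(\<Sum>\<sigma>\<in>A. c \<sigma> * ?t \<tau> v \<sigma>) = c (\<tau> - {v}) * ((-1) ^ card {u\<in>\<tau>. u < v} * x \<tau>)" .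
  qed
  also have "\<dots> = (\<Sum>\<tau>\<in>A. simplicial_coboundary c \<tau> * x \<tau>)"
    unfolding simplicial_coboundary_def sum_distrib_right
    by (intro sum.cong refl) (simp add: sign_act_mult)
  finally show ?thesis .
qed

lemma coboundary_eval:
  fixes \<phi> :: "('v::linorder set \<Rightarrow> 'f::field) \<Rightarrow> 'f"
  assumes A: "finite A" "\<And>\<tau>. \<tau> \<in> A \<Longrightarrow> finite \<tau>" and \<phi>: "\<phi> \<in> cochains d A" and x: "x \<in> chains (Suc d) A"
  shows "coboundary d A \<phi> x = (\<Sum>\<tau>\<in>A. simplicial_coboundary (coefficients d A \<phi>) \<tau> * x \<tau>)"
  using functional_boundary[OF A supported_coefficients[of A d \<phi>] x] x
  by (simp add: coboundary_def functional_coefficients[OF A(1) \<phi>])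

lemma coboundary_unit:
  fixes \<phi> :: "('v::linorder set \<Rightarrow> 'f::field) \<Rightarrow> 'f"
  assumes A: "finite A" "\<And>\<tau>. \<tau> \<in> A \<Longrightarrow> finite \<tau>" and \<phi>: "\<phi> \<in> cochains d A"
    and \<tau>: "\<tau> \<in> A" "card \<tau> = Suc (Suc d)"
  shows "coboundary d A \<phi> (unit_chain \<tau>) = simplicial_coboundary (coefficients d A \<phi>) \<tau>"
proof -
  have "(\<Sum>\<sigma>\<in>A. simplicial_coboundary (coefficients d A \<phi>) \<sigma> * unit_chain \<tau> \<sigma>)
     = (\<Sum>\<sigma>\<in>A. if \<sigma> = \<tau> then simplicial_coboundary (coefficients d A \<phi>) \<tau> else 0)"
    by (rule sum.cong) (auto simp: unit_chain_def)
  then show ?thesis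
    using A \<tau> by (simp add: coboundary_eval[OF A \<phi>])
qed

lemma cocycles_iff:
  fixes \<phi> :: "('v::linorder set \<Rightarrow> 'f::field) \<Rightarrow> 'f"
  assumes A: "finite A" "\<And>\<tau>. \<tau> \<in> A \<Longrightarrow> finite \<tau>"
  shows "\<phi> \<in> cocycles d A \<longleftrightarrow> \<phi> \<in> cochains d A \<and>
    (\<forall>\<tau>\<in>A. card \<tau> = Suc (Suc d) \<longrightarrow> simplicial_coboundary (coefficients d A \<phi>) \<tau> = 0)"
proof (intro iffI conjI ballI impI)
  assume \<phi>: "\<phi> \<in> cocycles d A"
  then show c: "\<phi> \<in> cochains d A" by (simp add: cocycles_def)
  fix \<tau> assume \<tau>: "\<tau> \<in> A" "card \<tau> = Suc (Suc d)"
  have eq: "coboundary d A \<phi> = (\<lambda>x\<in>chains (Suc d) A. 0)" using \<phi> by (simp add: cocycles_def)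
  have "coboundary d A \<phi> (unit_chain \<tau>) = 0" unfolding eq using \<tau> by simp
  then show "simplicial_coboundary (coefficients d A \<phi>) \<tau> = 0"
    by (simp only: coboundary_unit[OF A c \<tau>])
next
  assume c: "\<phi> \<in> cochains d A \<and>
    (\<forall>\<tau>\<in>A. card \<tau> = Suc (Suc d) \<longrightarrow> simplicial_coboundary (coefficients d A \<phi>) \<tau> = 0)"
  have "coboundary d A \<phi> x = 0" if x: "x \<in> chains (Suc d) A" for x :: "'v set \<Rightarrow> 'f"
  proof -
    have "(\<Sum>\<tau>\<in>A. simplicial_coboundary (coefficients d A \<phi>) \<tau> * x \<tau>) = 0"
    proof (rule sum.neutral, rule ballI)
      fix \<tau> assume "\<tau> \<in> A"
      then show "simplicial_coboundary (coefficients d A \<phi>) \<tau> * x \<tau> = 0"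
        using c x by (cases "x \<tau> = 0") (auto simp: chains_def)
    qed
    then show ?thesis by (simp only: coboundary_eval[OF A conjunct1[OF c] x])
  qed
  then have "coboundary d A \<phi> = (\<lambda>x\<in>chains (Suc d) A. 0)"
    by (intro extensionalityI[where A = "chains (Suc d) A"]) (auto simp: coboundary_def)
  with c show "\<phi> \<in> cocycles d A" by (simp add: cocycles_def)
qed

lemma coboundary_cochain:
  fixes \<phi> :: "('v::linorder set \<Rightarrow> 'f::field) \<Rightarrow> 'f"
  assumes A: "finite A" "\<And>\<tau>. \<tau> \<in> A \<Longrightarrow> finite \<tau>" and \<phi>: "\<phi> \<in> cochains d A"
  shows "coboundary d A \<phi> \<in> cochains (Suc d) A"
proof -
  have "coboundary d A \<phi> = functional (Suc d) A (simplicial_coboundary (coefficients d A \<phi>))"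
  proof (rule extensionalityI[where A = "chains (Suc d) A"])
    show "coboundary d A \<phi> \<in> extensional (chains (Suc d) A)" by (simp add: coboundary_def)
  qed (simp_all add: coboundary_eval[OF A \<phi>] functional_def)
  then show ?thesis by (simp add: functional_cochain)
qed

text \<open>
  One formulation for all degrees: in degree zero only the zero cochain is a coboundary, and
  \<open>b\<close> is unconstrained.
\<close>

lemma coboundaries_iff:
  fixes \<phi> :: "('v::linorder set \<Rightarrow> 'f::field) \<Rightarrow> 'f"
  assumes A: "finite A" "\<And>\<tau>. \<tau> \<in> A \<Longrightarrow> finite \<tau>" and \<phi>: "\<phi> \<in> cochains d A"
  shows "\<phi> \<in> coboundaries d A \<longleftrightarrow> (\<exists>b. (\<forall>q. d = Suc q \<longrightarrow> supported A q b) \<and>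
     (\<forall>\<tau>\<in>A. card \<tau> = Suc d \<longrightarrow> coefficients d A \<phi> \<tau> = (if d = 0 then 0 else simplicial_coboundary b \<tau>)))"
proof (cases d)
  case 0
  have "\<phi> = (\<lambda>x\<in>chains 0 A. 0) \<longleftrightarrow> coefficients 0 A \<phi> = (\<lambda>_. 0)"
  proof
    assume "coefficients 0 A \<phi> = (\<lambda>_. 0)"
    then show "\<phi> = (\<lambda>x\<in>chains 0 A. 0)"
      using functional_coefficients[OF A(1) \<phi>] by (simp add: 0 functional_def)
  qed (auto simp: coefficients_def fun_eq_iff)
  also have "\<dots> \<longleftrightarrow> (\<forall>\<tau>\<in>A. card \<tau> = Suc 0 \<longrightarrow> coefficients 0 A \<phi> \<tau> = 0)"
    by (auto simp: coefficients_def fun_eq_iff)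
  finally show ?thesis by (simp add: 0 coboundaries_def)
next
  case (Suc e)
  have coef: "coefficients d A (coboundary e A \<psi>) \<tau> = simplicial_coboundary (coefficients e A \<psi>) \<tau>"
    if "\<psi> \<in> cochains e A" "\<tau> \<in> A" "card \<tau> = Suc d" for \<psi> \<tau>
    using coboundary_unit[OF A that(1,2)] that by (simp add: coefficients_def Suc)
  show ?thesis
  proof
    assume "\<phi> \<in> coboundaries d A"
    then obtain \<psi> where "\<psi> \<in> cochains e A" "\<phi> = coboundary e A \<psi>" by (auto simp: coboundaries_def Suc)
    then show "\<exists>b. (\<forall>q. d = Suc q \<longrightarrow> supported A q b) \<and>
       (\<forall>\<tau>\<in>A. card \<tau> = Suc d \<longrightarrow> coefficients d A \<phi> \<tau> = (if d = 0 then 0 else simplicial_coboundary b \<tau>))"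
      using coef by (intro exI[of _ "coefficients e A \<psi>"]) (auto simp: Suc supported_coefficients)
  next
    assume "\<exists>b. (\<forall>q. d = Suc q \<longrightarrow> supported A q b) \<and>
       (\<forall>\<tau>\<in>A. card \<tau> = Suc d \<longrightarrow> coefficients d A \<phi> \<tau> = (if d = 0 then 0 else simplicial_coboundary b \<tau>))"
    then obtain b where b: "supported A e b"
      and eq: "\<And>\<tau>. \<tau> \<in> A \<Longrightarrow> card \<tau> = Suc d \<Longrightarrow> coefficients d A \<phi> \<tau> = simplicial_coboundary b \<tau>"
      by (auto simp: Suc)
    let ?\<psi> = "functional e A b"
    have \<psi>: "?\<psi> \<in> cochains e A" by (rule functional_cochain)
    have "coefficients d A \<phi> = coefficients d A (coboundary e A ?\<psi>)"
    proof
      fix \<tau>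
      show "coefficients d A \<phi> \<tau> = coefficients d A (coboundary e A ?\<psi>) \<tau>"
      proof (cases "\<tau> \<in> A \<and> card \<tau> = Suc d")
        case True
        then show ?thesis
          using coef[OF \<psi>] eq by (simp add: coefficients_functional[OF A(1) b])
      qed (auto simp: coefficients_def)
    qed
    then have "\<phi> = coboundary e A ?\<psi>"
      using coboundary_cochain[OF A \<psi>] \<phi>
      by (intro cochain_eqI[OF A(1)]) (simp_all add: Suc)
    then show "\<phi> \<in> coboundaries d A" using \<psi> by (simp add: coboundaries_def Suc)
  qed
qed

lemma module_homI:
  assumes "\<And>x. x \<in> carrier M \<Longrightarrow> f x \<in> carrier N"
    and "\<And>x y. x \<in> carrier M \<Longrightarrow> y \<in> carrier M \<Longrightarrow> f (x \<oplus>\<^bsub>M\<^esub> y) = f x \<oplus>\<^bsub>N\<^esub> f y"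
    and "\<And>r x. r \<in> carrier R \<Longrightarrow> x \<in> carrier M \<Longrightarrow> f (r \<odot>\<^bsub>M\<^esub> x) = r \<odot>\<^bsub>N\<^esub> f x"
  shows "f \<in> module_hom R M N"
  using assms by (simp add: module_hom_def Pi_def)

lemma cocycles_alt:
  fixes \<phi> :: "('v::linorder set \<Rightarrow> 'f::field) \<Rightarrow> 'f"
  shows "\<phi> \<in> cocycles d A \<longleftrightarrow> \<phi> \<in> cochains d A \<and> (\<forall>x\<in>chains (Suc d) A. \<phi> (boundary A x) = 0)"
  by (auto simp: cocycles_def coboundary_def restrict_def fun_eq_iff)

lemma linear_subset_simplicial_cochains:
  "linear_subset (chains d A) (cochains d A :: (('v set \<Rightarrow> 'f::field) \<Rightarrow> 'f) set)"
proof (rule linear_subset.intro)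
  show "f \<in> extensional (chains d A)" if "f \<in> cochains d A" for f :: "('v set \<Rightarrow> 'f) \<Rightarrow> 'f"
    using that by (rule cochain_extensional)
  show "(\<lambda>x\<in>chains d A. 0 :: 'f) \<in> cochains d A"
    by (simp add: cochains_def chains_add chains_smult)
  show "(\<lambda>x\<in>chains d A. f x + g x) \<in> cochains d A"
    if "f \<in> cochains d A" "g \<in> cochains d A" for f g :: "('v set \<Rightarrow> 'f) \<Rightarrow> 'f"
    using that by (simp add: cochains_def chains_add chains_smult algebra_simps)
  show "(\<lambda>x\<in>chains d A. c * f x) \<in> cochains d A"
    if "f \<in> cochains d A" for f :: "('v set \<Rightarrow> 'f) \<Rightarrow> 'f" and c
    using that by (simp add: cochains_def chains_add chains_smult algebra_simps)
qed

lemma linear_subset_simplicial_cocycles: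
  "linear_subset (chains d A) (cocycles d A :: (('v::linorder set \<Rightarrow> 'f::field) \<Rightarrow> 'f) set)"
proof (rule linear_subset.intro)
  note L = linear_subset_simplicial_cochains[of d A, where 'f = 'f]
  show "f \<in> extensional (chains d A)" if "f \<in> cocycles d A" for f :: "('v set \<Rightarrow> 'f) \<Rightarrow> 'f"
    using that by (intro cochain_extensional) (simp add: cocycles_alt)
  show "(\<lambda>x\<in>chains d A. 0 :: 'f) \<in> cocycles d A"
    using linear_subset.zero[OF L] by (simp add: cocycles_alt boundary_chains)
  show "(\<lambda>x\<in>chains d A. f x + g x) \<in> cocycles d A"
    if "f \<in> cocycles d A" "g \<in> cocycles d A" for f g :: "('v set \<Rightarrow> 'f) \<Rightarrow> 'f"
    using that linear_subset.add[OF L, of f g] by (simp add: cocycles_alt boundary_chains)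
  show "(\<lambda>x\<in>chains d A. c * f x) \<in> cocycles d A"
    if "f \<in> cocycles d A" for f :: "('v set \<Rightarrow> 'f) \<Rightarrow> 'f" and c
    using that linear_subset.smult[OF L, of f c] by (simp add: cocycles_alt boundary_chains)
qed

lemma cocycle_cochain: "\<phi> \<in> cocycles d A \<Longrightarrow> \<phi> \<in> cochains d A"
  by (simp add: cocycles_def)

abbreviation cocycle_space :: "nat \<Rightarrow> 'v::linorder set set \<Rightarrow> ('f::field, ('v set \<Rightarrow> 'f) \<Rightarrow> 'f) module"
  where "cocycle_space d A \<equiv> (fun_space (chains d A))\<lparr>carrier := cocycles d A\<rparr>"

text \<open>
  The cochains are a linear image of the space of vectors indexed by the simplices of
  \<open>A\<close>, and the cocycles form a subspace.
\<close>

lemma fin_dim_cocycle_space: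
  fixes A :: "'v::linorder set set"
  assumes A: "finite A"
  shows "vectorspace class_ring (cocycle_space d A :: ('f::field, _) module)"
    and "vectorspace.fin_dim class_ring (cocycle_space d A :: ('f::field, _) module)"
proof -
  let ?C = "(fun_space (chains d A) :: ('f, _) module)\<lparr>carrier := cochains d A\<rparr>"
  note Lc = linear_subset_simplicial_cochains[of d A, where 'f = 'f]
    and Lz = linear_subset_simplicial_cocycles[of d A, where 'f = 'f]
  have sub: "cocycles d A \<subseteq> (cochains d A :: (('v set \<Rightarrow> 'f) \<Rightarrow> 'f) set)" by (auto simp: cocycles_def)
  show "vectorspace class_ring (cocycle_space d A :: ('f::field, _) module)"
    by (rule submodule_linear_subset(2)[OF Lz Lz order_refl])
  interpret C: vectorspace class_ring ?C by (rule submodule_linear_subset(2)[OF Lc Lc order_refl])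
  obtain e where e: "bij_betw e {0..<card A} A" using ex_bij_betw_nat_finite[OF A] by blast
  let ?T = "\<lambda>v. \<lambda>x\<in>chains d A. \<Sum>i\<in>{0..<card A}. vec_index v i * x (e i) :: 'f"
  have T: "?T v \<in> cochains d A" for v
    by (auto simp: cochains_def chains_add chains_smult distrib_left sum.distrib sum_distrib_left mult.left_commute)
  interpret V: vec_space "TYPE('f)" "card A" .
  have vs: "vectorspace class_ring (module_vec TYPE('f) (card A))" by (rule vec_vs)
  have hom: "?T \<in> module_hom class_ring (module_vec TYPE('f) (card A)) ?C"
  proof (rule module_homI)
    show "?T v \<in> carrier ?C" for v using T by simp
  next
    fix v w :: "'f Matrix.vec"
    assume "v \<in> carrier (module_vec TYPE('f) (card A))" "w \<in> carrier (module_vec TYPE('f) (card A))"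
    then have "dim_vec w = card A" by (simp add: module_vec_simps)
    then have "(\<Sum>i\<in>{0..<card A}. vec_index (v + w) i * x (e i))
        = (\<Sum>i\<in>{0..<card A}. vec_index v i * x (e i)) + (\<Sum>i\<in>{0..<card A}. vec_index w i * x (e i))" for x
      unfolding sum.distrib[symmetric] by (intro sum.cong) (simp_all add: distrib_right)
    then show "?T (v \<oplus>\<^bsub>module_vec TYPE('f) (card A)\<^esub> w) = ?T v \<oplus>\<^bsub>?C\<^esub> ?T w"
      by (simp add: module_vec_simps cong: restrict_cong)
  next
    fix k :: 'f and v :: "'f Matrix.vec"
    assume "v \<in> carrier (module_vec TYPE('f) (card A))"
    then have "dim_vec v = card A" by (simp add: module_vec_simps)
    then have "(\<Sum>i\<in>{0..<card A}. vec_index (k \<cdot>\<^sub>v v) i * x (e i)) = k * (\<Sum>i\<in>{0..<card A}. vec_index v i * x (e i))" for x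
      unfolding sum_distrib_left by (intro sum.cong) (simp_all add: mult.assoc)
    then show "?T (k \<odot>\<^bsub>module_vec TYPE('f) (card A)\<^esub> v) = k \<odot>\<^bsub>?C\<^esub> ?T v"
      by (simp add: module_vec_simps cong: restrict_cong)
  qed
  interpret T: linear_map class_ring "module_vec TYPE('f) (card A)" ?C ?T
    by (rule linear_mapI[OF vs C.vectorspace_axioms hom])
  have "?T ` carrier (module_vec TYPE('f) (card A)) = carrier ?C"
  proof
    show "?T ` carrier (module_vec TYPE('f) (card A)) \<subseteq> carrier ?C" using T by auto
    show "carrier ?C \<subseteq> ?T ` carrier (module_vec TYPE('f) (card A))"
    proof
      fix \<phi> assume "\<phi> \<in> carrier ?C"
      then have \<phi>: "\<phi> \<in> cochains d A" by simp
      let ?v = "Matrix.vec (card A) (\<lambda>i. coefficients d A \<phi> (e i))"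
      have "functional d A (coefficients d A \<phi>) = ?T ?v"
        unfolding functional_def
      proof (rule restrict_ext)
        fix x
        have "(\<Sum>\<sigma>\<in>A. coefficients d A \<phi> \<sigma> * x \<sigma>) = (\<Sum>i\<in>{0..<card A}. coefficients d A \<phi> (e i) * x (e i))"
          by (rule sum.reindex_bij_betw[OF e, symmetric])
        also have "\<dots> = (\<Sum>i\<in>{0..<card A}. vec_index ?v i * x (e i))"
          by (rule sum.cong) auto
        finally show "(\<Sum>\<sigma>\<in>A. coefficients d A \<phi> \<sigma> * x \<sigma>) = (\<Sum>i\<in>{0..<card A}. vec_index ?v i * x (e i))" .
      qed
      then have "\<phi> = ?T ?v" by (simp only: functional_coefficients[OF A \<phi>])
      moreover have "?v \<in> carrier (module_vec TYPE('f) (card A))" by (simp add: module_vec_simps)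
      ultimately show "\<phi> \<in> ?T ` carrier (module_vec TYPE('f) (card A))" by (rule image_eqI)
    qed
  qed
  from T.surj_fin_dim[OF V.fin_dim this] have fd: "C.fin_dim" .
  have "vectorspace.fin_dim class_ring (?C\<lparr>carrier := cocycles d A\<rparr>)"
    by (rule C.fin_dim_subspace[OF fd submodule_linear_subset(1)[OF Lz Lc sub]])
  then show "vectorspace.fin_dim class_ring (cocycle_space d A :: ('f::field, _) module)" by simp
qed

text \<open>
  All faces of a simplex outside a supcomplex are outside too. So a cochain of \<open>A\<close> is a
  cocycle iff its extension by zero is a cocycle of \<open>K\<close>.
\<close>

lemma coboundary_outside_supcomplex:
  fixes c :: "'v::linorder set \<Rightarrow> 'f::field"
  assumes A: "supcomplex K A" and c: "supported A p c" and \<tau>: "\<tau> \<in> K" "\<tau> \<notin> A"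
  shows "simplicial_coboundary c \<tau> = 0"
proof -
  have "c (\<tau> - {v}) = 0" for v
  proof (rule ccontr)
    assume "c (\<tau> - {v}) \<noteq> 0"
    then have "\<tau> - {v} \<in> A" using c by (simp add: supported_def)
    then show False using A \<tau> unfolding supcomplex_def by blast
  qed
  then show ?thesis unfolding simplicial_coboundary_def by (simp add: sign_act_def)
qed

lemma chain_projection_chains: "x \<in> chains d B \<Longrightarrow> chain_projection A x \<in> chains d A"
  by (auto simp: chains_def chain_projection_def)

lemma chain_projection_add: "chain_projection A (\<lambda>\<sigma>. x \<sigma> + y \<sigma>) = (\<lambda>\<sigma>. chain_projection A x \<sigma> + chain_projection A y \<sigma>)"
  and chain_projection_smult: "chain_projection A (\<lambda>\<sigma>. c * x \<sigma>) = (\<lambda>\<sigma>. c * chain_projection A x \<sigma>)"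
  for x y :: "'v set \<Rightarrow> 'f::field"
  by (auto simp: chain_projection_def)

lemma cochain_inclusion_cochain:
  assumes \<phi>: "\<phi> \<in> cochains d A"
  shows "cochain_inclusion d A B \<phi> \<in> cochains d B"
  unfolding cochain_inclusion_def cochains_def
  by (simp add: chains_add chains_smult chain_projection_add chain_projection_smult
      cochain_add[OF \<phi> chain_projection_chains chain_projection_chains]
      cochain_smult[OF \<phi> chain_projection_chains])

text \<open>
  Dual to projecting chains is extending coefficient functions by zero, and coefficient functions
  are total with value zero off their complex.
\<close>

lemma coefficients_cochain_inclusion:
  fixes \<phi> :: "('v set \<Rightarrow> 'f::field) \<Rightarrow> 'f"
  assumes \<phi>: "\<phi> \<in> cochains d A" and sub: "A \<subseteq> B"
  shows "coefficients d B (cochain_inclusion d A B \<phi>) = coefficients d A \<phi>"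
proof
  fix \<sigma>
  have z: "(\<lambda>_. 0) \<in> chains d A" by (simp add: chains_def)
  have "\<phi> (\<lambda>\<sigma>. 0 * 0) = 0 * \<phi> (\<lambda>_. 0)" by (rule cochain_smult[OF \<phi> z])
  moreover have "chain_projection A (unit_chain \<sigma> :: 'v set \<Rightarrow> 'f) = (if \<sigma> \<in> A then unit_chain \<sigma> else (\<lambda>_. 0))"
    by (auto simp: chain_projection_def unit_chain_def)
  ultimately show "coefficients d B (cochain_inclusion d A B \<phi>) \<sigma> = coefficients d A \<phi> \<sigma>"
    using sub by (auto simp: coefficients_def cochain_inclusion_def)
qed

lemma finite_supcomplex:
  assumes "finite_simplicial_complex K" "supcomplex K A"
  shows "finite A" and "\<tau> \<in> A \<Longrightarrow> finite \<tau>"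
proof -
  show "finite A"
    by (rule finite_subset[of A K]) (use assms in \<open>simp_all add: finite_simplicial_complex_def supcomplex_def\<close>)
  show "finite \<tau>" if "\<tau> \<in> A"
    using assms that unfolding finite_simplicial_complex_def supcomplex_def by blast
qed

lemma cochain_inclusion_cocycle:
  fixes \<phi> :: "('v::linorder set \<Rightarrow> 'f::field) \<Rightarrow> 'f"
  assumes K: "finite_simplicial_complex K" and A: "supcomplex K A" and B: "supcomplex K B" and sub: "A \<subseteq> B"
    and \<phi>: "\<phi> \<in> cocycles d A"
  shows "cochain_inclusion d A B \<phi> \<in> cocycles d B"
proof -
  note fin = finite_supcomplex[OF K]
  note \<phi>' = cocycle_cochain[OF \<phi>]
  have "simplicial_coboundary (coefficients d A \<phi>) \<tau> = 0" if "\<tau> \<in> B" "card \<tau> = Suc (Suc d)" for \<tau>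
  proof (cases "\<tau> \<in> A")
    case True
    then show ?thesis using \<phi> that cocycles_iff[OF fin[OF A], of \<phi> d] by blast
  next
    case False
    then show ?thesis
      using coboundary_outside_supcomplex[OF A supported_coefficients] B that by (auto simp: supcomplex_def)
  qed
  then show ?thesis
    by (simp add: cocycles_iff[OF fin[OF B]] cochain_inclusion_cochain[OF \<phi>'] coefficients_cochain_inclusion[OF \<phi>' sub])
qed

lemma cochain_inclusion_hom:
  fixes K :: "'v::linorder set set"
  assumes K: "finite_simplicial_complex K" and A: "supcomplex K A" and B: "supcomplex K B" and sub: "A \<subseteq> B"
  shows "cochain_inclusion d A B \<in> module_hom class_ring (cocycle_space d A) (cocycle_space d B :: ('f::field, _) module)"
    and "inj_on (cochain_inclusion d A B) (carrier (cocycle_space d A :: ('f::field, _) module))"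
proof -
  show "cochain_inclusion d A B \<in> module_hom class_ring (cocycle_space d A) (cocycle_space d B :: ('f::field, _) module)"
    by (rule module_homI, simp add: cochain_inclusion_cocycle[OF K A B sub])
      (simp_all add: cochain_inclusion_def chain_projection_chains cong: restrict_cong)
  note fin = finite_supcomplex(1)[OF K A]
  show "inj_on (cochain_inclusion d A B) (carrier (cocycle_space d A :: ('f::field, _) module))"
  proof (rule inj_onI)
    fix \<phi> \<psi> :: "('v set \<Rightarrow> 'f) \<Rightarrow> 'f"
    assume "\<phi> \<in> carrier (cocycle_space d A)" "\<psi> \<in> carrier (cocycle_space d A)"
      and eq: "cochain_inclusion d A B \<phi> = cochain_inclusion d A B \<psi>"
    then have *: "\<phi> \<in> cochains d A" "\<psi> \<in> cochains d A" by (auto simp: cocycle_cochain)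
    then show "\<phi> = \<psi>"
      using coefficients_cochain_inclusion[OF *(1) sub] coefficients_cochain_inclusion[OF *(2) sub] eq
      by (intro cochain_eqI[OF fin]) auto
  qed
qed

section \<open>Classes of simplicial cocycles\<close>

context finite_complex
begin

lemma underlying_space_eq: "underlying_space K A = subtopology space_K (underlying_set A)"
  by (simp only: underlying_space_def)

lemma topspace_underlying_space: "supcomplex K A \<Longrightarrow> topspace (underlying_space K A) = underlying_set A"
  using underlying_set_mono[OF supcomplex_subset, of A] by (auto simp: underlying_space_def)

lemma compactin_underlying_spaceD:
  assumes A: "supcomplex K A" and C: "compactin (underlying_space K A) C"
  shows "closedin space_K C" "C \<subseteq> underlying_set A"
  using C compactin_imp_closedin[OF Hausdorff_space_K, of C]
  by (auto simp: underlying_space_eq compactin_subtopology)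

text \<open>
  By excision, all classes on \<open>|A|\<close> come from cocycles on \<open>|K|\<close>.
\<close>

lemma cpt_class_restrict_surj:
  fixes x :: "(('v \<Rightarrow> real) set \<times> (('v \<Rightarrow> real) chain \<Rightarrow> 'f::field) set) set"
  assumes A: "supcomplex K A" and x: "x \<in> carrier (cpt_cohomology p (underlying_space K A))"
  obtains C \<phi> where "compactin (underlying_space K A) C"
    "\<phi> \<in> sing_cocycles p space_K (underlying_set K - C)"
    "x = cpt_class p (underlying_space K A) C (restrict \<phi> (singular_chain_set p (underlying_space K A)))"
proof -
  let ?X = "underlying_space K A"
  obtain C and \<xi> :: "('v \<Rightarrow> real) chain \<Rightarrow> 'f" where C: "compactin ?X C"
    and \<xi>: "\<xi> \<in> sing_cocycles p ?X (topspace ?X - C)" and x': "x = cpt_class p ?X C \<xi>"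
    using x unfolding cpt_cohomology_carrier by blast
  have \<xi>': "\<xi> \<in> sing_cocycles p (subtopology space_K (underlying_set A)) (underlying_set A - C)"
    using \<xi> unfolding topspace_underlying_space[OF A] unfolding underlying_space_eq .
  obtain \<phi> where \<phi>: "\<phi> \<in> sing_cocycles p space_K (topspace space_K - C)"
    "restrict \<phi> (singular_chain_set p (subtopology space_K (underlying_set A))) = \<xi>"
    by (rule excision_surj[OF openin_underlying_set[OF A] compactin_underlying_spaceD[OF A C] \<xi>'])
  show thesis
    by (rule that[OF C, of \<phi>]) (use \<phi> x' in \<open>simp_all add: underlying_space_eq\<close>)
qed

lemma restrict_to_supcomplex:
  fixes \<phi> :: "('v \<Rightarrow> real) chain \<Rightarrow> 'f::field"
  assumes "\<phi> \<in> sing_cocycles p space_K (underlying_set K - C)"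
  shows "restrict \<phi> (singular_chain_set p (underlying_space K A))
    \<in> sing_cocycles p (underlying_space K A) (topspace (underlying_space K A) - C)"
  unfolding underlying_space_eq by (rule restrict_cocycle) (use assms in simp)

lemma cpt_class_restrict_eq_iff:
  fixes \<phi> \<psi> :: "('v \<Rightarrow> real) chain \<Rightarrow> 'f::field"
  assumes A: "supcomplex K A"
    and C: "compactin (underlying_space K A) C" and \<phi>: "\<phi> \<in> sing_cocycles p space_K (underlying_set K - C)"
    and C': "compactin (underlying_space K A) C'" and \<psi>: "\<psi> \<in> sing_cocycles p space_K (underlying_set K - C')"
  shows "cpt_class p (underlying_space K A) C (restrict \<phi> (singular_chain_set p (underlying_space K A)))
      = cpt_class p (underlying_space K A) C' (restrict \<psi> (singular_chain_set p (underlying_space K A)))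
    \<longleftrightarrow> (\<exists>L. compactin (underlying_space K A) L \<and>
      (\<lambda>x\<in>singular_chain_set p space_K. \<phi> x - \<psi> x) \<in> sing_coboundaries p space_K (underlying_set K - L))"
proof -
  have top: "topspace space_K = underlying_set K" by simp
  show ?thesis
    unfolding cpt_class_eq_iff[OF C restrict_to_supcomplex[OF \<phi>] C' restrict_to_supcomplex[OF \<psi>]]
    using cpt_equiv_restrict_iff[OF Hausdorff_space_K openin_underlying_set[OF A], of C \<phi> p C' \<psi>] C \<phi> C' \<psi>
    unfolding underlying_space_eq top by blast
qed

lemma pull_add: "pull p (\<lambda>\<sigma>. a \<sigma> + b \<sigma>) x = pull p a x + pull p b x"
proof -
  have "alternate p (\<lambda>\<sigma>. a \<sigma> + b \<sigma>) t = alternate p a t + alternate p b t" for t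
    by (simp add: alternate_def sign_act_def)
  then show ?thesis by (simp only: pull_def frag_eval_def distrib_left sum.distrib)
qed

lemma pull_smult: "pull p (\<lambda>\<sigma>. k * a \<sigma>) x = k * pull p a x"
proof -
  have "alternate p (\<lambda>\<sigma>. k * a \<sigma>) t = k * alternate p a t" for t
    by (simp add: alternate_def sign_act_def)
  then show ?thesis by (simp only: pull_def frag_eval_def sum_distrib_left mult.left_commute)
qed

end

context refined_complex
begin

text \<open>
  The class in \<open>H\<^sub>c(|A|)\<close> of a simplicial cocycle: its realization on
  \<open>|K|\<close> has compact support \<open>thick A mesh\<close> in \<open>|A|\<close> and is
  restricted to \<open>|A|\<close>.
\<close>

definition classify :: "'v set set \<Rightarrow> nat \<Rightarrow> (('v set \<Rightarrow> 'f::field) \<Rightarrow> 'f) \<Rightarrow>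
    (('v \<Rightarrow> real) set \<times> (('v \<Rightarrow> real) chain \<Rightarrow> 'f) set) set"
  where "classify A d z = cpt_class d (underlying_space K A) (thick A mesh)
     (restrict (realize d (coefficients d A z)) (singular_chain_set d (underlying_space K A)))"

lemma coefficients_cocycle:
  fixes z :: "('v set \<Rightarrow> 'f::field) \<Rightarrow> 'f"
  assumes A: "supcomplex K A" and z: "z \<in> cocycles d A" and \<tau>: "\<tau> \<in> K" "card \<tau> = Suc (Suc d)"
  shows "simplicial_coboundary (coefficients d A z) \<tau> = 0"
proof (cases "\<tau> \<in> A")
  case True
  then show ?thesis using z \<tau>(2) cocycles_iff[OF finite_supcomplex[OF complex A], of z d] by blast
next
  case False
  then show ?thesis by (rule coboundary_outside_supcomplex[OF A supported_coefficients \<tau>(1)])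
qed

lemma realize_coefficients:
  fixes z :: "('v set \<Rightarrow> 'f::field) \<Rightarrow> 'f"
  assumes A: "supcomplex K A" and z: "z \<in> cocycles d A"
  shows "realize d (coefficients d A z) \<in> sing_cocycles d space_K (underlying_set K - thick A mesh)"
  by (rule realize_cocycle[OF supported_coefficients coefficients_cocycle[OF A z]])

lemma coefficients_add:
  "coefficients d A (\<lambda>x\<in>chains d A. f x + g x) = (\<lambda>\<sigma>. coefficients d A f \<sigma> + coefficients d A g \<sigma>)"
  and coefficients_smult:
  "coefficients d A (\<lambda>x\<in>chains d A. k * f x) = (\<lambda>\<sigma>. k * coefficients d A f \<sigma>)"
  by (auto simp: coefficients_def fun_eq_iff)

lemma classify_hom:
  assumes A: "supcomplex K A"
  shows "classify A d \<in> module_hom class_ring (cocycle_space d A :: ('f::field, _) module)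
     (cpt_cohomology d (underlying_space K A))"
proof (rule module_homI)
  let ?X = "underlying_space K A"
  note cpt = compactin_thick[OF A mesh_pos]
  note coc = restrict_to_supcomplex[OF realize_coefficients[OF A], of _ d A]
  have inX: "singular_chain d space_K x" if "singular_chain d ?X x" for x
    using that unfolding underlying_space_eq singular_chain_subtopology[of d space_K] by (rule conjunct1)
  fix f assume "f \<in> carrier (cocycle_space d A :: ('f, _) module)"
  then have f: "f \<in> cocycles d A" by simp
  show "classify A d f \<in> carrier (cpt_cohomology d ?X)"
    unfolding classify_def cpt_cohomology_carrier using cpt coc[OF f] by blast
  show "classify A d (k \<odot>\<^bsub>cocycle_space d A\<^esub> f) = k \<odot>\<^bsub>cpt_cohomology d ?X\<^esub> classify A d f" for k
    unfolding classify_def cpt_cohomology_smult[OF cpt coc[OF f]]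
    by (rule arg_cong[of _ _ "cpt_class d ?X (thick A mesh)"], rule restrict_ext)
      (simp add: coefficients_smult realize_def inX pull_smult)
  fix g assume "g \<in> carrier (cocycle_space d A :: ('f, _) module)"
  then have g: "g \<in> cocycles d A" by simp
  show "classify A d (f \<oplus>\<^bsub>cocycle_space d A\<^esub> g) = classify A d f \<oplus>\<^bsub>cpt_cohomology d ?X\<^esub> classify A d g"
    unfolding classify_def cpt_cohomology_add[OF cpt coc[OF f] cpt coc[OF g]] Un_absorb
    by (rule arg_cong[of _ _ "cpt_class d ?X (thick A mesh)"], rule restrict_ext)
      (simp add: coefficients_add realize_def inX pull_add)
qed

text \<open>
  A class is represented by a cocycle supported in some compact \<open>C \<subseteq> |A|\<close>,
  and \<open>C\<close> lies in \<open>thick A \<delta>\<close> for small \<open>\<delta>\<close>.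
  Sampling this cocycle gives a simplicial cocycle whose realization is cohomologous to it with
  support in \<open>thick A \<delta>\<close>.
\<close>

lemma classify_surj:
  assumes A: "supcomplex K A"
  shows "classify A d ` carrier (cocycle_space d A :: ('f::field, _) module)
     = carrier (cpt_cohomology d (underlying_space K A))"
proof (intro equalityI subsetI)
  fix y :: "(('v \<Rightarrow> real) set \<times> (('v \<Rightarrow> real) chain \<Rightarrow> 'f) set) set"
  assume "y \<in> classify A d ` carrier (cocycle_space d A :: ('f, _) module)"
  then show "y \<in> carrier (cpt_cohomology d (underlying_space K A))"
    using module_hom_closed[OF classify_hom[OF A, of d, where 'f = 'f]] by blast
next
  fix y :: "(('v \<Rightarrow> real) set \<times> (('v \<Rightarrow> real) chain \<Rightarrow> 'f) set) set"
  assume "y \<in> carrier (cpt_cohomology d (underlying_space K A))"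
  then obtain C \<phi> where C: "compactin (underlying_space K A) C"
    and \<phi>: "\<phi> \<in> sing_cocycles d space_K (underlying_set K - C)"
    and y: "y = cpt_class d (underlying_space K A) C (restrict \<phi> (singular_chain_set d (underlying_space K A)))"
    by (rule cpt_class_restrict_surj[OF A])
  obtain \<delta> where \<delta>: "0 < \<delta>" "\<delta> \<le> mesh" and sub: "C \<subseteq> thick A \<delta>"
    by (rule compact_subset_thick[OF A C])
  have CA: "C \<subseteq> underlying_set A" by (rule compactin_underlying_spaceD(2)[OF A C])
  let ?c = "sample A d \<phi>"
  let ?z = "functional d A ?c"
  note fin = finite_supcomplex[OF complex A]
  have coef: "coefficients d A ?z = ?c" by (rule coefficients_functional[OF fin(1) supported_sample])
  have "simplicial_coboundary ?c \<tau> = 0" if "\<tau> \<in> A" "card \<tau> = Suc (Suc d)" for \<tau>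
  proof -
    have \<tau>: "\<tau> \<in> K" using that(1) A by (auto simp: supcomplex_def)
    show ?thesis
      unfolding sample_coboundary[OF A CA sing_cocycle_cochain[OF \<phi>] \<tau> that(2)]
      using \<phi> geom_simplex_in_K[OF \<tau> that(2)] unfolding sing_cocycles_iff by blast
  qed
  then have z: "?z \<in> cocycles d A"
    by (simp add: cocycles_iff[OF fin] functional_cochain coef)
  have "classify A d ?z = y"
    unfolding classify_def y
    by (rule iffD2[OF cpt_class_restrict_eq_iff[OF A compactin_thick[OF A mesh_pos] realize_coefficients[OF A z] C \<phi>]],
      rule exI[of _ "thick A \<delta>"], unfold coef)
      (intro conjI compactin_thick[OF A] \<delta> realize_sample_cohomologous[OF A \<delta> sub \<phi>])
  from this[symmetric] show "y \<in> classify A d ` carrier (cocycle_space d A :: ('f, _) module)"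
    by (rule image_eqI[where f = "classify A d" and x = ?z]) (simp add: z)
qed

lemma classify_eq_zero_iff:
  fixes z :: "('v set \<Rightarrow> 'f::field) \<Rightarrow> 'f"
  assumes A: "supcomplex K A" and z: "z \<in> cocycles d A"
  shows "classify A d z = \<zero>\<^bsub>cpt_cohomology d (underlying_space K A)\<^esub> \<longleftrightarrow> z \<in> coboundaries d A"
proof -
  let ?X = "underlying_space K A" and ?c = "coefficients d A z"
  let ?r = "realize d ?c" and ?o = "\<lambda>x\<in>singular_chain_set d space_K. 0 :: 'f"
  note fin = finite_supcomplex[OF complex A]
  note cpt = compactin_thick[OF A mesh_pos]
  have cob: "z \<in> coboundaries d A \<longleftrightarrow> (\<exists>b. (\<forall>q. d = Suc q \<longrightarrow> supported A q b) \<and>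
     (\<forall>\<tau>\<in>A. card \<tau> = Suc d \<longrightarrow> ?c \<tau> = (if d = 0 then 0 else simplicial_coboundary b \<tau>)))"
    by (rule coboundaries_iff[OF fin cocycle_cochain[OF z]])
  have inX: "singular_chain d space_K x" if "singular_chain d ?X x" for x
    using that unfolding underlying_space_eq singular_chain_subtopology[of d space_K] by (rule conjunct1)
  have zero: "\<zero>\<^bsub>cpt_cohomology d ?X\<^esub> = cpt_class d ?X (thick A mesh) (restrict ?o (singular_chain_set d ?X))"
    unfolding cpt_cohomology_zero[OF cpt]
    by (rule arg_cong[of _ _ "cpt_class d ?X (thick A mesh)"], rule restrict_ext) (simp add: inX)
  have diff: "(\<lambda>x\<in>singular_chain_set d space_K. ?r x - ?o x) = ?r"
    by (simp add: realize_def cong: restrict_cong)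
  have iff: "classify A d z = \<zero>\<^bsub>cpt_cohomology d ?X\<^esub>
    \<longleftrightarrow> (\<exists>L. compactin ?X L \<and> ?r \<in> sing_coboundaries d space_K (underlying_set K - L))"
    unfolding classify_def zero
      cpt_class_restrict_eq_iff[OF A cpt realize_coefficients[OF A z] cpt zero_cocycle] diff ..
  show ?thesis
    unfolding iff
  proof
    assume "\<exists>L. compactin ?X L \<and> ?r \<in> sing_coboundaries d space_K (underlying_set K - L)"
    then obtain L where L: "compactin ?X L" "?r \<in> sing_coboundaries d space_K (underlying_set K - L)"
      by (elim exE conjE)
    obtain b where "\<And>q. d = Suc q \<Longrightarrow> supported A q b"
      "\<And>\<tau>. \<tau> \<in> K \<Longrightarrow> card \<tau> = Suc d \<Longrightarrow> ?c \<tau> = (if d = 0 then 0 else simplicial_coboundary b \<tau>)"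
      by (rule realize_coboundary_imp[OF A compactin_underlying_spaceD(2)[OF A L(1)] L(2)]) blast
    then show "z \<in> coboundaries d A"
      unfolding cob using supcomplex_subset[OF A] by blast
  next
    assume "z \<in> coboundaries d A"
    then obtain b where b: "\<And>q. d = Suc q \<Longrightarrow> supported A q b"
      and eq: "\<And>\<tau>. \<tau> \<in> A \<Longrightarrow> card \<tau> = Suc d \<Longrightarrow> ?c \<tau> = (if d = 0 then 0 else simplicial_coboundary b \<tau>)"
      unfolding cob by blast
    have "?r \<in> sing_coboundaries d space_K (underlying_set K - thick A mesh)"
    proof (cases d)
      case 0
      have "?c = (\<lambda>\<sigma>. 0 * ?c \<sigma>)"
      proof
        fix \<sigma>
        show "?c \<sigma> = 0 * ?c \<sigma>" using eq[of \<sigma>] by (cases "\<sigma> \<in> A \<and> card \<sigma> = Suc d") (auto simp: 0 coefficients_def)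
      qed
      then have "pull d ?c x = 0 * pull d ?c x" for x by (metis pull_smult)
      then have "?r = ?o" by (simp add: realize_def)
      then show ?thesis using linear_subset.zero[OF linear_subset_coboundaries] by simp
    next
      case (Suc e)
      have "?c \<tau> = simplicial_coboundary b \<tau>" if "\<tau> \<in> K" "card \<tau> = Suc (Suc e)" for \<tau>
      proof (cases "\<tau> \<in> A")
        case True
        then show ?thesis using eq[of \<tau>] that Suc by simp
      next
        case False
        then show ?thesis
          using coboundary_outside_supcomplex[OF A b[OF Suc] that(1)] by (simp add: coefficients_def)
      qed
      then show ?thesis unfolding Suc by (intro realize_coboundary[OF b[OF Suc]]) (simp add: Suc)
    qed
    with cpt show "\<exists>L. compactin ?X L \<and> ?r \<in> sing_coboundaries d space_K (underlying_set K - L)"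
      by (intro exI conjI)
  qed
qed

text \<open>
  The realization depends only on the coefficients, which do not change under inclusion; the same
  cocycle of \<open>|K|\<close> represents both sides.
\<close>

lemma cpt_extension_classify:
  fixes z :: "('v set \<Rightarrow> 'f::field) \<Rightarrow> 'f"
  assumes A: "supcomplex K A" and B: "supcomplex K B" and sub: "A \<subseteq> B" and z: "z \<in> cocycles d A"
  shows "cpt_extension d (underlying_space K A) (underlying_space K B) (classify A d z)
    = classify B d (cochain_inclusion d A B z)"
proof -
  let ?X = "underlying_space K A" and ?Y = "underlying_space K B"
  let ?r = "realize d (coefficients d A z)"
  let ?\<psi> = "restrict ?r (singular_chain_set d ?Y)"
  have uAB: "underlying_set A \<subseteq> underlying_set B" by (rule underlying_set_mono[OF sub])
  have X: "?X = subtopology ?Y (underlying_set A)"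
    unfolding underlying_space_eq subtopology_subtopology Int_assoc Int_absorb1[OF uAB] ..
  have H: "Hausdorff_space ?Y"
    unfolding underlying_space_eq by (rule Hausdorff_space_subtopology[OF Hausdorff_space_K])
  have op: "openin ?Y (underlying_set A)"
    using openin_subtopology_Int[OF openin_underlying_set[OF A], of "underlying_set B"]
    unfolding underlying_space_eq Int_absorb2[OF uAB] .
  have cptX: "compactin (subtopology ?Y (underlying_set A)) (thick A mesh)"
    using compactin_thick[OF A mesh_pos] unfolding X .
  have cptY: "compactin ?Y (thick A mesh)" using cptX by (simp add: compactin_subtopology)
  note z' = cochain_inclusion_cocycle[OF complex A B sub z]
  note coef = coefficients_cochain_inclusion[OF cocycle_cochain[OF z] sub]
  note \<psi> = restrict_to_supcomplex[OF realize_coefficients[OF A z], of B]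
  have in_Y: "singular_chain d ?Y x" if "singular_chain d ?X x" for x
    using that unfolding X by (simp add: singular_chain_subtopology)
  have "classify A d z = cpt_class d ?X (thick A mesh) (restrict ?\<psi> (singular_chain_set d ?X))"
    unfolding classify_def by (rule arg_cong[of _ _ "cpt_class d ?X (thick A mesh)"], rule restrict_ext) (simp add: in_Y)
  then have "cpt_extension d ?X ?Y (classify A d z) = cpt_class d ?Y (thick A mesh) ?\<psi>"
    using cpt_extension_class[OF H op cptX \<psi>] unfolding X[symmetric] by simp
  also have "\<dots> = cpt_class d ?Y (thick B mesh) ?\<psi>"
    by (rule iffD2[OF cpt_class_eq_iff[OF cptY \<psi> compactin_thick[OF B mesh_pos]] cpt_equiv_refl[OF refl]])
      (rule restrict_to_supcomplex[OF realize_coefficients[OF B z', unfolded coef]])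
  also have "\<dots> = classify B d (cochain_inclusion d A B z)"
    unfolding classify_def coef ..
  finally show ?thesis .
qed

end

context refined_complex
begin

lemma classify_zero:
  assumes A: "supcomplex K A"
  shows "classify A d \<zero>\<^bsub>cocycle_space d A :: ('f::field, _) module\<^esub> = \<zero>\<^bsub>cpt_cohomology d (underlying_space K A)\<^esub>"
proof -
  let ?z = "\<lambda>x\<in>chains d A. 0 :: 'f"
  have z: "?z \<in> cocycles d A" by (rule linear_subset.zero[OF linear_subset_simplicial_cocycles])
  have "?z \<in> coboundaries d A \<longleftrightarrow> (\<exists>b. (\<forall>q. d = Suc q \<longrightarrow> supported A q b) \<and>
     (\<forall>\<tau>\<in>A. card \<tau> = Suc d \<longrightarrow> coefficients d A ?z \<tau> = (if d = 0 then 0 else simplicial_coboundary b \<tau>)))"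
    by (rule coboundaries_iff[OF finite_supcomplex[OF complex A] cocycle_cochain[OF z]])
  moreover have "\<dots>"
    by (rule exI[of _ "\<lambda>_. 0"]) (simp add: supported_def simplicial_coboundary_def coefficients_def)
  ultimately show ?thesis using classify_eq_zero_iff[OF A z] by simp
qed

lemma vectorspace_cpt_cohomology:
  assumes A: "supcomplex K A"
  shows "vectorspace class_ring (cpt_cohomology d (underlying_space K A) :: ('f::field, _) module)"
proof (rule vectorspace_hom_image)
  show "vectorspace class_ring (cocycle_space d A :: ('f, _) module)"
    by (rule fin_dim_cocycle_space(1)[OF finite_supcomplex(1)[OF complex A]])
qed (fact classify_hom[OF A] classify_surj[OF A] classify_zero[OF A])+

end

section \<open>Birth-death functions\<close>

text \<open>
  In a direct sum of modules \<open>up_module c\<close>, an element over \<open>a\<close> has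
  nonzero entries only for \<open>c \<le> a\<close>, and these are kept by the transition to
  \<open>b\<close>.
\<close>

lemma free_module_tr_inj:
  fixes E :: "('p::{finite, order}, 'f::field, 'e) pmodule"
  assumes E: "free_module E" and ab: "a \<le> b"
  shows "inj_on (tr E a b) (carrier (obj E a))"
proof (rule inj_onI)
  fix x y assume x: "x \<in> carrier (obj E a)" and y: "y \<in> carrier (obj E a)" and eq: "tr E a b x = tr E a b y"
  obtain I :: "nat set" and g where "pmodule_isomorphic E (direct_sum I (\<lambda>i. up_module (g i)))"
    using E unfolding free_module_def by blast
  let ?S = "direct_sum I (\<lambda>i. up_module (g i)) :: ('p, 'f, nat \<Rightarrow> 'f) pmodule"
  obtain \<eta> where nat: "natural_transformation E ?S \<eta>"
    and bij: "\<And>a. bij_betw (\<eta> a) (carrier (obj E a)) (carrier (obj ?S a))"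
    using \<open>pmodule_isomorphic E _\<close> unfolding pmodule_isomorphic_def by blast
  have natural: "\<eta> b (tr E a b u) = tr ?S a b (\<eta> a u)" if "u \<in> carrier (obj E a)" for u
    using nat ab that unfolding natural_transformation_def by blast
  have keep: "tr ?S a b u = u" if "u \<in> carrier (obj ?S a)" for u
  proof -
    have u: "u \<in> (\<Pi>\<^sub>E i\<in>I. if g i \<le> a then UNIV else {0})"
      using that by (simp add: direct_sum_def up_module_def)
    have "(if g i \<le> a \<and> a \<le> b then u i else 0) = u i" if "i \<in> I" for i
      using PiE_mem[OF u that] ab by (simp split: if_splits)
    then have "(\<lambda>i\<in>I. if g i \<le> a \<and> a \<le> b then u i else 0) = restrict u I" by (rule restrict_ext)
    also have "\<dots> = u" using u by (simp add: PiE_def extensional_restrict)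
    finally show ?thesis by (simp add: direct_sum_def up_module_def)
  qed
  have "\<eta> a u \<in> carrier (obj ?S a)" if "u \<in> carrier (obj E a)" for u
    using bij_betw_apply[OF bij that] .
  then have "\<eta> a x = \<eta> a y" using natural[OF x] natural[OF y] eq keep x y by metis
  then show "x = y" using bij_betw_imp_inj_on[OF bij] x y by (auto dest: inj_onD)
qed

theorem proposition6p4:
  fixes K :: "'v::linorder set set"
    and F :: "'p::{finite, order} \<Rightarrow> 'v set set"
    and d :: nat
    and E :: "('p, 'f::field, 'e) pmodule"
    and \<phi> :: "'p \<Rightarrow> 'e \<Rightarrow> (('v \<Rightarrow> real) set \<times> (('v \<Rightarrow> real) chain \<Rightarrow> 'f) set) set"
  assumes "finite_simplicial_complex K"
    and "cofiltration K F"
    and "free_presentation E (cohomology_pmodule d K F) \<phi>"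
  shows "moebius_inversion Int_poset (ZB_cofiltration TYPE('f) d F)
    \<sim>\<^sub>I moebius_inversion Int_poset (ZB_presentation E (cohomology_pmodule d K F) \<phi>)"
proof -
  interpret finite_complex K by (unfold_locales) (rule assms(1))
  obtain \<rho> D where retraction: "small_retraction space_K fine_cover \<rho> D"
    by (rule small_retraction_exists[OF openin_fine_cover fine_cover_covers])
  interpret refined_complex K \<rho> D
    by (intro refined_complex.intro refined_complex_axioms.intro finite_complex_axioms retraction)
  let ?M = "cohomology_pmodule d K F :: ('p, 'f, _) pmodule"
  let ?Z = "\<lambda>a. cocycle_space d (F a) :: ('f, _) module"
  let ?dim = "\<lambda>V. vectorspace.dim class_ring V"
  have M: "obj ?M a = cpt_cohomology d (underlying_space K (F a))"
    "tr ?M a b = cpt_extension d (underlying_space K (F a)) (underlying_space K (F b))" for a b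
    by (simp_all add: cohomology_pmodule_def)
  have sup: "supcomplex K (F a)" for a using assms(2) by (simp add: cofiltration_def)
  have mono: "F a \<subseteq> F b" if "a \<le> b" for a b using assms(2) that by (auto simp: cofiltration_def mono_def)
  have free: "free_module E" and nat: "natural_transformation E ?M \<phi>"
    and surj: "\<phi> a ` carrier (obj E a) = carrier (obj ?M a)" for a
    using assms(3) by (auto simp: free_presentation_def)
  then have pers: "persistence_module E" by (simp add: free_module_def)
  show ?thesis
  proof (rule int_equiv_moebius_inversion)
    fix a b :: 'p assume ab: "a \<le> b"
    let ?R = "(obj ?M b)\<lparr>carrier := tr ?M a b ` carrier (obj ?M a)\<rparr>"
    have vsM: "vectorspace class_ring (obj ?M b)" unfolding M by (rule vectorspace_cpt_cohomology[OF sup])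
    have E: "vectorspace class_ring (obj E c)" "vectorspace.fin_dim class_ring (obj E c)"
      "tr E a b \<in> module_hom class_ring (obj E a) (obj E b)" for c
      using pers ab by (auto simp: persistence_module_def)
    have \<phi>b: "\<phi> b \<in> module_hom class_ring (obj E b) (obj ?M b)"
      and natural: "\<And>x. x \<in> carrier (obj E a) \<Longrightarrow> \<phi> b (tr E a b x) = tr ?M a b (\<phi> a x)"
      using nat ab by (auto simp: natural_transformation_def)
    \<comment> \<open>Both \<open>E(a)\<close> and the cocycles of \<open>F(a)\<close> map onto \<open>M(a)\<close>, so both have the image of \<open>M(a)\<close> in \<open>M(b)\<close>,
      which is the carrier of \<open>?R\<close>.\<close>
    have "\<phi> b ` tr E a b ` carrier (obj E a) = tr ?M a b ` \<phi> a ` carrier (obj E a)"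
      unfolding image_image by (rule image_cong[OF refl natural])
    then have imE: "\<phi> b ` tr E a b ` carrier (obj E a) = tr ?M a b ` carrier (obj ?M a)"
      by (simp only: surj)
    have "ZB_presentation E ?M \<phi> (a, b) + int (?dim ?R) = int (?dim (obj E a))"
      using dim_kernel_in_image[OF E(1,2) E(1) vsM E(3) free_module_tr_inj[OF free ab] \<phi>b]
      unfolding imE by (simp add: ZB_presentation_def flip: of_nat_add)
    moreover
    note Z = fin_dim_cocycle_space[OF finite_supcomplex(1)[OF complex sup], of d _, where 'f = 'f]
    note incl = cochain_inclusion_hom[OF complex sup sup mono[OF ab], of d, where 'f = 'f]
    have "classify (F b) d ` cochain_inclusion d (F a) (F b) ` carrier (?Z a)
        = tr ?M a b ` classify (F a) d ` carrier (?Z a)"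
      unfolding image_image M
      by (rule image_cong[OF refl]) (simp add: cpt_extension_classify[OF sup sup mono[OF ab]])
    then have imZ: "classify (F b) d ` cochain_inclusion d (F a) (F b) ` carrier (?Z a)
        = tr ?M a b ` carrier (obj ?M a)"
      by (simp only: classify_surj[OF sup] M)
    have kernel: "{z \<in> carrier (?Z b). classify (F b) d z = \<zero>\<^bsub>obj ?M b\<^esub>}
        = cocycles d (F b) \<inter> coboundaries d (F b)"
      by (simp add: M classify_eq_zero_iff[OF sup] Int_def cong: conj_cong)
    have ker: "cochain_inclusion d (F a) (F b) ` carrier (?Z a)
          \<inter> {z \<in> carrier (?Z b). classify (F b) d z = \<zero>\<^bsub>obj ?M b\<^esub>}
        = cochain_inclusion d (F a) (F b) ` cocycles d (F a) \<inter> coboundaries d (F b)"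
      unfolding kernel using cochain_inclusion_cocycle[OF complex sup sup mono[OF ab], of _ d, where 'f = 'f] by auto
    have cl: "classify (F b) d \<in> module_hom class_ring (?Z b) (obj ?M b)"
      unfolding M by (rule classify_hom[OF sup])
    have "ZB_cofiltration TYPE('f) d F (a, b) + int (?dim ?R) = int (?dim (?Z a))"
      using dim_kernel_in_image[OF Z Z(1) vsM incl cl]
      unfolding imZ ker by (simp add: ZB_cofiltration_def flip: of_nat_add)
    ultimately show "ZB_presentation E ?M \<phi> (a, b)
      = ZB_cofiltration TYPE('f) d F (a, b) + (int (?dim (obj E a)) - int (?dim (?Z a)))"
      by simp
  qed
qed

end
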